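(* For almost every $\mathbf{y}\in\square$ and all $\boldsymbol{\alpha}\in\mathbb{N}_0^M$, the derivatives with respect to $\mathbf{y}$ of the solution $u(\mathbf{y})\in V$ of the parametric weak problem $$\int_D \big\langle \mathbf{A}(\mathbf{x},\mathbf{y})\nabla_{\mathbf{x}}u(\mathbf{x},\mathbf{y}),\nabla_{\mathbf{x}} v(\mathbf{x})\big\rangle\,\mathrm{d}\mathbf{x}=\int_D f(\mathbf{x})v(\mathbf{x})\,\mathrm{d}\mathbf{x}+\int_{\Gamma_N}g(\mathbf{x})v(\mathbf{x})\,\mathrm{d}s\quad\text{for all }v\in V$$ satisfy $$\big\|\partial_{\mathbf{y}}^{\boldsymbol{\alpha}}u(\mathbf{y})\big\|_{H^1(D)}\le |\boldsymbol{\alpha}|!\,\boldsymbol{\mu}^{\boldsymbol{\alpha}}\left(\frac{a_{\max}}{a_{\min}c_V^2}\max\Big\{2c_{\mathbf{A}},\ \|f\|_{\widetilde H^{-1}(D)}+\|g\|_{H^{-1/2}(\Gamma_N)}\Big\}\right)^{|\boldsymbol{\alpha}|+1}.$$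
   Context: Setting for the diffusion coefficient. $(\Omega,\mathcal{F},\mathbb{P})$ is a separable, complete probability space, $D\subset\mathbb{R}^d$ ($d\ge1$) is a bounded Lipschitz domain. $\mathbb{R}^d$ carries the Euclidean norm $\|\cdot\|_2$. $\mathbf{V}\in L^\infty_{\mathbb{P}}(\Omega;L^\infty(D;\mathbb{R}^d))$ is a random vector field (vector values are columns) with mean $\mathbb{E}[\mathbf{V}]$ and matrix covariance $\operatorname{Cov}[\mathbf{V}](\mathbf{x},\mathbf{x}')=\int_\Omega \mathbf{V}_0(\mathbf{x},\omega)\mathbf{V}_0^{\mathsf T}(\mathbf{x}',\omega)\,\mathrm{d}\mathbb{P}(\omega)$, $\mathbf{V}_0=\mathbf{V}-\mathbb{E}[\mathbf{V}]$. $(\lambda_k,\boldsymbol\psi_k)$, $\lambda_k>0$, are the eigenpairs ($\boldsymbol\psi_k$ orthonormal in $L^2(D;\mathbb{R}^d)$) of the integral operator on $L^2(D;\mathbb{R}^d)$ with kernel $\operatorname{Cov}[\mathbf{V}]$, and $Y_k=\lambda_k^{-1/2}\int_D\mathbf{V}_0^{\mathsf T}(\mathbf{x},\cdot)\boldsymbol\psi_k(\mathbf{x})\,\mathrm{d}\mathbf{x}$ are assumed independent and uniformly distributed on $[-\sqrt3,\sqrt3]$. Put $\sigma_k=\sqrt{3\lambda_k}$, $y_k=Y_k/\sqrt3\in[-1,1]$, $\boldsymbol\psi_0=\mathbb{E}[\mathbf{V}]$, $\sigma_0=1$, $\gamma_k=\|\sigma_k\boldsymbol\psi_k\|_{L^\infty(D;\mathbb{R}^d)}<\infty$.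 $\mathbf{V}$ is assumed to have the finite rank expansion $$\mathbf{V}(\mathbf{x},\mathbf{y})=\boldsymbol\psi_0(\mathbf{x})+\sum_{k=1}^M\sigma_k\boldsymbol\psi_k(\mathbf{x})y_k,\qquad \mathbf{y}\in\square=[-1,1]^{\mathbb{N}},$$ (only $y_1,\dots,y_M$ enter), where $\square$ carries the product $\mathbb{P}_{\mathbf{y}}$ of the uniform distributions on $[-1,1]$. There are constants $0<a_{\min}\le1\le a_{\max}<\infty$ with $a_{\min}\le\|\mathbf{V}(\mathbf{x},\mathbf{y})\|_2\le a_{\max}$ for almost every $\mathbf{y}\in\square$ and almost every $\mathbf{x}\in D$, and $a\in[a_{\min},a_{\max}]$ is a given number. The diffusion coefficient is $$\mathbf{A}(\mathbf{x},\mathbf{y})=a\mathbf{I}+\big(\|\mathbf{V}(\mathbf{x},\mathbf{y})\|_2-a\big)\frac{\mathbf{V}(\mathbf{x},\mathbf{y})\mathbf{V}^{\mathsf T}(\mathbf{x},\mathbf{y})}{\mathbf{V}^{\mathsf T}(\mathbf{x},\mathbf{y})\mathbf{V}(\mathbf{x},\mathbf{y})}.$$ Boundary value problem. $\partial D=\overline{\Gamma}_D\cup\overline{\Gamma}_N$ is a disjoint decomposition of the boundary; $f\in\widetilde H^{-1}(D)$ (the dual of $H^1(D)$, with the dual norm) and $g\in H^{-1/2}(\Gamma_N)$ (the dual of the trace space $H^{1/2}(\Gamma_N)$, the latter normed by $\|w\|=\inf\{\|v\|_{H^1(D)}: v\in H^1(D),\ v|_{\Gamma_N}=w\}$, with the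 dual norm). The integrals $\int_D fv$ and $\int_{\Gamma_N}gv$ are understood as duality pairings. If $\Gamma_D$ has non-zero boundary measure, $V=H^1_{\Gamma_D}(D)=\{v\in H^1(D): v=0\text{ on }\Gamma_D\}$; if $\Gamma_D$ has zero boundary measure, $V=\{v\in H^1(D):(v,1)_{L^2(D)}=0\}$ and it is required that $\int_D f\,\mathrm{d}\mathbf{x}=-\int_{\Gamma_N}g\,\mathrm{d}s$. The constant $0<c_V\le1$ is such that $c_V\|v\|_{H^1(D)}\le\|\nabla_{\mathbf{x}}v\|_{L^2(D;\mathbb{R}^d)}\le\|v\|_{H^1(D)}$ for all $v\in V$. For almost every $\mathbf{y}$ the weak problem has a unique solution $u(\mathbf{y})\in V$. Constants and multi-index notation. $$\mu_k=\frac{4a_{\max}^2}{a_{\min}^2\log2}\gamma_k,\qquad c_{\mathbf{A}}=(2a_{\max})\frac{6a_{\max}^2}{a_{\min}^2}.$$ For $\boldsymbol\alpha\in\mathbb{N}_0^M$: $|\boldsymbol\alpha|=\sum_k\alpha_k$, $\boldsymbol\mu^{\boldsymbol\alpha}=\prod_{k=1}^M\mu_k^{\alpha_k}$, $\partial_{\mathbf{y}}^{\boldsymbol\alpha}=\partial_{y_1}^{\alpha_1}\cdots\partial_{y_M}^{\alpha_M}$ (derivatives of $u$ as a $V$-valued map). *)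

theory Defs
  imports "HOL-Probability.Probability"
begin

section \<open>Lebesgue spaces\<close>

text \<open>Elements of all function spaces are represented by functions; equality in the space is
  equality almost everywhere, and norms are seminorms on representatives.  Functions on
  \<open>D\<close> are total functions whose values off \<open>D\<close> are irrelevant.\<close>

definition L2 :: "'a measure \<Rightarrow> ('a \<Rightarrow> 'b::euclidean_space) set" where
  "L2 N = {f. f \<in> borel_measurable N \<and> integrable N (\<lambda>x. (norm (f x))\<^sup>2)}"

definition L2_norm :: "'a measure \<Rightarrow> ('a \<Rightarrow> 'b::euclidean_space) \<Rightarrow> real" where
  "L2_norm N f = sqrt (\<integral>x. (norm (f x))\<^sup>2 \<partial>N)"

definition Linf_norm :: "'a measure \<Rightarrow> ('a \<Rightarrow> 'b::euclidean_space) \<Rightarrow> ereal" where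
  "Linf_norm N f = esssup N (\<lambda>x. ereal (norm (f x)))"

definition Linf :: "'a measure \<Rightarrow> ('a \<Rightarrow> 'b::euclidean_space) set" where
  "Linf N = {f. f \<in> borel_measurable N \<and> Linf_norm N f < \<infinity>}"

text \<open>The Bochner space of strongly measurable, essentially bounded maps from \<open>P\<close> into the
  (non-separable) space \<open>Linf N\<close>.  Joint measurability is a condition on the
  choice of representatives: without it the pointwise formulas for mean and covariance below
  would depend on how the representative of \<open>V \<omega>\<close> is chosen for each \<open>\<omega>\<close>.\<close>

definition Linf_Bochner ::
    "'o measure \<Rightarrow> 'a measure \<Rightarrow> ('o \<Rightarrow> 'a \<Rightarrow> 'b::euclidean_space) set" where
  "Linf_Bochner P N = {V.
      case_prod V \<in> borel_measurable (P \<Otimes>\<^sub>M N) \<and>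
      (\<exists>S. (\<forall>n::nat. simple_function P (S n) \<and> (\<forall>\<omega>\<in>space P. S n \<omega> \<in> Linf N)) \<and>
           (AE \<omega> in P. (\<lambda>n. Linf_norm N (\<lambda>x. V \<omega> x - S n \<omega> x)) \<longlonglongrightarrow> 0)) \<and>
      (\<exists>C::real. AE \<omega> in P. Linf_norm N (V \<omega>) \<le> ereal C)}"

section \<open>Probability spaces and random fields\<close>

text \<open>Separability of the measure algebra, with the metric given by the measure of the
  symmetric difference.\<close>

definition separable_measure_space :: "'o measure \<Rightarrow> bool" where
  "separable_measure_space P \<longleftrightarrow>
     (\<exists>\<C>. countable \<C> \<and> \<C> \<subseteq> sets P \<and>
        (\<forall>A\<in>sets P. \<forall>e>0. \<exists>B\<in>\<C>. measure P ((A - B) \<union> (B - A)) < e))"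

definition outer_prod :: "real^'n \<Rightarrow> real^'m \<Rightarrow> real^'m^'n" where
  "outer_prod v w = (\<chi> i j. v $ i * w $ j)"

definition mean_field :: "'o measure \<Rightarrow> ('o \<Rightarrow> 'a \<Rightarrow> real^'d) \<Rightarrow> 'a \<Rightarrow> real^'d" where
  "mean_field P V x = (\<integral>\<omega>. V \<omega> x \<partial>P)"

definition centred_field ::
    "'o measure \<Rightarrow> ('o \<Rightarrow> 'a \<Rightarrow> real^'d) \<Rightarrow> 'o \<Rightarrow> 'a \<Rightarrow> real^'d" where
  "centred_field P V \<omega> x = V \<omega> x - mean_field P V x"

definition cov_field ::
    "'o measure \<Rightarrow> ('o \<Rightarrow> 'a \<Rightarrow> real^'d) \<Rightarrow> 'a \<Rightarrow> 'a \<Rightarrow> real^'d^'d" where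
  "cov_field P V x x' =
     (\<integral>\<omega>. outer_prod (centred_field P V \<omega> x) (centred_field P V \<omega> x') \<partial>P)"

definition cov_operator ::
    "'o measure \<Rightarrow> 'a measure \<Rightarrow> ('o \<Rightarrow> 'a \<Rightarrow> real^'d) \<Rightarrow> ('a \<Rightarrow> real^'d) \<Rightarrow> 'a \<Rightarrow> real^'d" where
  "cov_operator P N V \<phi> x = (\<integral>x'. cov_field P V x x' *v \<phi> x' \<partial>N)"

text \<open>The Karhunen-Loeve coordinate \<open>Y_k\<close> belonging to the eigenpair \<open>(l, \<phi>)\<close>.\<close>

definition KL_coord ::
    "'o measure \<Rightarrow> 'a measure \<Rightarrow> ('o \<Rightarrow> 'a \<Rightarrow> real^'d) \<Rightarrow> real \<Rightarrow> ('a \<Rightarrow> real^'d) \<Rightarrow> 'o \<Rightarrow> real" where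
  "KL_coord P N V l \<phi> \<omega> = (\<integral>x. centred_field P V \<omega> x \<bullet> \<phi> x \<partial>N) / sqrt l"

section \<open>The parameter domain and the diffusion coefficient\<close>

text \<open>Parameter sequences are indexed by \<open>1, 2, 3, \<dots>\<close>.\<close>

definition param_box :: "(nat \<Rightarrow> real) set" where
  "param_box = PiE {1..} (\<lambda>_. {-1..1})"

definition param_measure :: "(nat \<Rightarrow> real) measure" where
  "param_measure = PiM {1..} (\<lambda>_. uniform_measure lborel {-1..1})"

definition param_field ::
    "nat \<Rightarrow> ('a \<Rightarrow> real^'d) \<Rightarrow> (nat \<Rightarrow> real) \<Rightarrow> (nat \<Rightarrow> 'a \<Rightarrow> real^'d) \<Rightarrow> 'a \<Rightarrow> (nat \<Rightarrow> real) \<Rightarrow> real^'d"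
  where
  "param_field M \<psi>0 \<sigma> \<psi> x y = \<psi>0 x + (\<Sum>k=1..M. (\<sigma> k * y k) *\<^sub>R \<psi> k x)"

definition diffusion_matrix :: "real \<Rightarrow> real^'d \<Rightarrow> real^'d^'d" where
  "diffusion_matrix a v = a *\<^sub>R mat 1 + ((norm v - a) / (v \<bullet> v)) *\<^sub>R outer_prod v v"

section \<open>Lipschitz domains and surface measure\<close>

text \<open>Near each boundary point the domain is the strict epigraph, in some direction \<open>e\<close>, of a
  Lipschitz function of the component orthogonal to \<open>e\<close>.\<close>

definition Lipschitz_domain :: "(real^'d) set \<Rightarrow> bool" where
  "Lipschitz_domain D \<longleftrightarrow> open D \<and> connected D \<and> D \<noteq> {} \<and>
     (\<forall>p\<in>frontier D. \<exists>U e L (\<phi> :: real^'d \<Rightarrow> real).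
        open U \<and> p \<in> U \<and> norm e = 1 \<and> L-lipschitz_on UNIV \<phi> \<and>
        D \<inter> U = {x \<in> U. \<phi> (x - (x \<bullet> e) *\<^sub>R e) < x \<bullet> e})"

text \<open>Hausdorff (outer) measure of integer dimension \<open>s\<close>, normalised to agree with
  \<open>s\<close>-dimensional Lebesgue measure.  For \<open>s = 0\<close> the power is \<open>1\<close> on nonempty sets, which
  gives the counting measure.\<close>

definition Hausdorff_premeasure :: "nat \<Rightarrow> real \<Rightarrow> 'a::metric_space set \<Rightarrow> ennreal" where
  "Hausdorff_premeasure s \<delta> A =
     (INF C \<in> {C :: nat \<Rightarrow> 'a set. A \<subseteq> (\<Union>n. C n) \<and> (\<forall>n. bounded (C n) \<and> diameter (C n) \<le> \<delta>)}.
        \<Sum>n. if C n = {} then 0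
             else ennreal (unit_ball_vol (real s) * (diameter (C n) / 2) ^ s))"

definition Hausdorff_outer :: "nat \<Rightarrow> 'a::metric_space set \<Rightarrow> ennreal" where
  "Hausdorff_outer s A = (SUP \<delta>\<in>{0<..}. Hausdorff_premeasure s \<delta> A)"

definition surface_measure :: "(real^'d) measure" where
  "surface_measure = measure_of UNIV (sets borel) (Hausdorff_outer (CARD('d) - 1))"

section \<open>Sobolev spaces and traces\<close>

definition test_function :: "(real^'d) set \<Rightarrow> (real^'d \<Rightarrow> real) \<Rightarrow> (real^'d \<Rightarrow> real^'d) \<Rightarrow> bool" where
  "test_function D \<phi> d\<phi> \<longleftrightarrow>
     (\<forall>x. GDERIV \<phi> x :> d\<phi> x) \<and> continuous_on UNIV d\<phi> \<and>
     compact (closure {x. \<phi> x \<noteq> 0}) \<and> closure {x. \<phi> x \<noteq> 0} \<subseteq> D"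

text \<open>First-order weak derivatives are tested against compactly supported functions of class
  \<open>C^1\<close>, as in Gilbarg and Trudinger.\<close>

definition has_weak_gradient ::
    "(real^'d) set \<Rightarrow> (real^'d \<Rightarrow> real) \<Rightarrow> (real^'d \<Rightarrow> real^'d) \<Rightarrow> bool" where
  "has_weak_gradient D v G \<longleftrightarrow>
     (\<forall>\<phi> d\<phi>. test_function D \<phi> d\<phi> \<longrightarrow>
        (\<integral>x. v x *\<^sub>R d\<phi> x \<partial>lebesgue_on D) = - (\<integral>x. \<phi> x *\<^sub>R G x \<partial>lebesgue_on D))"

definition H1 :: "(real^'d) set \<Rightarrow> (real^'d \<Rightarrow> real) set" where
  "H1 D = {v \<in> L2 (lebesgue_on D). \<exists>G\<in>L2 (lebesgue_on D). has_weak_gradient D v G}"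

definition weak_grad :: "(real^'d) set \<Rightarrow> (real^'d \<Rightarrow> real) \<Rightarrow> real^'d \<Rightarrow> real^'d" where
  "weak_grad D v = (SOME G. G \<in> L2 (lebesgue_on D) \<and> has_weak_gradient D v G)"

definition H1_norm :: "(real^'d) set \<Rightarrow> (real^'d \<Rightarrow> real) \<Rightarrow> real" where
  "H1_norm D v =
     sqrt ((L2_norm (lebesgue_on D) v)\<^sup>2 + (L2_norm (lebesgue_on D) (weak_grad D v))\<^sup>2)"

definition C1_function :: "(real^'d \<Rightarrow> real) \<Rightarrow> bool" where
  "C1_function \<phi> \<longleftrightarrow> (\<exists>d\<phi>. (\<forall>x. GDERIV \<phi> x :> d\<phi> x) \<and> continuous_on UNIV d\<phi>)"

text \<open>The trace of \<open>v\<close> on \<open>\<Gamma>\<close> is the extension by continuity of the restriction map, from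
  functions that are \<open>C^1\<close> up to the boundary, to \<open>H^1\<close>.  As an element of \<open>L^2(\<Gamma>)\<close> it is
  represented by its class of almost everywhere equal functions.\<close>

definition bd_trace :: "(real^'d) set \<Rightarrow> (real^'d) set \<Rightarrow> (real^'d \<Rightarrow> real) \<Rightarrow> (real^'d \<Rightarrow> real) set" where
  "bd_trace D \<Gamma> v = {w \<in> L2 (restrict_space surface_measure \<Gamma>).
     \<exists>\<phi> :: nat \<Rightarrow> real^'d \<Rightarrow> real.
       (\<forall>n. C1_function (\<phi> n) \<and> \<phi> n \<in> H1 D \<and> \<phi> n \<in> L2 (restrict_space surface_measure \<Gamma>)) \<and>
       (\<lambda>n. H1_norm D (\<lambda>x. \<phi> n x - v x)) \<longlonglongrightarrow> 0 \<and>
       (\<lambda>n. L2_norm (restrict_space surface_measure \<Gamma>) (\<lambda>x. \<phi> n x - w x)) \<longlonglongrightarrow> 0}"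

definition vanishes_on :: "(real^'d) set \<Rightarrow> (real^'d) set \<Rightarrow> (real^'d \<Rightarrow> real) \<Rightarrow> bool" where
  "vanishes_on D \<Gamma> v \<longleftrightarrow> (\<lambda>_. 0) \<in> bd_trace D \<Gamma> v"

text \<open>The trace space \<open>H^{1/2}(\<Gamma>)\<close> and its norm.\<close>

definition Hhalf :: "(real^'d) set \<Rightarrow> (real^'d) set \<Rightarrow> (real^'d \<Rightarrow> real) set set" where
  "Hhalf D \<Gamma> = bd_trace D \<Gamma> ` H1 D"

definition Hhalf_norm :: "(real^'d) set \<Rightarrow> (real^'d) set \<Rightarrow> (real^'d \<Rightarrow> real) set \<Rightarrow> real" where
  "Hhalf_norm D \<Gamma> w = Inf {H1_norm D v | v. v \<in> H1 D \<and> bd_trace D \<Gamma> v = w}"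

section \<open>Dual spaces\<close>

definition dual_norm :: "'v set \<Rightarrow> ('v \<Rightarrow> real) \<Rightarrow> ('v \<Rightarrow> real) \<Rightarrow> real" where
  "dual_norm S nrm F = Sup {\<bar>F v\<bar> | v. v \<in> S \<and> nrm v \<le> 1}"

definition H1_dual :: "(real^'d) set \<Rightarrow> ((real^'d \<Rightarrow> real) \<Rightarrow> real) set" where
  "H1_dual D = {F.
     (\<forall>v\<in>H1 D. \<forall>w\<in>H1 D. \<forall>b c. F (\<lambda>x. b * v x + c * w x) = b * F v + c * F w) \<and>
     (\<exists>C. \<forall>v\<in>H1 D. \<bar>F v\<bar> \<le> C * H1_norm D v)}"

definition H1_dual_norm :: "(real^'d) set \<Rightarrow> ((real^'d \<Rightarrow> real) \<Rightarrow> real) \<Rightarrow> real" where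
  "H1_dual_norm D F = dual_norm (H1 D) (H1_norm D) F"

text \<open>The vector space operations of the trace space are those for which taking traces is linear.\<close>

definition Hhalf_dual ::
    "(real^'d) set \<Rightarrow> (real^'d) set \<Rightarrow> ((real^'d \<Rightarrow> real) set \<Rightarrow> real) set" where
  "Hhalf_dual D \<Gamma> = {g.
     (\<forall>v\<in>H1 D. \<forall>w\<in>H1 D. \<forall>b c.
        g (bd_trace D \<Gamma> (\<lambda>x. b * v x + c * w x)) = b * g (bd_trace D \<Gamma> v) + c * g (bd_trace D \<Gamma> w)) \<and>
     (\<exists>C. \<forall>w\<in>Hhalf D \<Gamma>. \<bar>g w\<bar> \<le> C * Hhalf_norm D \<Gamma> w)}"

definition Hhalf_dual_norm ::
    "(real^'d) set \<Rightarrow> (real^'d) set \<Rightarrow> ((real^'d \<Rightarrow> real) set \<Rightarrow> real) \<Rightarrow> real" where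
  "Hhalf_dual_norm D \<Gamma> g = dual_norm (Hhalf D \<Gamma>) (Hhalf_norm D \<Gamma>) g"

section \<open>The boundary value problem\<close>

definition boundary_decomposition :: "(real^'d) set \<Rightarrow> (real^'d) set \<Rightarrow> (real^'d) set \<Rightarrow> bool" where
  "boundary_decomposition D \<Gamma>D \<Gamma>N \<longleftrightarrow>
     \<Gamma>D \<subseteq> frontier D \<and> \<Gamma>N \<subseteq> frontier D \<and> \<Gamma>D \<in> sets borel \<and> \<Gamma>N \<in> sets borel \<and>
     \<Gamma>D \<inter> \<Gamma>N = {} \<and> frontier D = closure \<Gamma>D \<union> closure \<Gamma>N"

definition bvp_space :: "(real^'d) set \<Rightarrow> (real^'d) set \<Rightarrow> (real^'d \<Rightarrow> real) set" where
  "bvp_space D \<Gamma>D =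
     (if emeasure surface_measure \<Gamma>D \<noteq> 0 then {v \<in> H1 D. vanishes_on D \<Gamma>D v}
      else {v \<in> H1 D. (\<integral>x. v x \<partial>lebesgue_on D) = 0})"

definition weak_solution ::
    "(real^'d) set \<Rightarrow> (real^'d) set \<Rightarrow> (real^'d) set \<Rightarrow> (real^'d \<Rightarrow> real^'d^'d) \<Rightarrow>
     ((real^'d \<Rightarrow> real) \<Rightarrow> real) \<Rightarrow> ((real^'d \<Rightarrow> real) set \<Rightarrow> real) \<Rightarrow> (real^'d \<Rightarrow> real) \<Rightarrow> bool" where
  "weak_solution D \<Gamma>D \<Gamma>N A f g w \<longleftrightarrow>
     w \<in> bvp_space D \<Gamma>D \<and>
     (\<forall>v\<in>bvp_space D \<Gamma>D.
        (\<integral>x. (A x *v weak_grad D w x) \<bullet> weak_grad D v x \<partial>lebesgue_on D)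
          = f v + g (bd_trace D \<Gamma>N v))"

section \<open>Mixed partial derivatives of function-valued maps\<close>

text \<open>\<open>has_iter_partial S nrm [k\<^sub>1, \<dots>, k\<^sub>m] U y w\<close>: the map \<open>U\<close> from parameters to the space
  \<open>S\<close> normed by \<open>nrm\<close> has the iterated partial derivative
  \<open>\<partial>\<^bsub>k\<^sub>1\<^esub> \<cdots> \<partial>\<^bsub>k\<^sub>m\<^esub> U\<close> with value \<open>w\<close> at \<open>y\<close>; all inner derivatives are required to exist
  on a neighbourhood of \<open>y\<close> in the coordinate line of the outer differentiation, where they
  are given by \<open>W\<close>.\<close>

primrec has_iter_partial ::
    "('a \<Rightarrow> real) set \<Rightarrow> (('a \<Rightarrow> real) \<Rightarrow> real) \<Rightarrow> nat list \<Rightarrow>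
     ((nat \<Rightarrow> real) \<Rightarrow> 'a \<Rightarrow> real) \<Rightarrow> (nat \<Rightarrow> real) \<Rightarrow> ('a \<Rightarrow> real) \<Rightarrow> bool" where
  "has_iter_partial S nrm [] U y w \<longleftrightarrow> w \<in> S \<and> w = U y"
| "has_iter_partial S nrm (k # ks) U y w \<longleftrightarrow> w \<in> S \<and>
     (\<exists>W :: real \<Rightarrow> 'a \<Rightarrow> real.
        (\<forall>\<^sub>F h in nhds 0. has_iter_partial S nrm ks U (y(k := y k + h)) (W h)) \<and>
        ((\<lambda>h. nrm (\<lambda>x. (W h x - W 0 x) / h - w x)) \<longlongrightarrow> 0) (at 0))"

text \<open>A multi-index is a function of which only the values on \<open>{1..M}\<close> matter; the associated
  list expands \<open>\<partial>\<^sub>1\<close> to the power \<open>\<alpha> 1\<close>, up to \<open>\<partial>\<^bsub>M\<^esub>\<close> to the power \<open>\<alpha> M\<close>.\<close>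

definition multi_index_list :: "nat \<Rightarrow> (nat \<Rightarrow> nat) \<Rightarrow> nat list" where
  "multi_index_list M \<alpha> = concat (map (\<lambda>k. replicate (\<alpha> k) k) [1..<Suc M])"

definition has_mixed_partial ::
    "('a \<Rightarrow> real) set \<Rightarrow> (('a \<Rightarrow> real) \<Rightarrow> real) \<Rightarrow> nat \<Rightarrow> (nat \<Rightarrow> nat) \<Rightarrow>
     ((nat \<Rightarrow> real) \<Rightarrow> 'a \<Rightarrow> real) \<Rightarrow> (nat \<Rightarrow> real) \<Rightarrow> ('a \<Rightarrow> real) \<Rightarrow> bool" where
  "has_mixed_partial S nrm M \<alpha> U y w \<longleftrightarrow> has_iter_partial S nrm (multi_index_list M \<alpha>) U y w"

definition mi_abs :: "nat \<Rightarrow> (nat \<Rightarrow> nat) \<Rightarrow> nat" where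
  "mi_abs M \<alpha> = (\<Sum>k=1..M. \<alpha> k)"

definition mi_power :: "nat \<Rightarrow> (nat \<Rightarrow> real) \<Rightarrow> (nat \<Rightarrow> nat) \<Rightarrow> real" where
  "mi_power M \<mu> \<alpha> = (\<Prod>k=1..M. \<mu> k ^ \<alpha> k)"

end

theory Submission
  imports Defs
begin

text \<open>The bilinear form of the diffusion matrix on gradients \<open>\<xi>\<close>, \<open>\<eta>\<close> is
  \<open>a \<xi> \<bullet> \<eta> + (v \<bullet> \<xi>) (v \<bullet> \<eta>) (r - a r\<^sup>2)\<close> with \<open>r = 1 / \<parallel>v\<parallel>\<close>, and \<open>v\<close> is affine in the
  parameters.  The identity \<open>\<parallel>v\<parallel>\<^sup>2 \<partial>\<^sub>k r = - (v \<bullet> w\<^sub>k) r\<close>, differentiated with the Leibniz rule,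
  bounds the \<open>n\<close>-th derivatives of \<open>r\<close>, and hence those of the form, by \<open>n!\<close> times a geometric
  factor and the product of the \<open>\<gamma>\<^sub>k\<close>.  Differentiating the weak problem, the derivatives of \<open>u\<close>
  solve weak problems with the same form whose right-hand side collects the Leibniz terms
  containing fewer derivatives of \<open>u\<close>; these are solvable by the Riesz representation theorem, and
  coercivity turns them into a recursive bound with geometric solution.  The difference quotient
  minus the candidate derivative satisfies the same kind of equation with a vanishing right-hand
  side, so the candidates really are the derivatives.\<close>

section \<open>Leibniz sums and directional derivatives of the diffusion matrix\<close>

text \<open>Lists of directions replace multi-indices: each single differentiation is an entry of
  its own, and \<open>leibniz\<close> sums over all order-preserving splittings of such a list into
  two, so that no multinomial coefficients appear. Multiplication by the squared norm pays because
  it is a quadratic polynomial in the parameters: its derivatives stop at order two, and the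
  derivatives of the reciprocal norm obey a three-term recursion. Geometric growth with ratio
  \<open>\<rho>\<close> per derivative, in units of the reciprocal norm, is consistent with it once
  \<rho> * \<rho> \<ge> 2 * \<rho> + 1, which 5/2 satisfies; the square of the reciprocal norm
  doubles this to 5. The logarithm in \<open>\<mu>\<close> does not come from this recursion; it
  enters by comparison, through 5 * ln 2 \<le> 4. The obstacle is that the bounds on the field hold
  for almost every parameter, whereas a partial derivative involves the problem on a whole segment
  of a coordinate line, which is a null set. So the bounds are extended to every parameter of a box
  of full measure that is open in the active coordinates, and all differentiation takes place
  there.\<close>

primrec leibniz :: "('k list \<Rightarrow> 'k list \<Rightarrow> real) \<Rightarrow> 'k list \<Rightarrow> real" where
  "leibniz m [] = m [] []"
| "leibniz m (k # p) = leibniz (\<lambda>q r. m (k # q) r) p + leibniz (\<lambda>q r. m q (k # r)) p"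

text \<open>Three facts about a splitting suffice throughout: the lengths drive inductions over
  shorter lists, the inclusions keep all directions in the admissible index set.\<close>

lemma leibniz_cong:
  assumes "\<And>q r. length q + length r = length p \<Longrightarrow> set q \<subseteq> set p \<Longrightarrow> set r \<subseteq> set p \<Longrightarrow> m q r = m' q r"
  shows "leibniz m p = leibniz m' p"
  using assms
proof (induction p arbitrary: m m')
  case (Cons k p)
  have "leibniz (\<lambda>q r. m (k # q) r) p = leibniz (\<lambda>q r. m' (k # q) r) p"
       "leibniz (\<lambda>q r. m q (k # r)) p = leibniz (\<lambda>q r. m' q (k # r)) p"
    by (rule Cons.IH, rule Cons.prems, auto)+
  then show ?case by simp
qed auto

lemma leibniz_mono:
  assumes "\<And>q r. length q + length r = length p \<Longrightarrow> set q \<subseteq> set p \<Longrightarrow> set r \<subseteq> set p \<Longrightarrow> m q r \<le> m' q r"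
  shows "leibniz m p \<le> leibniz m' p"
  using assms
proof (induction p arbitrary: m m')
  case (Cons k p)
  have "leibniz (\<lambda>q r. m (k # q) r) p \<le> leibniz (\<lambda>q r. m' (k # q) r) p"
       "leibniz (\<lambda>q r. m q (k # r)) p \<le> leibniz (\<lambda>q r. m' q (k # r)) p"
    by (rule Cons.IH, rule Cons.prems, auto)+
  then show ?case by simp
qed auto

lemma leibniz_add: "leibniz (\<lambda>q r. m q r + m' q r) p = leibniz m p + leibniz m' p"
  by (induction p arbitrary: m m') auto

lemma leibniz_cmult: "leibniz (\<lambda>q r. c * m q r) p = c * leibniz m p"
  by (induction p arbitrary: m) (auto simp: algebra_simps)

lemma leibniz_zero [simp]: "leibniz (\<lambda>q r. 0) p = 0"
  by (induction p) auto

lemma leibniz_abs: "\<bar>leibniz m p\<bar> \<le> leibniz (\<lambda>q r. \<bar>m q r\<bar>) p"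
proof (induction p arbitrary: m)
  case (Cons k p)
  show ?case
    using Cons.IH[of "\<lambda>q r. m (k # q) r"] Cons.IH[of "\<lambda>q r. m q (k # r)"] by simp
qed auto

lemma leibniz_head: "leibniz (\<lambda>q r. if q = [] then m r else 0) p = m p"
  by (induction p arbitrary: m) auto

text \<open>The splitting with empty \<open>q\<close> puts all directions on the second factor.
  Isolating it turns a Leibniz identity into a recursion for the derivative of highest order of that
  factor.\<close>

lemma leibniz_split_head:
  "leibniz m p = m [] p + leibniz (\<lambda>q r. if q = [] then 0 else m q r) p"
proof -
  have "leibniz m p = leibniz (\<lambda>q r. (if q = [] then m [] r else 0) + (if q = [] then 0 else m q r)) p"
    by (rule leibniz_cong) auto
  then show ?thesis
    by (simp only: leibniz_add leibniz_head)
qed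

text \<open>\<open>dexps\<close> applies the last direction of its list first, so the product rule
  has to peel lists from the right, although \<open>leibniz\<close> recurses from the left.\<close>

lemma leibniz_snoc:
  "leibniz m (p @ [k]) = leibniz (\<lambda>q r. m (q @ [k]) r) p + leibniz (\<lambda>q r. m q (r @ [k])) p"
  by (induction p arbitrary: m) auto

lemma leibniz_tendsto:
  assumes "\<And>q r. length q + length r = length p \<Longrightarrow> set q \<subseteq> set p \<Longrightarrow> set r \<subseteq> set p
             \<Longrightarrow> ((\<lambda>h. m h q r) \<longlongrightarrow> l q r) F"
  shows "((\<lambda>h. leibniz (m h) p) \<longlongrightarrow> leibniz l p) F"
  using assms
proof (induction p arbitrary: m l)
  case (Cons k p)
  have "((\<lambda>h. leibniz (\<lambda>q r. m h (k # q) r) p) \<longlongrightarrow> leibniz (\<lambda>q r. l (k # q) r) p) F"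
       "((\<lambda>h. leibniz (\<lambda>q r. m h q (k # r)) p) \<longlongrightarrow> leibniz (\<lambda>q r. l q (k # r)) p) F"
    by (rule Cons.IH, rule Cons.prems, auto)+
  then show ?case by (auto intro: tendsto_add)
qed auto

section \<open>Weights and factorials in Leibniz sums\<close>

definition weight :: "('k \<Rightarrow> real) \<Rightarrow> 'k list \<Rightarrow> real" where
  "weight \<gamma> p = prod_list (map \<gamma> p)"

lemma weight_simps [simp]:
  "weight \<gamma> [] = 1" "weight \<gamma> (k # p) = \<gamma> k * weight \<gamma> p"
  "weight \<gamma> (p @ q) = weight \<gamma> p * weight \<gamma> q"
  by (auto simp: weight_def)

lemma weight_nonneg: "(\<And>k. k \<in> set p \<Longrightarrow> 0 \<le> \<gamma> k) \<Longrightarrow> 0 \<le> weight \<gamma> p"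
  by (induction p) auto

lemma weight_cmult: "weight (\<lambda>k. c * \<gamma> k) p = c ^ length p * weight \<gamma> p"
  by (induction p) auto

text \<open>The two parts of a splitting together use every entry of \<open>p\<close> exactly once,
  so the product of their weights is the same for all splittings.\<close>

lemma leibniz_weight:
  "leibniz (\<lambda>q r. weight \<gamma> q * weight \<gamma> r * m q r) p = weight \<gamma> p * leibniz m p"
proof (induction p arbitrary: m)
  case (Cons k p)
  have "leibniz (\<lambda>q r. weight \<gamma> (k # q) * weight \<gamma> r * m (k # q) r) p
      = leibniz (\<lambda>q r. \<gamma> k * (weight \<gamma> q * weight \<gamma> r * m (k # q) r)) p"
    by (simp add: mult_ac)
  moreover have "leibniz (\<lambda>q r. weight \<gamma> q * weight \<gamma> (k # r) * m q (k # r)) p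
      = leibniz (\<lambda>q r. \<gamma> k * (weight \<gamma> q * weight \<gamma> r * m q (k # r))) p"
    by (simp add: mult_ac)
  ultimately show ?case
    unfolding leibniz.simps leibniz_cmult Cons.IH by (simp add: algebra_simps)
qed auto

text \<open>There are \<open>n choose i\<close> splittings whose first part has length
  \<open>i\<close>; the induction step is Pascal's rule.\<close>

lemma leibniz_length:
  "leibniz (\<lambda>q r. f (length q) (length r)) p
     = (\<Sum>i\<le>length p. real (length p choose i) * f i (length p - i))"
proof (induction p arbitrary: f)
  case (Cons k p)
  let ?n = "length p"
  have 1: "(\<Sum>i\<le>Suc ?n. real (Suc ?n choose i) * f i (Suc ?n - i))
     = f 0 (Suc ?n) + (\<Sum>i\<le>?n. real (Suc ?n choose Suc i) * f (Suc i) (?n - i))"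
    by (subst sum.atMost_Suc_shift) simp
  have 2: "(\<Sum>i\<le>?n. real (?n choose Suc i) * f (Suc i) (?n - i)) + f 0 (Suc ?n)
     = (\<Sum>i\<le>Suc ?n. real (?n choose i) * f i (Suc ?n - i))"
    by (subst sum.atMost_Suc_shift) simp
  have 3: "(\<Sum>i\<le>Suc ?n. real (?n choose i) * f i (Suc ?n - i))
     = (\<Sum>i\<le>?n. real (?n choose i) * f i (Suc (?n - i)))"
    by (simp add: Suc_diff_le)
  show ?case
    using Cons.IH[of "\<lambda>i j. f (Suc i) j"] Cons.IH[of "\<lambda>i j. f i (Suc j)"] 1 2 3
    by (simp add: sum.distrib algebra_simps)
qed auto

text \<open>The binomial coefficient turns two factorials into one. This is why bounds of the form
  factorial times sequence survive products: the sequences are merely convolved.\<close>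

lemma leibniz_fact:
  "leibniz (\<lambda>q r. fact (length q) * fact (length r) * g (length q) (length r)) p
     = fact (length p) * (\<Sum>i\<le>length p. g i (length p - i))"
proof -
  have "leibniz (\<lambda>q r. fact (length q) * fact (length r) * g (length q) (length r)) p
    = (\<Sum>i\<le>length p. real (length p choose i) * (fact i * fact (length p - i) * g i (length p - i)))"
    by (rule leibniz_length)
  also have "\<dots> = (\<Sum>i\<le>length p. fact (length p) * g i (length p - i))"
  proof (rule sum.cong[OF refl])
    fix i assume "i \<in> {..length p}"
    then have "fact i * fact (length p - i) * real (length p choose i) = fact (length p)"
      by (simp add: binomial_fact)
    then show "real (length p choose i) * (fact i * fact (length p - i) * g i (length p - i))
      = fact (length p) * g i (length p - i)"
      by (metis mult.assoc mult.commute)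
  qed
  finally show ?thesis by (simp add: sum_distrib_left)
qed

text \<open>Syntactic functions of \<open>v\<close>, of the directions \<open>w k\<close> of differentiation and of two gradients, built
  on \<open>1 / \<parallel>v\<parallel>\<close>.  The class is closed under the directional derivatives, which become a primitive
  recursion, and all bounds and measurability statements can be read off the syntax.\<close>

datatype expr = Const real | VV | VW nat | WW nat nat | VX | VY | WX nat | WY nat | XY | Rn
  | Add expr expr | Mul expr expr

primrec ev :: "(nat \<Rightarrow> 'a::real_inner) \<Rightarrow> 'a \<Rightarrow> 'a \<Rightarrow> expr \<Rightarrow> 'a \<Rightarrow> real" where
  "ev w \<xi> \<eta> (Const c) v = c"
| "ev w \<xi> \<eta> VV v = v \<bullet> v"
| "ev w \<xi> \<eta> (VW k) v = v \<bullet> w k"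
| "ev w \<xi> \<eta> (WW j k) v = w j \<bullet> w k"
| "ev w \<xi> \<eta> VX v = v \<bullet> \<xi>"
| "ev w \<xi> \<eta> VY v = v \<bullet> \<eta>"
| "ev w \<xi> \<eta> (WX k) v = w k \<bullet> \<xi>"
| "ev w \<xi> \<eta> (WY k) v = w k \<bullet> \<eta>"
| "ev w \<xi> \<eta> XY v = \<xi> \<bullet> \<eta>"
| "ev w \<xi> \<eta> Rn v = 1 / norm v"
| "ev w \<xi> \<eta> (Add e e') v = ev w \<xi> \<eta> e v + ev w \<xi> \<eta> e' v"
| "ev w \<xi> \<eta> (Mul e e') v = ev w \<xi> \<eta> e v * ev w \<xi> \<eta> e' v"

primrec dexp :: "nat \<Rightarrow> expr \<Rightarrow> expr" where
  "dexp k (Const c) = Const 0"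
| "dexp k VV = Mul (Const 2) (VW k)"
| "dexp k (VW j) = WW k j"
| "dexp k (WW i j) = Const 0"
| "dexp k VX = WX k"
| "dexp k VY = WY k"
| "dexp k (WX j) = Const 0"
| "dexp k (WY j) = Const 0"
| "dexp k XY = Const 0"
| "dexp k Rn = Mul (Const (-1)) (Mul (VW k) (Mul Rn (Mul Rn Rn)))"
| "dexp k (Add e e') = Add (dexp k e) (dexp k e')"
| "dexp k (Mul e e') = Add (Mul (dexp k e) e') (Mul e (dexp k e'))"

definition dexps :: "nat list \<Rightarrow> expr \<Rightarrow> expr" where
  "dexps p e = foldr dexp p e"

lemma dexps_simps [simp]:
  "dexps [] e = e" "dexps (k # p) e = dexp k (dexps p e)" "dexps (p @ [k]) e = dexps p (dexp k e)"
  by (auto simp: dexps_def)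

lemma ev_deriv:
  fixes v :: "'a::real_inner"
  assumes "v + t *\<^sub>R w k \<noteq> 0"
  shows "((\<lambda>t. ev w \<xi> \<eta> e (v + t *\<^sub>R w k)) has_real_derivative ev w \<xi> \<eta> (dexp k e) (v + t *\<^sub>R w k)) (at t)"
proof (induction e)
  case VV
  show ?case unfolding has_field_derivative_def ev.simps dexp.simps
    by (rule has_derivative_eq_rhs)
      (auto intro!: derivative_eq_intros simp: fun_eq_iff inner_simps inner_commute algebra_simps)
next
  case (VW j)
  show ?case unfolding has_field_derivative_def ev.simps dexp.simps
    by (auto intro!: derivative_eq_intros simp: fun_eq_iff inner_simps inner_commute algebra_simps)
next
  case VX
  show ?case unfolding has_field_derivative_def ev.simps dexp.simps
    by (auto intro!: derivative_eq_intros simp: fun_eq_iff inner_simps inner_commute algebra_simps)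
next
  case VY
  show ?case unfolding has_field_derivative_def ev.simps dexp.simps
    by (auto intro!: derivative_eq_intros simp: fun_eq_iff inner_simps inner_commute algebra_simps)
next
  case Rn
  let ?z = "v + t *\<^sub>R w k"
  have "((\<lambda>t. norm (v + t *\<^sub>R w k)) has_derivative (\<lambda>h. (h *\<^sub>R w k) \<bullet> sgn ?z)) (at t)"
    by (rule has_derivative_compose[where f' = "\<lambda>h. h *\<^sub>R w k" and g' = "\<lambda>h. h \<bullet> sgn ?z"])
      (use has_derivative_norm[OF assms] in \<open>auto intro!: derivative_eq_intros\<close>)
  then have "((\<lambda>t. norm (v + t *\<^sub>R w k)) has_real_derivative (w k \<bullet> ?z) / norm ?z) (at t)"
    unfolding has_field_derivative_def
    by (rule has_derivative_eq_rhs) (auto simp: fun_eq_iff sgn_div_norm divide_inverse mult_ac inner_simps distrib_left)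
  then have "((\<lambda>t. inverse (norm (v + t *\<^sub>R w k))) has_real_derivative
     - (inverse (norm ?z) * ((w k \<bullet> ?z) / norm ?z) * inverse (norm ?z))) (at t)"
    using assms by (intro DERIV_inverse') auto
  then show ?case
    by (simp add: divide_inverse inner_commute mult_ac)
next
  case (Mul e e')
  show ?case unfolding ev.simps dexp.simps
    by (rule DERIV_cong[OF DERIV_mult[OF Mul]]) (simp add: algebra_simps)
next
  case (Add e e')
  show ?case unfolding ev.simps dexp.simps by (rule DERIV_add[OF Add])
qed auto

text \<open>\<open>dexp\<close> acts on syntax, yet it computes true derivatives along lines, and
  the nonzero vectors form an open set. Hence an identity between values can be differentiated, by
  uniqueness of derivatives. The coefficients \<open>b\<close> and \<open>c\<close> make one lemma
  serve both for rewriting an expression and for linearity in a gradient.\<close>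

lemma ev_dexps_lin:
  fixes v :: "'a::real_inner"
  assumes "\<And>v::'a. v \<noteq> 0 \<Longrightarrow> ev w \<xi> \<eta> e v = b * ev w \<xi>' \<eta>' e' v + c * ev w \<xi>'' \<eta>'' e'' v" "v \<noteq> 0"
  shows "ev w \<xi> \<eta> (dexps p e) v = b * ev w \<xi>' \<eta>' (dexps p e') v + c * ev w \<xi>'' \<eta>'' (dexps p e'') v"
  using assms(2)
proof (induction p arbitrary: v)
  case (Cons k p)
  let ?a = "\<lambda>t. ev w \<xi> \<eta> (dexps p e) (v + t *\<^sub>R w k)"
    and ?b = "\<lambda>t. b * ev w \<xi>' \<eta>' (dexps p e') (v + t *\<^sub>R w k) + c * ev w \<xi>'' \<eta>'' (dexps p e'') (v + t *\<^sub>R w k)"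
  have "((\<lambda>t. v + t *\<^sub>R w k) \<longlongrightarrow> v + 0 *\<^sub>R w k) (at (0::real))"
    by (intro tendsto_intros)
  then have "eventually (\<lambda>t. v + t *\<^sub>R w k \<noteq> 0) (at (0::real))"
    using Cons.prems by (intro tendsto_imp_eventually_ne) auto
  \<comment> \<open>Close to \<open>t = 0\<close> the line avoids the origin, so the induction
    hypothesis is an identity between functions of \<open>t\<close>.\<close>
  then have ev: "eventually (\<lambda>t. ?a t = ?b t) (nhds 0)"
    unfolding eventually_nhds_conv_at using Cons by (auto elim!: eventually_mono)
  have a: "(?a has_real_derivative ev w \<xi> \<eta> (dexps (k # p) e) v) (at 0)"
    using ev_deriv[of v 0 w k \<xi> \<eta> "dexps p e"] Cons.prems by simp
  have b: "(?b has_real_derivative b * ev w \<xi>' \<eta>' (dexps (k # p) e') v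
      + c * ev w \<xi>'' \<eta>'' (dexps (k # p) e'') v) (at 0)"
    using ev_deriv[of v 0 w k \<xi>' \<eta>' "dexps p e'"] ev_deriv[of v 0 w k \<xi>'' \<eta>'' "dexps p e''"] Cons.prems
    by (intro DERIV_add DERIV_cmult) simp_all
  from a have "(?b has_real_derivative ev w \<xi> \<eta> (dexps (k # p) e) v) (at 0)"
    using DERIV_cong_ev[OF refl ev refl] by simp
  from DERIV_unique[OF this b] show ?case .
qed (use assms in auto)

lemma ev_dexps_cong:
  fixes v :: "'a::real_inner"
  assumes "\<And>v::'a. v \<noteq> 0 \<Longrightarrow> ev w \<xi> \<eta> e v = ev w \<xi>' \<eta>' e' v" "v \<noteq> 0"
  shows "ev w \<xi> \<eta> (dexps p e) v = ev w \<xi>' \<eta>' (dexps p e') v"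
  using ev_dexps_lin[of w \<xi> \<eta> e 1 \<xi>' \<eta>' e' 0 \<xi>' \<eta>' e' v p] assms by simp

lemma ev_dexps_Add [simp]:
  "ev w \<xi> \<eta> (dexps p (Add e e')) v = ev w \<xi> \<eta> (dexps p e) v + ev w \<xi> \<eta> (dexps p e') v"
proof -
  have "dexps p (Add e e') = Add (dexps p e) (dexps p e')"
    by (induction p) auto
  then show ?thesis by simp
qed

lemma ev_dexps_Mul:
  "ev w \<xi> \<eta> (dexps p (Mul e e')) v
     = leibniz (\<lambda>q r. ev w \<xi> \<eta> (dexps q e) v * ev w \<xi> \<eta> (dexps r e') v) p"
  by (induction p arbitrary: e e' rule: rev_induct) (auto simp: leibniz_snoc)

lemma dexps_Const: "dexps p (Const c) = (if p = [] then Const c else Const 0)"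
  by (induction p) auto

lemma dexps_XY: "dexps p XY = (if p = [] then XY else Const 0)"
  by (induction p) auto

lemma dexps_VX: "dexps p VX = (case p of [] \<Rightarrow> VX | [k] \<Rightarrow> WX k | _ \<Rightarrow> Const 0)"
  by (induction p) (auto split: list.splits)

lemma dexps_VY: "dexps p VY = (case p of [] \<Rightarrow> VY | [k] \<Rightarrow> WY k | _ \<Rightarrow> Const 0)"
  by (induction p) (auto split: list.splits)

lemma dexps_VW: "dexps p (VW j) = (case p of [] \<Rightarrow> VW j | [k] \<Rightarrow> WW k j | _ \<Rightarrow> Const 0)"
  by (induction p) (auto split: list.splits)

text \<open>A quadratic polynomial in \<open>v\<close> has no derivatives beyond order two; this is
  what truncates the Leibniz sum for the reciprocal norm.\<close>

lemma ev_dexps_VV: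
  "ev w \<xi> \<eta> (dexps p VV) v = (case p of [] \<Rightarrow> v \<bullet> v | [k] \<Rightarrow> 2 * (v \<bullet> w k) | [j, k] \<Rightarrow> 2 * (w j \<bullet> w k) | _ \<Rightarrow> 0)"
proof -
  have "length p \<ge> 3 \<Longrightarrow> ev w \<xi> \<eta> (dexps p VV) v = 0"
  proof (induction p rule: rev_induct)
    case (snoc k p)
    then show ?case
      by (auto simp: ev_dexps_Mul dexps_Const dexps_VW numeral_3_eq_3 Suc_le_eq intro!: leibniz_cong[where m' = "\<lambda>q r. 0", simplified]
           split: list.splits)
  qed auto
  then show ?thesis
    by (cases "length p \<ge> 3") (auto split: list.splits simp: Suc_le_eq numeral_3_eq_3)
qed


lemma ev_dexps_Const_Mul:
  "ev w \<xi> \<eta> (dexps p (Mul (Const c) e)) v = c * ev w \<xi> \<eta> (dexps p e) v"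
proof -
  have "ev w \<xi> \<eta> (dexps p (Mul (Const c) e)) v
     = leibniz (\<lambda>q r. if q = [] then c * ev w \<xi> \<eta> (dexps r e) v else 0) p"
    unfolding ev_dexps_Mul dexps_Const by (rule leibniz_cong) auto
  then show ?thesis by (simp only: leibniz_head)
qed

section \<open>Factorial bounds for the derivatives of the form\<close>

lemma leibniz_dominated:
  assumes "\<And>q r. length q + length r = length p \<Longrightarrow> set q \<subseteq> set p \<Longrightarrow> set r \<subseteq> set p \<Longrightarrow>
     \<bar>m q r\<bar> \<le> weight \<gamma> q * weight \<gamma> r * (fact (length q) * fact (length r) * g (length q) (length r))"
  shows "\<bar>leibniz m p\<bar> \<le> weight \<gamma> p * (fact (length p) * (\<Sum>i\<le>length p. g i (length p - i)))"
proof -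
  have "\<bar>leibniz m p\<bar> \<le> leibniz (\<lambda>q r. \<bar>m q r\<bar>) p"
    by (rule leibniz_abs)
  also have "\<dots> \<le> leibniz (\<lambda>q r. weight \<gamma> q * weight \<gamma> r * (fact (length q) * fact (length r) * g (length q) (length r))) p"
    by (rule leibniz_mono) (rule assms)
  also have "\<dots> = weight \<gamma> p * (fact (length p) * (\<Sum>i\<le>length p. g i (length p - i)))"
    unfolding leibniz_weight leibniz_fact ..
  finally show ?thesis .
qed

lemma leibniz_dominated_mult:
  assumes S: "\<And>q. set q \<subseteq> set p \<Longrightarrow> \<bar>S q\<bar> \<le> fact (length q) * \<sigma> (length q) * weight \<gamma> q"
    and T: "\<And>q. set q \<subseteq> set p \<Longrightarrow> \<bar>T q\<bar> \<le> fact (length q) * \<tau> (length q) * weight \<gamma> q"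
  shows "\<bar>leibniz (\<lambda>q r. S q * T r) p\<bar> \<le> weight \<gamma> p * (fact (length p) * (\<Sum>i\<le>length p. \<sigma> i * \<tau> (length p - i)))"
proof (rule leibniz_dominated)
  fix q r :: "'a list" assume *: "set q \<subseteq> set p" "set r \<subseteq> set p"
  have "\<bar>S q * T r\<bar> \<le> (fact (length q) * \<sigma> (length q) * weight \<gamma> q) * (fact (length r) * \<tau> (length r) * weight \<gamma> r)"
    unfolding abs_mult by (rule mult_mono[OF S T]) (use * S[of q] in auto)
  then show "\<bar>S q * T r\<bar> \<le> weight \<gamma> q * weight \<gamma> r * (fact (length q) * fact (length r) * (\<sigma> (length q) * \<tau> (length r)))"
    by (simp add: mult_ac)
qed

text \<open>Majorant of the derivatives of a polynomial of degree at most two: the entry at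
  \<open>i\<close> bounds those of order \<open>i\<close> after division by \<open>fact i\<close>
  and by the weight.\<close>

abbreviation first_three :: "real \<Rightarrow> real \<Rightarrow> real \<Rightarrow> nat \<Rightarrow> real" where
  "first_three s0 s1 s2 i \<equiv> if i = 0 then s0 else if i = 1 then s1 else if i = 2 then s2 else 0"

lemma sum_first_three:
  fixes \<tau> :: "nat \<Rightarrow> real"
  shows "(\<Sum>i\<le>m. (first_three s0 s1 s2 i) * \<tau> (m - i))
     = s0 * \<tau> m + (if m \<ge> 1 then s1 * \<tau> (m - 1) else 0) + (if m \<ge> 2 then s2 * \<tau> (m - 2) else 0)"
proof (cases "m \<ge> 2")
  case True
  then obtain n where m: "m = Suc (Suc n)" by (metis add_2_eq_Suc le_Suc_ex)
  have "(\<Sum>i\<le>n. (if Suc (Suc i) = 2 then s2 else 0) * \<tau> (n - i)) = (\<Sum>i\<le>n. if i = 0 then s2 * \<tau> n else 0)"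
    by (rule sum.cong) auto
  then show ?thesis
    unfolding m by (subst sum.atMost_Suc_shift, subst sum.atMost_Suc_shift) simp
next
  case False
  then have "m = 0 \<or> m = 1" by auto
  then show ?thesis by auto
qed

text \<open>Write \<open>b\<close> for the norm of \<open>v\<close>. If \<open>t\<close> majorises
  the derivatives of lower order, the differentiated identity yields the next order provided that
  \<open>(m + 1) * b^2 * t (m + 1)\<close> is at least
  \<open>(2 * m + 1) * b * t m + m * t (m - 1)\<close>. For a geometric \<open>t\<close> with ratio
  \<open>\<rho> / b\<close> this follows from \<rho> * \<rho> \<ge> 2 * \<rho> + 1, and 5/2 is a
  round number just above the root 1 + sqrt 2.\<close>

lemma Rn_deriv_bound:
  fixes v :: "'a::real_inner"
  assumes v: "v \<noteq> 0" and w: "\<And>k. k \<in> set p \<Longrightarrow> norm (w k) \<le> \<gamma> k"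
  shows "\<bar>ev w \<xi> \<eta> (dexps p Rn) v\<bar> \<le> fact (length p) * (1 / norm v * (5 / (2 * norm v)) ^ length p) * weight \<gamma> p"
  using w
proof (induction "length p" arbitrary: p rule: less_induct)
  case less
  define b where "b = norm v"
  define t where "t n = 1 / b * (5 / (2 * b)) ^ n" for n :: nat
  have b: "b > 0" using v by (simp add: b_def)
  have t0: "t n \<ge> 0" for n using b by (simp add: t_def)
  show ?case
  proof (cases p rule: rev_cases)
    case Nil
    then show ?thesis by simp
  next
    case (snoc p0 k)
    define m where "m = length p0"
    \<comment> \<open>The innermost direction \<open>k\<close> is performed symbolically once and
      for all, so \<open>Z p0\<close> is the derivative to be bounded.\<close>
    define Z where "Z q = ev w \<xi> \<eta> (dexps q (dexp k Rn)) v" for q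
    define W where "W = weight \<gamma> p0 * \<gamma> k"
    define R where "R q = ev w \<xi> \<eta> (dexps q Rn) v" for q
    define L where "L = leibniz (\<lambda>q r. if q = [] then 0 else ev w \<xi> \<eta> (dexps q VV) v * Z r) p0"
    have w: "norm (w j) \<le> \<gamma> j" if "j \<in> set p0 \<or> j = k" for j
      using less.prems that snoc by auto
    have \<gamma>0: "0 \<le> \<gamma> j" if "j \<in> set p0 \<or> j = k" for j
      using w[OF that] norm_ge_zero[of "w j"] by linarith
    have inner_vw: "\<bar>v \<bullet> w j\<bar> \<le> b * \<gamma> j" if "j \<in> set p0 \<or> j = k" for j
      using Cauchy_Schwarz_ineq2[of v "w j"] mult_left_mono[OF w[OF that], of b] b unfolding b_def by linarith
    have inner_ww: "\<bar>w i \<bullet> w j\<bar> \<le> \<gamma> i * \<gamma> j" if "i \<in> set p0 \<or> i = k" "j \<in> set p0 \<or> j = k" for i j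
      using Cauchy_Schwarz_ineq2[of "w i" "w j"] mult_mono[OF w[OF that(1)] w[OF that(2)]] \<gamma>0[OF that(1)] by auto
    \<comment> \<open>The two products are different expressions with the same value at every
      nonzero vector; \<open>ev_dexps_cong\<close> allows both to be differentiated along
      \<open>p0\<close>.\<close>
    have eq: "leibniz (\<lambda>q r. ev w \<xi> \<eta> (dexps q VV) v * Z r) p0 = - leibniz (\<lambda>q r. ev w \<xi> \<eta> (dexps q (VW k)) v * R r) p0"
    proof -
      have "ev w \<xi> \<eta> (dexps p0 (Mul VV (dexp k Rn))) v = ev w \<xi> \<eta> (dexps p0 (Mul (Const (-1)) (Mul (VW k) Rn))) v"
        by (rule ev_dexps_cong[OF _ v]) (simp add: field_simps power2_eq_square[symmetric] power2_norm_eq_inner)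
      then show ?thesis
        unfolding ev_dexps_Const_Mul unfolding ev_dexps_Mul Z_def R_def by simp
    qed
    have R: "\<bar>R q\<bar> \<le> fact (length q) * t (length q) * weight \<gamma> q" if "set q \<subseteq> set p0" "length q \<le> m" for q
      using less.hyps[of q] that snoc w unfolding R_def t_def b_def m_def by (auto simp: less_Suc_eq_le)
    have Z: "\<bar>Z r\<bar> \<le> fact (Suc (length r)) * t (Suc (length r)) * (weight \<gamma> r * \<gamma> k)"
      if "set r \<subseteq> set p0" "length r < m" for r
      using less.hyps[of "r @ [k]"] that snoc w unfolding Z_def t_def b_def m_def by auto
    \<comment> \<open>The coefficients: order zero has been split off, first derivatives of the
      squared norm are at most \<open>2 * b\<close> times the weight, second ones at most
      \<open>fact 2 * 1\<close> times the weight. The factor \<open>Suc\<close> is left over when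
      the factorial in the bound for \<open>Z r\<close> is reduced to
      \<open>fact (length r)\<close>.\<close>
    have "\<bar>L\<bar> \<le> weight \<gamma> p0 * (fact (length p0) * (\<Sum>i\<le>length p0. first_three 0 (2 * b) 1 i * (real (Suc (length p0 - i)) * t (Suc (length p0 - i)) * \<gamma> k)))"
      unfolding L_def
    proof (rule leibniz_dominated)
      fix q r assume *: "length q + length r = length p0" "set q \<subseteq> set p0" "set r \<subseteq> set p0"
      show "\<bar>if q = [] then 0 else ev w \<xi> \<eta> (dexps q VV) v * Z r\<bar> \<le> weight \<gamma> q * weight \<gamma> r * (fact (length q) * fact (length r) *
         ((first_three 0 (2 * b) 1 (length q)) * (real (Suc (length r)) * t (Suc (length r)) * \<gamma> k)))"
      proof (cases "q = []")
        case False
        define s :: real where "s = (if length q = 1 then 2 * b else if length q = 2 then 1 else 0)"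
        have VV: "\<bar>ev w \<xi> \<eta> (dexps q VV) v\<bar> \<le> weight \<gamma> q * (fact (length q) * s)"
          using False inner_vw inner_ww *(2) unfolding ev_dexps_VV s_def
          by (auto split: list.splits simp: abs_mult mult.commute[of _ b])
        have Z': "\<bar>Z r\<bar> \<le> fact (Suc (length r)) * t (Suc (length r)) * (weight \<gamma> r * \<gamma> k)"
          using False *(1,3) by (intro Z) (cases q; auto simp: m_def)+
        have "\<bar>ev w \<xi> \<eta> (dexps q VV) v * Z r\<bar> \<le> (weight \<gamma> q * (fact (length q) * s)) * (fact (Suc (length r)) * t (Suc (length r)) * (weight \<gamma> r * \<gamma> k))"
          unfolding abs_mult by (rule mult_mono[OF VV Z']) (use VV in auto)
        with False show ?thesis by (simp add: s_def mult_ac)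
      qed simp
    qed
    also have "\<dots> = fact m * W * ((if m \<ge> 1 then 2 * b * real m * t m else 0) + (if m \<ge> 2 then real (m - 1) * t (m - 1) else 0))"
      unfolding sum_first_three[where \<tau> = "\<lambda>j. real (Suc j) * t (Suc j) * \<gamma> k"]
      unfolding m_def[symmetric] W_def
    proof -
      consider "m = 0" | "m = 1" | n where "m = Suc (Suc n)" by (metis One_nat_def not0_implies_Suc)
      then show "weight \<gamma> p0 * (fact m * (0 * (real (Suc m) * t (Suc m) * \<gamma> k)
         + (if 1 \<le> m then 2 * b * (real (Suc (m - 1)) * t (Suc (m - 1)) * \<gamma> k) else 0)
         + (if 2 \<le> m then 1 * (real (Suc (m - 2)) * t (Suc (m - 2)) * \<gamma> k) else 0)))
        = fact m * (weight \<gamma> p0 * \<gamma> k) * ((if m \<ge> 1 then 2 * b * real m * t m else 0) + (if m \<ge> 2 then real (m - 1) * t (m - 1) else 0))"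
        by cases (auto simp: algebra_simps)
    qed
    \<comment> \<open>For \<open>m = 0\<close> the term \<open>(real m - 1) * t (m - 1)\<close>
      equals \<open>- t 0\<close>, since the subtraction inside \<open>t\<close> is truncated; the
      last summand cancels it.\<close>
    also have "\<dots> \<le> fact m * W * (2 * b * real m * t m + (real m - 1) * t (m - 1) + (if m = 0 then t 0 else 0))"
    proof (rule mult_left_mono)
      show "(if m \<ge> 1 then 2 * b * real m * t m else 0) + (if m \<ge> 2 then real (m - 1) * t (m - 1) else 0)
        \<le> 2 * b * real m * t m + (real m - 1) * t (m - 1) + (if m = 0 then t 0 else 0)"
        using t0 by (cases m) auto
      show "0 \<le> fact m * W" using weight_nonneg[of p0 \<gamma>] \<gamma>0 by (auto simp: W_def)
    qed
    finally have L: "\<bar>L\<bar> \<le> fact m * W * (2 * b * real m * t m + (real m - 1) * t (m - 1) + (if m = 0 then t 0 else 0))" .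
    have VW: "\<bar>ev w \<xi> \<eta> (dexps q (VW k)) v\<bar> \<le> fact (length q) * first_three (b * \<gamma> k) (\<gamma> k) 0 (length q) * weight \<gamma> q"
      if "set q \<subseteq> set p0" for q
      using inner_vw inner_ww that unfolding dexps_VW by (auto split: list.splits simp: mult.commute)
    have "\<bar>leibniz (\<lambda>q r. ev w \<xi> \<eta> (dexps q (VW k)) v * R r) p0\<bar>
       \<le> weight \<gamma> p0 * (fact (length p0) * (\<Sum>i\<le>length p0. first_three (b * \<gamma> k) (\<gamma> k) 0 i * t (length p0 - i)))"
    proof (rule leibniz_dominated)
      fix q r assume *: "length q + length r = length p0" "set q \<subseteq> set p0" "set r \<subseteq> set p0"
      have R': "\<bar>R r\<bar> \<le> fact (length r) * t (length r) * weight \<gamma> r" using R[of r] * by (auto simp: m_def)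
      have "\<bar>ev w \<xi> \<eta> (dexps q (VW k)) v * R r\<bar> \<le> (fact (length q) * first_three (b * \<gamma> k) (\<gamma> k) 0 (length q) * weight \<gamma> q) * (fact (length r) * t (length r) * weight \<gamma> r)"
        unfolding abs_mult by (rule mult_mono[OF VW[OF *(2)] R']) (use VW[OF *(2)] in auto)
      then show "\<bar>ev w \<xi> \<eta> (dexps q (VW k)) v * R r\<bar> \<le> weight \<gamma> q * weight \<gamma> r * (fact (length q) * fact (length r) *
         ((first_three (b * \<gamma> k) (\<gamma> k) 0 (length q)) * t (length r)))"
        by (simp only: mult_ac)
    qed
    also have "\<dots> \<le> fact m * W * (b * t m + (if m \<ge> 1 then t (m - 1) else 0))"
      unfolding sum_first_three by (auto simp: m_def[symmetric] W_def algebra_simps)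
    finally have VWR: "\<bar>leibniz (\<lambda>q r. ev w \<xi> \<eta> (dexps q (VW k)) v * R r) p0\<bar> \<le> fact m * W * (b * t m + (if m \<ge> 1 then t (m - 1) else 0))" .
    have "leibniz (\<lambda>q r. ev w \<xi> \<eta> (dexps q VV) v * Z r) p0 = b\<^sup>2 * Z p0 + L"
      unfolding L_def by (subst leibniz_split_head) (simp add: b_def power2_norm_eq_inner)
    then have "\<bar>b\<^sup>2 * Z p0\<bar> \<le> \<bar>L\<bar> + \<bar>leibniz (\<lambda>q r. ev w \<xi> \<eta> (dexps q (VW k)) v * R r) p0\<bar>"
      using eq by linarith
    then have "b\<^sup>2 * \<bar>Z p0\<bar> \<le> \<bar>L\<bar> + \<bar>leibniz (\<lambda>q r. ev w \<xi> \<eta> (dexps q (VW k)) v * R r) p0\<bar>"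
      by (simp add: abs_mult)
    also have "\<dots> \<le> fact m * W * ((2 * b * real m * t m + (real m - 1) * t (m - 1) + (if m = 0 then t 0 else 0)) + (b * t m + (if m \<ge> 1 then t (m - 1) else 0)))"
      using L VWR by (simp only: distrib_left)
    also have "\<dots> \<le> fact m * W * (real (Suc m) * (b\<^sup>2 * t (Suc m)))"
    proof (rule mult_left_mono)
      show "(2 * b * real m * t m + (real m - 1) * t (m - 1) + (if m = 0 then t 0 else 0)) + (b * t m + (if m \<ge> 1 then t (m - 1) else 0))
         \<le> real (Suc m) * (b\<^sup>2 * t (Suc m))"
      proof (cases m)
        case 0
        then show ?thesis using b by (simp add: t_def field_simps power2_eq_square)
      next
        case (Suc n)
        have "b * t (Suc n) = 5/2 * t n" "b\<^sup>2 * t (Suc (Suc n)) = 25/4 * t n"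
          using b by (simp_all add: t_def field_simps power2_eq_square)
        \<comment> \<open>The choice of 5/2 is decided here: the coefficient of \<open>m\<close> is
          6 on the left and 25/4 on the right.\<close>
        moreover have "(2 * real m + 1) * (5/2 * t n) + real m * t n \<le> real (Suc m) * (25/4 * t n)"
          using t0[of n] by (simp add: algebra_simps)
        ultimately have "(2 * real m + 1) * (b * t (Suc n)) + real m * t n \<le> real (Suc m) * (b\<^sup>2 * t (Suc (Suc n)))"
          by (simp only:)
        then show ?thesis unfolding Suc by (simp add: algebra_simps)
      qed
      show "0 \<le> fact m * W" using weight_nonneg[of p0 \<gamma>] \<gamma>0 by (auto simp: W_def)
    qed
    finally have "b\<^sup>2 * \<bar>Z p0\<bar> \<le> b\<^sup>2 * (fact (Suc m) * t (Suc m) * W)"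
      by (simp add: algebra_simps)
    then have "\<bar>Z p0\<bar> \<le> fact (Suc m) * t (Suc m) * W"
      using b by simp
    then show ?thesis
      by (simp add: snoc Z_def m_def W_def t_def b_def mult_ac)
  qed
qed

definition Aexp :: "real \<Rightarrow> expr" where
  "Aexp a = Add (Mul (Const a) XY) (Mul VX (Mul VY (Add Rn (Mul (Const (- a)) (Mul Rn Rn)))))"

text \<open>A factor that is affine in the parameters contributes only orders zero and one. The
  order-one term has one power of \<open>5 / b\<close> less, so it is a fifth of the other, and 1 +
  1/5 = 6/5.\<close>

lemma leibniz_order_one_bound:
  fixes S T :: "'k list \<Rightarrow> real"
  assumes S: "\<And>q. set q \<subseteq> set p \<Longrightarrow> \<bar>S q\<bar> \<le> fact (length q) * first_three (c * b) c 0 (length q) * weight \<gamma> q"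
    and T: "\<And>q. set q \<subseteq> set p \<Longrightarrow> \<bar>T q\<bar> \<le> fact (length q) * (K * (5 / b) ^ length q) * weight \<gamma> q"
    and pos: "b > 0" "K \<ge> 0" "c \<ge> 0" and \<gamma>: "\<And>k. k \<in> set p \<Longrightarrow> 0 \<le> \<gamma> k"
  shows "\<bar>leibniz (\<lambda>q r. S q * T r) p\<bar> \<le> fact (length p) * ((6 / 5 * b * c * K) * (5 / b) ^ length p) * weight \<gamma> p"
proof -
  let ?n = "length p"
  have "(\<Sum>i\<le>?n. (first_three (c * b) c 0 i) * (K * (5 / b) ^ (?n - i)))
     \<le> 6 / 5 * b * c * K * (5 / b) ^ ?n"
  proof (cases ?n)
    case (Suc m)
    have "c * b * (K * (5 / b) ^ Suc m) + c * (K * (5 / b) ^ m) = 6 / 5 * b * c * K * (5 / b) ^ Suc m"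
      using pos by (simp add: field_simps)
    moreover have "(\<Sum>i\<le>?n. (first_three (c * b) c 0 i) * (K * (5 / b) ^ (?n - i)))
      = c * b * (K * (5 / b) ^ Suc m) + c * (K * (5 / b) ^ m)"
      unfolding sum_first_three[where \<tau> = "\<lambda>j. K * (5 / b) ^ j"] Suc by simp
    ultimately show ?thesis unfolding Suc by linarith
  qed (use pos in auto)
  then have *: "weight \<gamma> p * (fact ?n * (\<Sum>i\<le>?n. (first_three (c * b) c 0 i) * (K * (5 / b) ^ (?n - i))))
    \<le> weight \<gamma> p * (fact ?n * (6 / 5 * b * c * K * (5 / b) ^ ?n))"
    using weight_nonneg[of p \<gamma>] \<gamma> by (intro mult_left_mono) auto
  have "\<bar>leibniz (\<lambda>q r. S q * T r) p\<bar> \<le> weight \<gamma> p * (fact ?n * (\<Sum>i\<le>?n. (first_three (c * b) c 0 i) * (K * (5 / b) ^ (?n - i))))"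
    by (rule leibniz_dominated_mult[OF S T])
  also note *
  finally show ?thesis by (simp only: mult_ac)
qed

text \<open>The second summand of \<open>Aexp\<close> is a product of two affine factors, each
  costing 6/5, with an expression bounded by \<open>K\<close>. As
  \<open>b\<^sup>2 * K = b + a\<close>, the total is a + 36/25 * (a + b), which 3 * (a + b)
  majorises.\<close>

lemma Aexp_deriv_bound:
  fixes v :: "'a::real_inner"
  assumes v: "v \<noteq> 0" and a: "a \<ge> 0" and w: "\<And>k. k \<in> set p \<Longrightarrow> norm (w k) \<le> \<gamma> k"
  shows "\<bar>ev w \<xi> \<eta> (dexps p (Aexp a)) v\<bar>
    \<le> 3 * (a + norm v) * (fact (length p) * (5 / norm v) ^ length p * weight \<gamma> p) * (norm \<xi> * norm \<eta>)"
proof -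
  define b where "b = norm v"
  have b: "b > 0" using v by (simp add: b_def)
  have \<gamma>0: "0 \<le> \<gamma> j" if "j \<in> set p" for j
    using w[OF that] norm_ge_zero[of "w j"] by linarith
  have W0: "weight \<gamma> q \<ge> 0" if "set q \<subseteq> set p" for q
    using that \<gamma>0 by (intro weight_nonneg) auto
  define K where "K = 1 / b + a / b\<^sup>2"
  define E where "E = Add Rn (Mul (Const (- a)) (Mul Rn Rn))"
  have K: "K \<ge> 0" using b a by (simp add: K_def)
  \<comment> \<open>The square of the reciprocal norm convolves a geometric sequence with itself,
    which gives \<open>n + 1\<close> equal terms; doubling the ratio absorbs them.\<close>
  have half: "real (Suc n) * (5 / (2 * b)) ^ n \<le> (5 / b) ^ n" for n
  proof -
    have "Suc n \<le> 2 ^ n" by (rule Suc_leI) (rule less_exp)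
    then have "real (Suc n) \<le> 2 ^ n" by (metis of_nat_le_iff of_nat_numeral of_nat_power)
    then have "real (Suc n) * (5 / (2 * b)) ^ n \<le> 2 ^ n * (5 / (2 * b)) ^ n"
      using b by (intro mult_right_mono) auto
    also have "\<dots> = (5 / b) ^ n" by (simp flip: power_mult_distrib)
    finally show ?thesis .
  qed
  have E: "\<bar>ev w \<xi> \<eta> (dexps q E) v\<bar> \<le> fact (length q) * (K * (5 / b) ^ length q) * weight \<gamma> q" if q: "set q \<subseteq> set p" for q
  proof -
    let ?n = "length q"
    have R: "\<bar>ev w \<xi> \<eta> (dexps r Rn) v\<bar> \<le> fact (length r) * (1 / b * (5 / (2 * b)) ^ length r) * weight \<gamma> r"
      if "set r \<subseteq> set q" for r
      unfolding b_def using that q w by (intro Rn_deriv_bound v) auto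
    have "\<bar>ev w \<xi> \<eta> (dexps q (Mul Rn Rn)) v\<bar> \<le> weight \<gamma> q * (fact ?n * (\<Sum>i\<le>?n. (1 / b * (5 / (2 * b)) ^ i) * (1 / b * (5 / (2 * b)) ^ (?n - i))))"
      unfolding ev_dexps_Mul by (rule leibniz_dominated_mult; rule R)
    also have "(\<Sum>i\<le>?n. (1 / b * (5 / (2 * b)) ^ i) * (1 / b * (5 / (2 * b)) ^ (?n - i))) = (\<Sum>i\<le>?n. 1 / b\<^sup>2 * (5 / (2 * b)) ^ ?n)"
      by (rule sum.cong) (auto simp: power2_eq_square simp flip: power_add)
    also have "\<dots> = 1 / b\<^sup>2 * (real (Suc ?n) * (5 / (2 * b)) ^ ?n)" by simp
    also have "weight \<gamma> q * (fact ?n * \<dots>) \<le> weight \<gamma> q * (fact ?n * (1 / b\<^sup>2 * (5 / b) ^ ?n))"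
      using W0[OF q] half[of ?n] by (intro mult_left_mono) auto
    finally have RR: "\<bar>ev w \<xi> \<eta> (dexps q (Mul Rn Rn)) v\<bar> \<le> weight \<gamma> q * (fact ?n * (1 / b\<^sup>2 * (5 / b) ^ ?n))" .
    have "(5 / (2 * b)) ^ ?n \<le> (5 / b) ^ ?n"
      using b by (intro power_mono) (auto simp: field_simps)
    then have "fact ?n * (1 / b * (5 / (2 * b)) ^ ?n) * weight \<gamma> q \<le> fact ?n * (1 / b * (5 / b) ^ ?n) * weight \<gamma> q"
      using b W0[OF q] by (intro mult_right_mono mult_left_mono) auto
    with R[of q] have R': "\<bar>ev w \<xi> \<eta> (dexps q Rn) v\<bar> \<le> fact ?n * (1 / b * (5 / b) ^ ?n) * weight \<gamma> q" by simp
    have "\<bar>ev w \<xi> \<eta> (dexps q E) v\<bar> \<le> \<bar>ev w \<xi> \<eta> (dexps q Rn) v\<bar> + a * \<bar>ev w \<xi> \<eta> (dexps q (Mul Rn Rn)) v\<bar>"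
      unfolding E_def ev_dexps_Add ev_dexps_Const_Mul using a
      by (metis abs_minus_cancel abs_mult abs_of_nonneg abs_triangle_ineq)
    also have "\<dots> \<le> fact ?n * (1 / b * (5 / b) ^ ?n) * weight \<gamma> q + a * (weight \<gamma> q * (fact ?n * (1 / b\<^sup>2 * (5 / b) ^ ?n)))"
      using R' RR a by (intro add_mono mult_left_mono) auto
    also have "\<dots> = fact ?n * (K * (5 / b) ^ ?n) * weight \<gamma> q"
      by (simp add: K_def algebra_simps)
    finally show ?thesis .
  qed
  have inner: "\<bar>w k \<bullet> z\<bar> \<le> norm z * \<gamma> k" if "k \<in> set p" for k z
    using Cauchy_Schwarz_ineq2[of "w k" z] mult_right_mono[OF w[OF that] norm_ge_zero[of z]] by (simp add: mult.commute)
  have Y: "\<bar>ev w \<xi> \<eta> (dexps q VY) v\<bar> \<le> fact (length q) * first_three (norm \<eta> * b) (norm \<eta>) 0 (length q) * weight \<gamma> q"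
    if "set q \<subseteq> set p" for q
    using that Cauchy_Schwarz_ineq2[of v \<eta>] inner unfolding dexps_VY by (auto split: list.splits simp: b_def mult.commute)
  have X: "\<bar>ev w \<xi> \<eta> (dexps q VX) v\<bar> \<le> fact (length q) * first_three (norm \<xi> * b) (norm \<xi>) 0 (length q) * weight \<gamma> q"
    if "set q \<subseteq> set p" for q
    using that Cauchy_Schwarz_ineq2[of v \<xi>] inner unfolding dexps_VX by (auto split: list.splits simp: b_def mult.commute)
  have YE: "\<bar>ev w \<xi> \<eta> (dexps q (Mul VY E)) v\<bar> \<le> fact (length q) * ((6 / 5 * b * norm \<eta> * K) * (5 / b) ^ length q) * weight \<gamma> q"
    if q: "set q \<subseteq> set p" for q
    unfolding ev_dexps_Mul using q by (intro leibniz_order_one_bound[OF Y E]) (use b K \<gamma>0 in auto)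
  have XYE: "\<bar>ev w \<xi> \<eta> (dexps p (Mul VX (Mul VY E))) v\<bar> \<le> fact (length p) * ((6 / 5 * b * norm \<xi> * (6 / 5 * b * norm \<eta> * K)) * (5 / b) ^ length p) * weight \<gamma> p"
    unfolding ev_dexps_Mul[of w \<xi> \<eta> p VX] by (intro leibniz_order_one_bound[OF X YE]) (use b K \<gamma>0 in auto)
  have XY: "\<bar>ev w \<xi> \<eta> (dexps p XY) v\<bar> \<le> fact (length p) * (5 / b) ^ length p * weight \<gamma> p * (norm \<xi> * norm \<eta>)"
    using Cauchy_Schwarz_ineq2[of \<xi> \<eta>] W0[of p] b by (auto simp: dexps_XY)
  have "\<bar>ev w \<xi> \<eta> (dexps p (Aexp a)) v\<bar> \<le> a * \<bar>ev w \<xi> \<eta> (dexps p XY) v\<bar> + \<bar>ev w \<xi> \<eta> (dexps p (Mul VX (Mul VY E))) v\<bar>"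
    unfolding Aexp_def E_def[symmetric] ev_dexps_Add ev_dexps_Const_Mul using a
    by (metis abs_mult abs_of_nonneg abs_triangle_ineq)
  also have "\<dots> \<le> a * (fact (length p) * (5 / b) ^ length p * weight \<gamma> p * (norm \<xi> * norm \<eta>))
     + fact (length p) * ((6 / 5 * b * norm \<xi> * (6 / 5 * b * norm \<eta> * K)) * (5 / b) ^ length p) * weight \<gamma> p"
    using XY XYE a by (intro add_mono mult_left_mono) auto
  also have "\<dots> = (a + 36 / 25 * (b\<^sup>2 * K)) * (fact (length p) * (5 / b) ^ length p * weight \<gamma> p) * (norm \<xi> * norm \<eta>)"
    by (simp add: algebra_simps power2_eq_square)
  also have "b\<^sup>2 * K = b + a"
    using b by (simp add: K_def field_simps power2_eq_square)
  also have "(a + 36 / 25 * (b + a)) * (fact (length p) * (5 / b) ^ length p * weight \<gamma> p) * (norm \<xi> * norm \<eta>)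
     \<le> 3 * (a + b) * (fact (length p) * (5 / b) ^ length p * weight \<gamma> p) * (norm \<xi> * norm \<eta>)"
    using a b W0[of p] by (intro mult_right_mono) auto
  finally show ?thesis by (simp add: b_def)
qed

text \<open>Linearity is evident before differentiation, and \<open>ev_dexps_lin\<close> carries it
  to all derivatives; the same holds in the second gradient.\<close>

lemma Aexp_linear_left:
  fixes v :: "'a::real_inner"
  assumes "v \<noteq> 0"
  shows "ev w (b *\<^sub>R \<xi> + c *\<^sub>R \<xi>') \<eta> (dexps p (Aexp a)) v
    = b * ev w \<xi> \<eta> (dexps p (Aexp a)) v + c * ev w \<xi>' \<eta> (dexps p (Aexp a)) v"
  by (rule ev_dexps_lin[OF _ assms]) (simp add: Aexp_def inner_simps algebra_simps add_divide_distrib)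

lemma Aexp_linear_right:
  fixes v :: "'a::real_inner"
  assumes "v \<noteq> 0"
  shows "ev w \<xi> (b *\<^sub>R \<eta> + c *\<^sub>R \<eta>') (dexps p (Aexp a)) v
    = b * ev w \<xi> \<eta> (dexps p (Aexp a)) v + c * ev w \<xi> \<eta>' (dexps p (Aexp a)) v"
  by (rule ev_dexps_lin[OF _ assms]) (simp add: Aexp_def inner_simps algebra_simps add_divide_distrib)

lemma Aexp_diffusion_matrix_nonzero:
  fixes v :: "real^'d"
  assumes "v \<noteq> 0"
  shows "(diffusion_matrix a v *v \<xi>) \<bullet> \<eta> = ev w \<xi> \<eta> (Aexp a) v"
proof -
  have o: "outer_prod v v *v \<xi> = (v \<bullet> \<xi>) *\<^sub>R v"
    by (simp add: outer_prod_def matrix_vector_mult_def vec_eq_iff inner_vec_def sum_distrib_left sum_distrib_right mult_ac)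
  have "(norm v - a) / (v \<bullet> v) = 1 / norm v - a * (1 / norm v * (1 / norm v))"
    using assms by (simp add: field_simps power2_norm_eq_inner[symmetric] power2_eq_square)
  then show ?thesis
    unfolding diffusion_matrix_def
    by (simp only: matrix_vector_mult_add_rdistrib scaleR_matrix_vector_assoc[symmetric] o)
      (simp add: Aexp_def inner_simps algebra_simps)
qed

lemma Aexp_sym:
  "ev w \<xi> \<eta> (Aexp a) v = ev w \<eta> \<xi> (Aexp a) v"
  by (simp add: Aexp_def inner_commute mult_ac)

text \<open>The matrix has eigenvalue \<open>norm v\<close> in the direction of \<open>v\<close> and
  \<open>a\<close> on its orthogonal complement. In the proof, \<open>s\<close> is the squared
  length of the component of \<open>\<xi>\<close> along \<open>v\<close>.\<close>

lemma Aexp_coercive: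
  fixes v :: "'a::real_inner"
  assumes "v \<noteq> 0" "c \<le> norm v" "c \<le> a"
  shows "c * (norm \<xi>)\<^sup>2 \<le> ev w \<xi> \<xi> (Aexp a) v"
proof -
  define b where "b = norm v"
  define s where "s = (v \<bullet> \<xi>)\<^sup>2 / b\<^sup>2"
  have b: "b > 0" using assms by (simp add: b_def)
  have "(v \<bullet> \<xi>)\<^sup>2 \<le> b\<^sup>2 * (norm \<xi>)\<^sup>2"
    using Cauchy_Schwarz_ineq[of v \<xi>] by (simp add: b_def power2_norm_eq_inner)
  then have s: "s \<le> (norm \<xi>)\<^sup>2" "s \<ge> 0" using b by (auto simp: s_def field_simps)
  have "ev w \<xi> \<xi> (Aexp a) v = a * (norm \<xi>)\<^sup>2 + (b - a) * s"
    using b unfolding power2_norm_eq_inner by (simp add: Aexp_def s_def b_def[symmetric] field_simps power2_eq_square)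
  also have "\<dots> = a * ((norm \<xi>)\<^sup>2 - s) + b * s" by (simp add: algebra_simps)
  also have "\<dots> \<ge> c * ((norm \<xi>)\<^sup>2 - s) + c * s"
    using s assms by (intro add_mono mult_right_mono) (auto simp: b_def)
  finally show ?thesis by (simp add: algebra_simps)
qed

section \<open>Taylor remainder of the form in one parameter\<close>

lemma second_order_remainder:
  fixes f f' f'' :: "real \<Rightarrow> real"
  assumes "\<And>t. \<bar>t\<bar> \<le> \<bar>h\<bar> \<Longrightarrow> (f has_real_derivative f' t) (at t)"
    and "\<And>t. \<bar>t\<bar> \<le> \<bar>h\<bar> \<Longrightarrow> (f' has_real_derivative f'' t) (at t)"
    and B: "\<And>t. \<bar>t\<bar> \<le> \<bar>h\<bar> \<Longrightarrow> \<bar>f'' t\<bar> \<le> B"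
  shows "\<bar>f h - f 0 - h * f' 0\<bar> \<le> B * h\<^sup>2"
proof -
  let ?S = "{-\<bar>h\<bar>..\<bar>h\<bar>}"
  have "B \<ge> 0" using B[of 0] by auto
  have 1: "\<bar>f' t - f' 0\<bar> \<le> B * \<bar>h\<bar>" if "\<bar>t\<bar> \<le> \<bar>h\<bar>" for t
  proof -
    have "norm (f' t - f' 0) \<le> B * norm (t - 0)"
      by (rule field_differentiable_bound[of ?S f' f''])
        (use assms that in \<open>auto intro: has_field_derivative_at_within\<close>)
    also have "\<dots> \<le> B * \<bar>h\<bar>" using that \<open>B \<ge> 0\<close> by (auto intro: mult_left_mono)
    finally show ?thesis by simp
  qed
  \<comment> \<open>A second use of the mean value inequality, now for \<open>f\<close> minus its
    linear part, whose derivative has just been bounded.\<close>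
  have "norm ((f h - h * f' 0) - (f 0 - 0 * f' 0)) \<le> (B * \<bar>h\<bar>) * norm (h - 0)"
    by (rule field_differentiable_bound[of ?S "\<lambda>t. f t - t * f' 0" "\<lambda>t. f' t - f' 0"])
      (use assms 1 in \<open>auto intro!: derivative_eq_intros intro: has_field_derivative_at_within\<close>)
  then show ?thesis by (simp add: power2_eq_square algebra_simps)
qed

text \<open>The restriction on \<open>h\<close> keeps the segment starting at \<open>v\<close>
  between the norms \<open>c / 2\<close> and \<open>2 * d\<close>. On it the ratio 5 over the norm
  is at most \<open>10 / c\<close>, and the prefactor at most 3 * (d + 2 * d) = 9 * d. The resulting
  constant is the same at all points of the domain, so the estimate can be integrated.\<close>

lemma Aexp_remainder:
  fixes v :: "'a::real_inner"
  assumes v: "0 < c" "c \<le> norm v" "norm v \<le> d" and a: "0 \<le> a" "a \<le> d"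
    and w: "\<And>j. j \<in> set (k # p) \<Longrightarrow> norm (w j) \<le> \<gamma> j" and h: "\<bar>h\<bar> * \<gamma> k \<le> c / 2"
  shows "\<bar>ev w \<xi> \<eta> (dexps p (Aexp a)) (v + h *\<^sub>R w k) - ev w \<xi> \<eta> (dexps p (Aexp a)) v
      - h * ev w \<xi> \<eta> (dexps (k # p) (Aexp a)) v\<bar>
    \<le> (9 * d * (fact (length p + 2) * (10 / c) ^ (length p + 2) * (\<gamma> k * (\<gamma> k * weight \<gamma> p)))) * (norm \<xi> * norm \<eta>) * h\<^sup>2"
proof -
  have \<gamma>0: "0 \<le> \<gamma> j" if "j \<in> set (k # p)" for j
    using w[OF that] norm_ge_zero[of "w j"] by linarith
  have W0: "0 \<le> \<gamma> k * (\<gamma> k * weight \<gamma> p)"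
    using \<gamma>0 by (intro mult_nonneg_nonneg weight_nonneg) auto
  have near: "c / 2 \<le> norm (v + t *\<^sub>R w k) \<and> norm (v + t *\<^sub>R w k) \<le> 2 * d" if "\<bar>t\<bar> \<le> \<bar>h\<bar>" for t
  proof -
    have "norm (t *\<^sub>R w k) \<le> \<bar>h\<bar> * \<gamma> k"
      using that w[of k] by (auto intro!: mult_mono)
    with h have "norm (t *\<^sub>R w k) \<le> c / 2" by simp
    then show ?thesis
      using norm_triangle_ineq[of v "t *\<^sub>R w k"] norm_diff_ineq[of v "t *\<^sub>R w k"] v by auto
  qed
  have D: "((\<lambda>t. ev w \<xi> \<eta> (dexps q (Aexp a)) (v + t *\<^sub>R w k)) has_real_derivative
     ev w \<xi> \<eta> (dexps (k # q) (Aexp a)) (v + t *\<^sub>R w k)) (at t)" if "\<bar>t\<bar> \<le> \<bar>h\<bar>" for q t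
  proof -
    have "v + t *\<^sub>R w k \<noteq> 0" using near[OF that] v by (metis half_gt_zero norm_zero not_less)
    then show ?thesis using ev_deriv[of v t w k \<xi> \<eta> "dexps q (Aexp a)"] by simp
  qed
  have B: "\<bar>ev w \<xi> \<eta> (dexps (k # k # p) (Aexp a)) (v + t *\<^sub>R w k)\<bar>
     \<le> (9 * d * (fact (length p + 2) * (10 / c) ^ (length p + 2) * (\<gamma> k * (\<gamma> k * weight \<gamma> p)))) * (norm \<xi> * norm \<eta>)"
    if t: "\<bar>t\<bar> \<le> \<bar>h\<bar>" for t
  proof -
    let ?z = "v + t *\<^sub>R w k"
    have z: "c / 2 \<le> norm ?z" "norm ?z \<le> 2 * d" "?z \<noteq> 0" using near[OF t] v by auto
    have "\<bar>ev w \<xi> \<eta> (dexps (k # k # p) (Aexp a)) ?z\<bar>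
      \<le> 3 * (a + norm ?z) * (fact (length (k # k # p)) * (5 / norm ?z) ^ length (k # k # p) * weight \<gamma> (k # k # p)) * (norm \<xi> * norm \<eta>)"
      by (rule Aexp_deriv_bound) (use z a w in auto)
    also have "\<dots> = 3 * (a + norm ?z) * (fact (length p + 2) * (5 / norm ?z) ^ (length p + 2) * (\<gamma> k * (\<gamma> k * weight \<gamma> p))) * (norm \<xi> * norm \<eta>)"
      by simp
    also have "\<dots> \<le> (9 * d) * (fact (length p + 2) * (10 / c) ^ (length p + 2) * (\<gamma> k * (\<gamma> k * weight \<gamma> p))) * (norm \<xi> * norm \<eta>)"
    proof (rule mult_right_mono, rule mult_mono, goal_cases)
      case 1 show ?case using add_mono[OF a(2) z(2)] by simp
    next
      case 2
      have "5 / norm ?z \<le> 10 / c" using z v by (simp add: field_simps)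
      then show ?case using W0 v by (intro mult_right_mono mult_left_mono power_mono) auto
    qed (use z a W0 v in auto)
    finally show ?thesis .
  qed
  show ?thesis
    using second_order_remainder[of h "\<lambda>t. ev w \<xi> \<eta> (dexps p (Aexp a)) (v + t *\<^sub>R w k)"
        "\<lambda>t. ev w \<xi> \<eta> (dexps (k # p) (Aexp a)) (v + t *\<^sub>R w k)" "\<lambda>t. ev w \<xi> \<eta> (dexps (k # k # p) (Aexp a)) (v + t *\<^sub>R w k)", OF D D B]
    by simp
qed

section \<open>Parametric families of coercive forms\<close>

text \<open>The function spaces are sets rather than types; this single operation carries their
  linear structure, covering sums, differences and multiples.\<close>

definition lincomb :: "real \<Rightarrow> ('a \<Rightarrow> real) \<Rightarrow> real \<Rightarrow> ('a \<Rightarrow> real) \<Rightarrow> 'a \<Rightarrow> real" where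
  "lincomb b u c v = (\<lambda>x. b * u x + c * v x)"

text \<open>Serves both Cauchy-Schwarz inequalities below and, with \<open>c = 0\<close>, the first
  variation at a minimiser, where it forces \<open>b = 0\<close>. The sign of \<open>a\<close> is
  derived from the assumption.\<close>

lemma nonneg_quadratic_discriminant:
  fixes a b c :: real
  assumes "\<And>t. 0 \<le> a * t\<^sup>2 + 2 * b * t + c"
  shows "b\<^sup>2 \<le> a * c"
proof (cases "a = 0")
  case True
  have "b = 0"
  proof (rule ccontr)
    assume "b \<noteq> 0"
    then show False using assms[of "- (c + 1) / (2 * b)"] True by (simp add: field_simps)
  qed
  then show ?thesis using True by simp
next
  case False
  have "a > 0"
  proof (rule ccontr)
    assume "\<not> a > 0"
    with False have a: "a < 0" by simp
    \<comment> \<open>Chosen so that \<open>- a * t\<close> exceeds twice the sum of the other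
      coefficients while t \<ge> 1; the polynomial is then negative at \<open>t\<close>.\<close>
    define t where "t = 2 * (\<bar>b\<bar> + \<bar>c\<bar> + 1) / (- a) + 1"
    have t: "t \<ge> 1" "- a * t \<ge> 2 * (\<bar>b\<bar> + \<bar>c\<bar> + 1)"
      using a by (auto simp: t_def field_simps)
    have "2 * (\<bar>b\<bar> + \<bar>c\<bar> + 1) * t \<le> (- a * t) * t" using t by (intro mult_right_mono) auto
    moreover have "2 * b * t \<le> 2 * \<bar>b\<bar> * t" using t by (intro mult_right_mono) auto
    moreover have "(2 * \<bar>c\<bar> + 2) * t \<ge> (2 * \<bar>c\<bar> + 2) * 1" using t by (intro mult_left_mono) auto
    ultimately show False using assms[of t] by (simp add: power2_eq_square algebra_simps)
  qed
  then show ?thesis using assms[of "- b / a"] by (simp add: field_simps power2_eq_square)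
qed

text \<open>Only semidefinite: functions that agree almost everywhere are not identified, so
  \<open>ip v v = 0\<close> does not force \<open>v\<close> to be zero.\<close>

locale semi_inner =
  fixes S :: "('a \<Rightarrow> real) set" and ip :: "('a \<Rightarrow> real) \<Rightarrow> ('a \<Rightarrow> real) \<Rightarrow> real"
  assumes nonempty: "S \<noteq> {}"
    and lincomb_in: "\<And>u v b c. u \<in> S \<Longrightarrow> v \<in> S \<Longrightarrow> lincomb b u c v \<in> S"
    and ip_lincomb: "\<And>u v w b c. u \<in> S \<Longrightarrow> v \<in> S \<Longrightarrow> w \<in> S \<Longrightarrow>
       ip (lincomb b u c v) w = b * ip u w + c * ip v w"
    and ip_commute: "\<And>u v. u \<in> S \<Longrightarrow> v \<in> S \<Longrightarrow> ip u v = ip v u"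
    and ip_nonneg: "\<And>v. v \<in> S \<Longrightarrow> 0 \<le> ip v v"
begin

lemma ip_lincomb_right:
  "u \<in> S \<Longrightarrow> v \<in> S \<Longrightarrow> w \<in> S \<Longrightarrow> ip w (lincomb b u c v) = b * ip w u + c * ip w v"
  by (simp add: ip_commute[of w] lincomb_in ip_lincomb)

lemma ip_lincomb_self:
  "u \<in> S \<Longrightarrow> v \<in> S \<Longrightarrow> ip (lincomb b u c v) (lincomb b u c v) = b\<^sup>2 * ip u u + 2 * b * c * ip u v + c\<^sup>2 * ip v v"
  by (simp add: ip_lincomb ip_lincomb_right lincomb_in ip_commute[of v u] algebra_simps power2_eq_square)

lemma ip_Cauchy_Schwarz:
  assumes "u \<in> S" "v \<in> S"
  shows "\<bar>ip u v\<bar> \<le> sqrt (ip u u) * sqrt (ip v v)"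
proof -
  have "(ip u v)\<^sup>2 \<le> ip u u * ip v v"
  proof (rule nonneg_quadratic_discriminant)
    fix t
    show "0 \<le> ip u u * t\<^sup>2 + 2 * ip u v * t + ip v v"
      using ip_nonneg[OF lincomb_in[OF assms], of t 1] unfolding ip_lincomb_self[OF assms] by (simp add: algebra_simps)
  qed
  then show ?thesis
    by (metis real_sqrt_abs real_sqrt_le_mono real_sqrt_mult)
qed


text \<open>The representing element minimises the energy \<open>J\<close>. Minimising sequences are
  Cauchy by the parallelogram law, and vanishing of the first variation at the limit is the desired
  equation. Completeness is phrased in terms of \<open>ip\<close> itself.\<close>

lemma Riesz_representation:
  assumes complete: "\<And>X. (\<And>n. X n \<in> S) \<Longrightarrow>
      (\<And>e. e > 0 \<Longrightarrow> \<exists>N. \<forall>m\<ge>N. \<forall>n\<ge>N. ip (lincomb 1 (X m) (-1) (X n)) (lincomb 1 (X m) (-1) (X n)) < e) \<Longrightarrow>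
      \<exists>l\<in>S. (\<lambda>n. ip (lincomb 1 (X n) (-1) l) (lincomb 1 (X n) (-1) l)) \<longlonglongrightarrow> 0"
    and F_lincomb: "\<And>u v b c. u \<in> S \<Longrightarrow> v \<in> S \<Longrightarrow> F (lincomb b u c v) = b * F u + c * F v"
    and F_bound: "\<And>v. v \<in> S \<Longrightarrow> \<bar>F v\<bar> \<le> C * sqrt (ip v v)"
  shows "\<exists>w\<in>S. \<forall>v\<in>S. ip w v = F v"
proof -
  define J where "J v = ip v v - 2 * F v" for v
  have J_below: "- C\<^sup>2 \<le> J v" if "v \<in> S" for v
  proof -
    have "0 \<le> (sqrt (ip v v) - C)\<^sup>2" by simp
    then show ?thesis
      using F_bound[OF that] ip_nonneg[OF that] by (simp add: J_def power2_diff algebra_simps)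
  qed
  then have bdd: "bdd_below (J ` S)" by (auto simp: bdd_below_def)
  define m where "m = Inf (J ` S)"
  have m_le: "m \<le> J v" if "v \<in> S" for v
    unfolding m_def by (rule cInf_lower) (use that bdd in auto)
  have "\<exists>v\<in>S. J v < m + 1 / Suc n" for n
  proof -
    have "\<exists>z\<in>J ` S. z < m + 1 / Suc n"
      unfolding m_def by (rule cInf_lessD) (use nonempty in auto)
    then show ?thesis by auto
  qed
  then obtain X where X: "\<And>n. X n \<in> S" "\<And>n. J (X n) < m + 1 / Suc n"
    by metis
  have J_lincomb: "J (lincomb b u c v) = b\<^sup>2 * ip u u + 2 * b * c * ip u v + c\<^sup>2 * ip v v - 2 * b * F u - 2 * c * F v"
    if "u \<in> S" "v \<in> S" for u v b c
    using that by (simp add: J_def ip_lincomb_self F_lincomb algebra_simps)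
  \<comment> \<open>Parallelogram law: the midpoint has energy at least \<open>m\<close>, so the
    distance of two members is controlled by their excess over the infimum.\<close>
  have diff: "ip (lincomb 1 (X i) (-1) (X j)) (lincomb 1 (X i) (-1) (X j)) < 2 / Suc i + 2 / Suc j" for i j
  proof -
    have "m \<le> J (lincomb (1/2) (X i) (1/2) (X j))" by (intro m_le lincomb_in X)
    moreover have "ip (lincomb 1 (X i) (-1) (X j)) (lincomb 1 (X i) (-1) (X j))
       = 2 * J (X i) + 2 * J (X j) - 4 * J (lincomb (1/2) (X i) (1/2) (X j))"
      using X by (simp add: J_lincomb ip_lincomb_self) (simp add: J_def field_simps power2_eq_square)
    ultimately show ?thesis using X(2)[of i] X(2)[of j] by simp
  qed
  have "\<exists>l\<in>S. (\<lambda>n. ip (lincomb 1 (X n) (-1) l) (lincomb 1 (X n) (-1) l)) \<longlonglongrightarrow> 0"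
  proof (rule complete[OF X(1)])
    fix e :: real assume "e > 0"
    then obtain N where N: "4 / e < real N" using reals_Archimedean2 by blast
    have "2 / Suc i < e / 2" if "i \<ge> N" for i
    proof -
      have "4 / e < Suc i" using N that by simp
      then show ?thesis using \<open>e > 0\<close> by (simp add: field_simps)
    qed
    then show "\<exists>N. \<forall>i\<ge>N. \<forall>j\<ge>N. ip (lincomb 1 (X i) (-1) (X j)) (lincomb 1 (X i) (-1) (X j)) < e"
      using diff by (intro exI[of _ N]) (smt (verit) field_sum_of_halves)
  qed
  then obtain l where l: "l \<in> S" "(\<lambda>n. ip (lincomb 1 (X n) (-1) l) (lincomb 1 (X n) (-1) l)) \<longlonglongrightarrow> 0" by auto
  define d where "d n = lincomb 1 (X n) (-1) l" for n
  have dS: "d n \<in> S" for n unfolding d_def by (intro lincomb_in X l)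
  have d0: "(\<lambda>n. sqrt (ip (d n) (d n))) \<longlonglongrightarrow> 0"
    using tendsto_real_sqrt[OF l(2)] by (simp add: d_def)
  have "(\<lambda>n. ip (d n) l) \<longlonglongrightarrow> 0"
  proof (rule Lim_null_comparison)
    show "(\<lambda>n. sqrt (ip (d n) (d n)) * sqrt (ip l l)) \<longlonglongrightarrow> 0" by (rule tendsto_mult_left_zero[OF d0])
  qed (use ip_Cauchy_Schwarz[OF dS l(1)] in auto)
  moreover have "(\<lambda>n. F (d n)) \<longlonglongrightarrow> 0"
  proof (rule Lim_null_comparison)
    show "(\<lambda>n. C * sqrt (ip (d n) (d n))) \<longlonglongrightarrow> 0" by (rule tendsto_mult_right_zero[OF d0])
  qed (use F_bound[OF dS] in auto)
  ultimately have "(\<lambda>n. J l + ip (d n) (d n) + 2 * ip (d n) l - 2 * F (d n)) \<longlonglongrightarrow> J l + 0 + 2 * 0 - 2 * 0"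
    using l(2) unfolding d_def[symmetric] by (intro tendsto_intros)
  moreover have "J (X n) = J l + ip (d n) (d n) + 2 * ip (d n) l - 2 * F (d n)" for n
  proof -
    have "X n = lincomb 1 (d n) 1 l" by (simp add: d_def lincomb_def)
    then show ?thesis using J_lincomb[OF dS[of n] l(1), of 1 1] by (simp add: J_def)
  qed
  ultimately have "(\<lambda>n. J (X n)) \<longlonglongrightarrow> J l" by simp
  moreover have "(\<lambda>n. m + 1 / Suc n) \<longlonglongrightarrow> m + 0"
    by (intro tendsto_add tendsto_const) (use LIMSEQ_inverse_real_of_nat in \<open>simp add: inverse_eq_divide\<close>)
  ultimately have "J l \<le> m + 0"
    by (rule LIMSEQ_le) (use X(2) less_imp_le in blast)
  then have Jl: "J l \<le> m" by simp
  have "ip l v = F v" if v: "v \<in> S" for v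
  proof -
    \<comment> \<open>Along the line through \<open>l\<close> in direction \<open>v\<close> the
      energy is smallest at \<open>t = 0\<close>; a nonnegative quadratic without constant term has
      no linear term either.\<close>
    have "(ip l v - F v)\<^sup>2 \<le> ip v v * 0"
    proof (rule nonneg_quadratic_discriminant)
      fix t :: real
      have "J l \<le> J (lincomb 1 l t v)" using Jl m_le[OF lincomb_in[OF l(1) v]] by (rule order_trans)
      then show "0 \<le> ip v v * t\<^sup>2 + 2 * (ip l v - F v) * t + 0"
        using J_lincomb[OF l(1) v, of 1 t] by (simp add: J_def algebra_simps)
    qed
    then show ?thesis by simp
  qed
  with l(1) show ?thesis by blast
qed

end

text \<open>\<open>a y q\<close> plays the derivative of the form \<open>a y []\<close> along the
  directions \<open>q\<close>; that it is one is encoded in \<open>a_remainder\<close>. There a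
  single radius serves all \<open>q\<close>, so no minimum over sublists has to be taken, while the
  constant may depend on \<open>q\<close>.\<close>

locale parametric_forms =
  fixes S :: "('a \<Rightarrow> real) set" and nn :: "('a \<Rightarrow> real) \<Rightarrow> real"
    and a :: "(nat \<Rightarrow> real) \<Rightarrow> nat list \<Rightarrow> ('a \<Rightarrow> real) \<Rightarrow> ('a \<Rightarrow> real) \<Rightarrow> real"
    and Q :: "(nat \<Rightarrow> real) set" and I :: "nat set"
    and K \<kappa> \<theta> F0 :: real and \<gamma> :: "nat \<Rightarrow> real" and F :: "('a \<Rightarrow> real) \<Rightarrow> real"
    and u :: "(nat \<Rightarrow> real) \<Rightarrow> 'a \<Rightarrow> real"
  assumes lincomb_S: "\<And>v w b c. v \<in> S \<Longrightarrow> w \<in> S \<Longrightarrow> lincomb b v c w \<in> S"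
    and nn_nonneg: "\<And>v. v \<in> S \<Longrightarrow> 0 \<le> nn v"
    and a_left: "\<And>y q v w z b c. \<lbrakk>y \<in> Q; set q \<subseteq> I; v \<in> S; w \<in> S; z \<in> S\<rbrakk> \<Longrightarrow>
       a y q (lincomb b v c w) z = b * a y q v z + c * a y q w z"
    and a_right: "\<And>y q v w z b c. \<lbrakk>y \<in> Q; set q \<subseteq> I; v \<in> S; w \<in> S; z \<in> S\<rbrakk> \<Longrightarrow>
       a y q z (lincomb b v c w) = b * a y q z v + c * a y q z w"
    and a_bound: "\<And>y q v w. \<lbrakk>y \<in> Q; set q \<subseteq> I; v \<in> S; w \<in> S\<rbrakk> \<Longrightarrow>
       \<bar>a y q v w\<bar> \<le> K * (fact (length q) * \<kappa> ^ length q * weight \<gamma> q) * (nn v * nn w)"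
    and a_coercive: "\<And>y v. y \<in> Q \<Longrightarrow> v \<in> S \<Longrightarrow> \<theta> * (nn v)\<^sup>2 \<le> a y [] v v"
    and a_remainder: "\<And>y k. y \<in> Q \<Longrightarrow> k \<in> I \<Longrightarrow> \<exists>\<delta>>0. \<forall>q. set q \<subseteq> I \<longrightarrow>
       (\<exists>C. \<forall>h v w. \<bar>h\<bar> < \<delta> \<longrightarrow> y(k := y k + h) \<in> Q \<longrightarrow> v \<in> S \<longrightarrow> w \<in> S \<longrightarrow>
         \<bar>a (y(k := y k + h)) q v w - a y q v w - h * a y (k # q) v w\<bar> \<le> C * (nn v * nn w) * h\<^sup>2)"
    and Q_open: "\<And>y k. y \<in> Q \<Longrightarrow> k \<in> I \<Longrightarrow> \<forall>\<^sub>F h in nhds 0. y(k := y k + h) \<in> Q"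
    and solvable: "\<And>y G C. \<lbrakk>y \<in> Q; \<And>v w b c. v \<in> S \<Longrightarrow> w \<in> S \<Longrightarrow> G (lincomb b v c w) = b * G v + c * G w;
       \<And>v. v \<in> S \<Longrightarrow> \<bar>G v\<bar> \<le> C * nn v\<rbrakk> \<Longrightarrow> \<exists>w\<in>S. \<forall>v\<in>S. a y [] w v = G v"
    and constants: "0 < \<theta>" "0 \<le> K" "0 \<le> \<kappa>" "0 \<le> F0" "\<And>k. k \<in> I \<Longrightarrow> 0 \<le> \<gamma> k"
    and F_bound: "\<And>v. v \<in> S \<Longrightarrow> \<bar>F v\<bar> \<le> F0 * nn v"
    and u_solves: "\<And>y. y \<in> Q \<Longrightarrow> u y \<in> S" "\<And>y v. y \<in> Q \<Longrightarrow> v \<in> S \<Longrightarrow> a y [] (u y) v = F v"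
begin

text \<open>Formal differentiation of the weak problem along \<open>p\<close>. The load
  \<open>F\<close> does not depend on the parameters, so the right-hand side survives for the empty
  list only. Nothing here says that \<open>U\<close> consists of derivatives of \<open>u\<close>;
  \<open>U_derivative\<close> proves it.\<close>

definition derivative_family :: "((nat \<Rightarrow> real) \<Rightarrow> nat list \<Rightarrow> 'a \<Rightarrow> real) \<Rightarrow> bool" where
  "derivative_family U \<longleftrightarrow> (\<forall>y\<in>Q. U y [] = u y \<and> (\<forall>p. set p \<subseteq> I \<longrightarrow> U y p \<in> S \<and>
     (\<forall>v\<in>S. leibniz (\<lambda>q r. a y q (U y r) v) p = (if p = [] then F v else 0))))"

text \<open>In the equation for \<open>p\<close> the unknown \<open>U y p\<close> occurs only in the
  splitting with empty \<open>q\<close>; every other term involves a shorter list. The family is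
  thus built by recursion on length, each step being one coercive problem.\<close>

lemma derivative_family_exists: "\<exists>U. derivative_family U"
proof -
  have "\<exists>f. f [] = u y \<and> (\<forall>p. set p \<subseteq> I \<longrightarrow> f p \<in> S \<and>
     (\<forall>v\<in>S. leibniz (\<lambda>q r. a y q (f r) v) p = (if p = [] then F v else 0)))" if y: "y \<in> Q" for y
  proof -
    \<comment> \<open>For lists with directions outside \<open>I\<close> nothing is demanded beyond
      the value at the empty list, so the choice can be total. At the empty list the given solution
      \<open>u y\<close> is prescribed, not just any solution.\<close>
    define P where "P f p z \<longleftrightarrow> (p = [] \<longrightarrow> z = u y) \<and> (set p \<subseteq> I \<longrightarrow> z \<in> S \<and>
       (\<forall>v\<in>S. a y [] z v + leibniz (\<lambda>q r. if q = [] then 0 else a y q (f r) v) p = (if p = [] then F v else 0)))"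
      for f p z
    have "\<exists>f. \<forall>p. P f p (f p)"
    \<comment> \<open>The first goal of this principle is that \<open>P f p\<close> sees
      \<open>f\<close> at shorter lists only, the second that an admissible value exists.\<close>
    proof (rule dependent_wf_choice[of "Wellfounded.measure length"])
      fix f g :: "nat list \<Rightarrow> 'a \<Rightarrow> real" and p z
      assume *: "\<And>r. (r, p) \<in> Wellfounded.measure length \<Longrightarrow> f r = g r"
      have "leibniz (\<lambda>q r. if q = [] then 0 else a y q (f r) v) p
          = leibniz (\<lambda>q r. if q = [] then 0 else a y q (g r) v) p" for v
      proof (rule leibniz_cong)
        fix q r :: "nat list" assume "length q + length r = length p"
        then show "(if q = [] then 0 else a y q (f r) v) = (if q = [] then 0 else a y q (g r) v)"
          using *[of r] by (cases q) auto
      qed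
      then show "P f p z = P g p z" by (simp add: P_def)
    next
      fix p and f :: "nat list \<Rightarrow> 'a \<Rightarrow> real"
      assume IH: "\<And>r. (r, p) \<in> Wellfounded.measure length \<Longrightarrow> P f r (f r)"
      have fS: "f r \<in> S" if "length r < length p" "set r \<subseteq> I" for r
        using IH[of r] that by (simp add: P_def)
      show "\<exists>z. P f p z"
      proof (cases "p = [] \<or> \<not> set p \<subseteq> I")
        case True
        then show ?thesis using u_solves[OF y] by (auto simp: P_def)
      next
        case False
        define G where "G v = - leibniz (\<lambda>q r. if q = [] then 0 else a y q (f r) v) p" for v
        have shorter: "length r < length p" if "length q + length r = length p" "q \<noteq> []" for q r :: "nat list"
          using that by (cases q) auto
        have "\<exists>w\<in>S. \<forall>v\<in>S. a y [] w v = G v"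
        proof (rule solvable[OF y])
          fix v w b c assume vw: "v \<in> S" "w \<in> S"
          have "leibniz (\<lambda>q r. if q = [] then 0 else a y q (f r) (lincomb b v c w)) p
             = leibniz (\<lambda>q r. b * (if q = [] then 0 else a y q (f r) v) + c * (if q = [] then 0 else a y q (f r) w)) p"
            using False vw by (intro leibniz_cong) (auto simp: a_right[OF y] fS shorter)
          then show "G (lincomb b v c w) = b * G v + c * G w"
            unfolding G_def leibniz_add leibniz_cmult by simp
        next
          fix v assume v: "v \<in> S"
          have "\<bar>G v\<bar> \<le> leibniz (\<lambda>q r. \<bar>if q = [] then 0 else a y q (f r) v\<bar>) p"
            unfolding G_def abs_minus_cancel by (rule leibniz_abs)
          also have "\<dots> \<le> leibniz (\<lambda>q r. nn v * (if q = [] then 0 else K * (fact (length q) * \<kappa> ^ length q * weight \<gamma> q) * nn (f r))) p"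
          proof (rule leibniz_mono)
            fix q r assume "length q + length r = length p" "set q \<subseteq> set p" "set r \<subseteq> set p"
            then show "\<bar>if q = [] then 0 else a y q (f r) v\<bar> \<le> nn v * (if q = [] then 0 else K * (fact (length q) * \<kappa> ^ length q * weight \<gamma> q) * nn (f r))"
              using a_bound[OF y, of q "f r" v] False fS[OF shorter, of q r] v by (auto simp: mult_ac)
          qed
          finally show "\<bar>G v\<bar> \<le> leibniz (\<lambda>q r. if q = [] then 0 else K * (fact (length q) * \<kappa> ^ length q * weight \<gamma> q) * nn (f r)) p * nn v"
            unfolding leibniz_cmult by (simp add: mult.commute)
        qed
        with False show ?thesis by (auto simp: P_def G_def)
      qed
    qed simp
    then obtain f where f: "\<And>p. P f p (f p)" by blast
    have "leibniz (\<lambda>q r. a y q (f r) v) p = (if p = [] then F v else 0)" if "set p \<subseteq> I" "v \<in> S" for p v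
      using f[of p] that by (subst leibniz_split_head) (simp add: P_def)
    moreover have "f [] = u y" "set p \<subseteq> I \<Longrightarrow> f p \<in> S" for p
      using f[of p] f[of "[]"] by (simp_all add: P_def)
    ultimately show ?thesis by blast
  qed
  then show ?thesis unfolding derivative_family_def by (intro bchoice ballI) blast
qed

context
  fixes U assumes U: "derivative_family U"
begin

lemma U_in: "y \<in> Q \<Longrightarrow> set p \<subseteq> I \<Longrightarrow> U y p \<in> S"
  using U by (simp add: derivative_family_def)

lemma U_leibniz: "y \<in> Q \<Longrightarrow> set p \<subseteq> I \<Longrightarrow> v \<in> S \<Longrightarrow>
   leibniz (\<lambda>q r. a y q (U y r) v) p = (if p = [] then F v else 0)"
  using U by (simp add: derivative_family_def)

lemma coercive_imp_bound:
  assumes "y \<in> Q" "v \<in> S" "\<bar>a y [] v v\<bar> \<le> B * nn v" "0 \<le> B"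
  shows "nn v \<le> B / \<theta>"
proof (cases "nn v = 0")
  case False
  then have "nn v > 0" using nn_nonneg[OF assms(2)] by simp
  moreover have "\<theta> * (nn v)\<^sup>2 \<le> B * nn v"
    using a_coercive[OF assms(1,2)] assms(3) by linarith
  ultimately show ?thesis using constants(1) by (simp add: power2_eq_square field_simps)
qed (use assms constants in auto)

text \<open>Origin of the ratio \<open>1 + K / \<theta>\<close>: it is the \<open>L\<close> for
  which \<open>K\<close> times the geometric sum equals \<open>\<theta> * (L ^ n - 1)\<close>, so
  the majorant reproduces itself under the recursion.\<close>

lemma geometric_convolution:
  "K * (\<Sum>i\<le>n. if i = 0 then 0 else (1 + K / \<theta>) ^ (n - i)) \<le> \<theta> * (1 + K / \<theta>) ^ n"
proof (cases n)
  case (Suc m)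
  let ?L = "1 + K / \<theta>"
  have "(\<Sum>i\<le>n. if i = 0 then 0 else ?L ^ (n - i)) = (\<Sum>i<Suc m. ?L ^ (Suc m - Suc i))"
    unfolding Suc by (subst sum.atMost_Suc_shift) (simp add: lessThan_Suc_atMost)
  also have "\<dots> = (\<Sum>i<Suc m. ?L ^ i)" by (rule sum.nat_diff_reindex)
  finally have "K * (\<Sum>i\<le>n. if i = 0 then 0 else ?L ^ (n - i)) = \<theta> * ((?L - 1) * (\<Sum>i<Suc m. ?L ^ i))"
    using constants by simp
  also have "(?L - 1) * (\<Sum>i<Suc m. ?L ^ i) = ?L ^ Suc m - 1"
    by (rule power_diff_1_eq[symmetric])
  also have "\<theta> * (?L ^ Suc m - 1) \<le> \<theta> * ?L ^ n"
    using constants Suc by (intro mult_left_mono) auto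
  finally show ?thesis .
qed (use constants in auto)

text \<open>The equation for \<open>p\<close> is tested with \<open>U y p\<close> itself. Factorials
  and weights combine by \<open>leibniz_dominated\<close>, the powers of \<open>\<kappa>\<close>
  multiply to a constant, and only the geometric sum is left to be estimated.\<close>

lemma U_bound:
  assumes y: "y \<in> Q" and p: "set p \<subseteq> I"
  shows "nn (U y p) \<le> weight \<gamma> p * (fact (length p) * (\<kappa> ^ length p * (F0 / \<theta> * (1 + K / \<theta>) ^ length p)))"
  using p
proof (induction "length p" arbitrary: p rule: less_induct)
  case less
  let ?L = "1 + K / \<theta>" and ?n = "length p"
  have L: "?L \<ge> 0" using constants by (intro add_nonneg_nonneg divide_nonneg_pos) auto
  have US: "U y p \<in> S" using U_in[OF y less.prems] .
  have W: "weight \<gamma> p \<ge> 0" using less.prems constants by (intro weight_nonneg) auto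
  show ?case
  proof (cases "p = []")
    case True
    have "nn (U y p) \<le> F0 / \<theta>"
      by (rule coercive_imp_bound[OF y US]) (use U_leibniz[OF y less.prems US] F_bound[OF US] constants True in auto)
    then show ?thesis using True by simp
  next
    case False
    let ?m = "\<lambda>q r. if q = [] then 0 else a y q (U y r) (U y p)"
    let ?g = "\<lambda>i j. if i = 0 then 0 else K * (\<kappa> ^ i * (\<kappa> ^ j * (F0 / \<theta> * ?L ^ j))) * nn (U y p)"
    have "a y [] (U y p) (U y p) + leibniz ?m p = 0"
      using U_leibniz[OF y less.prems US] leibniz_split_head[of "\<lambda>q r. a y q (U y r) (U y p)" p] False by simp
    then have "\<bar>a y [] (U y p) (U y p)\<bar> = \<bar>leibniz ?m p\<bar>" by simp
    also have "\<dots> \<le> weight \<gamma> p * (fact ?n * (\<Sum>i\<le>?n. ?g i (?n - i)))"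
    proof (rule leibniz_dominated[where g = ?g])
      fix q r assume qr: "length q + length r = ?n" "set q \<subseteq> set p" "set r \<subseteq> set p"
      show "\<bar>?m q r\<bar> \<le> weight \<gamma> q * weight \<gamma> r * (fact (length q) * fact (length r) * ?g (length q) (length r))"
      proof (cases "q = []")
        case False
        have r: "length r < ?n" "set r \<subseteq> I" using False qr less.prems by (cases q; auto)+
        have W': "0 \<le> weight \<gamma> q" using qr less.prems constants by (intro weight_nonneg) auto
        have "\<bar>?m q r\<bar> \<le> K * (fact (length q) * \<kappa> ^ length q * weight \<gamma> q) * (nn (U y r) * nn (U y p))"
          using False a_bound[OF y, of q "U y r" "U y p"] qr less.prems U_in[OF y] US by auto
        also have "\<dots> \<le> K * (fact (length q) * \<kappa> ^ length q * weight \<gamma> q) *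
           ((weight \<gamma> r * (fact (length r) * (\<kappa> ^ length r * (F0 / \<theta> * ?L ^ length r)))) * nn (U y p))"
          using W' nn_nonneg[OF US] constants
          by (intro mult_left_mono[OF mult_right_mono[OF less.hyps[OF r]]] mult_nonneg_nonneg) auto
        finally show ?thesis using False by (simp add: mult_ac)
      qed simp
    qed
    finally have 1: "\<bar>a y [] (U y p) (U y p)\<bar> \<le> weight \<gamma> p * (fact ?n * (\<Sum>i\<le>?n. ?g i (?n - i)))" .
    have 2: "(\<Sum>i\<le>?n. ?g i (?n - i)) = (\<kappa> ^ ?n * (F0 / \<theta>)) * (K * (\<Sum>i\<le>?n. if i = 0 then 0 else ?L ^ (?n - i))) * nn (U y p)"
      unfolding sum_distrib_left sum_distrib_right
    proof (rule sum.cong[OF refl])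
      fix i assume "i \<in> {..?n}"
      then have n: "\<kappa> ^ i * \<kappa> ^ (?n - i) = \<kappa> ^ ?n" using power_add[of \<kappa> i "?n - i"] by simp
      have "K * (x * (z * (c * l))) * N = ((x * z) * c) * (K * l) * N" for x z c l N :: real
        by (simp only: mult_ac)
      then show "?g i (?n - i) = (\<kappa> ^ ?n * (F0 / \<theta>)) * (K * (if i = 0 then 0 else ?L ^ (?n - i))) * nn (U y p)"
        unfolding n[symmetric] by (cases "i = 0") (simp_all only: if_True if_False simp_thms mult_zero_left mult_zero_right)
    qed
    have 3: "weight \<gamma> p * (fact ?n * ((\<kappa> ^ ?n * (F0 / \<theta>)) * (K * (\<Sum>i\<le>?n. if i = 0 then 0 else ?L ^ (?n - i))) * nn (U y p))) \<le> weight \<gamma> p * (fact ?n * ((\<kappa> ^ ?n * (F0 / \<theta>)) * (\<theta> * ?L ^ ?n) * nn (U y p)))"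
    proof (rule mult_left_mono[OF mult_left_mono[OF mult_right_mono[OF mult_left_mono[OF geometric_convolution]]]])
      show "0 \<le> \<kappa> ^ ?n * (F0 / \<theta>)" using constants by simp
    qed (use W nn_nonneg[OF US] in auto)
    have "\<bar>a y [] (U y p) (U y p)\<bar> \<le> (\<theta> * (weight \<gamma> p * (fact ?n * (\<kappa> ^ ?n * (F0 / \<theta> * ?L ^ ?n))))) * nn (U y p)"
    proof -
      have "w * (f * ((z * x) * (\<theta> * l) * N)) = (\<theta> * (w * (f * (z * (x * l))))) * N" for w f z x l N :: real
        by (simp only: mult_ac)
      from order_trans[OF 1[unfolded 2] 3, unfolded this] show ?thesis .
    qed
    then have "nn (U y p) \<le> (\<theta> * (weight \<gamma> p * (fact ?n * (\<kappa> ^ ?n * (F0 / \<theta> * ?L ^ ?n))))) / \<theta>"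
    proof (rule coercive_imp_bound[OF y US])
      have "0 \<le> F0 / \<theta>" "0 \<le> ?L ^ ?n" "0 \<le> \<kappa> ^ ?n" using constants L by simp_all
      then show "0 \<le> \<theta> * (weight \<gamma> p * (fact ?n * (\<kappa> ^ ?n * (F0 / \<theta> * ?L ^ ?n))))"
        using W constants by (intro mult_nonneg_nonneg) auto
    qed
    then show ?thesis using constants by simp
  qed
qed

text \<open>The equation at the shifted parameter minus that at \<open>y\<close>, divided by
  \<open>h\<close>, minus the equation for \<open>k # p\<close>, is a Leibniz system for the errors
  \<open>D h r\<close> with the form at the shifted parameter. Terms with shorter \<open>r\<close>
  vanish in the limit by induction; the remaining one is controlled by coercivity, whose constant is
  independent of \<open>h\<close>.\<close>

lemma U_derivative:
  assumes y: "y \<in> Q" and k: "k \<in> I" and p: "set p \<subseteq> I"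
  shows "((\<lambda>h. nn (\<lambda>x. (U (y(k := y k + h)) p x - U y p x) / h - U y (k # p) x)) \<longlongrightarrow> 0) (at 0)"
  using p
proof (induction "length p" arbitrary: p rule: less_induct)
  case less
  define yh where "yh h = y(k := y k + h)" for h
  define D where "D h r = (\<lambda>x. (U (yh h) r x - U y r x) / h - U y (k # r) x)" for h r
  define B where "B q = K * (fact (length q) * \<kappa> ^ length q * weight \<gamma> q)" for q
  have D_eq: "D h r = lincomb 1 (lincomb (1 / h) (U (yh h) r) (- 1 / h) (U y r)) (-1) (U y (k # r))" for h r
    by (auto simp: D_def lincomb_def fun_eq_iff diff_divide_distrib)
  have DS: "D h r \<in> S" if "yh h \<in> Q" "set r \<subseteq> I" for h r
    unfolding D_eq using that y k by (intro lincomb_S U_in) auto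
  obtain \<delta> where \<delta>: "\<delta> > 0" and "\<forall>q. set q \<subseteq> I \<longrightarrow> (\<exists>C. \<forall>h v w. \<bar>h\<bar> < \<delta> \<longrightarrow> yh h \<in> Q \<longrightarrow> v \<in> S \<longrightarrow> w \<in> S \<longrightarrow>
         \<bar>a (yh h) q v w - a y q v w - h * a y (k # q) v w\<bar> \<le> C * (nn v * nn w) * h\<^sup>2)"
    using a_remainder[OF y k] unfolding yh_def by blast
  then obtain C where C: "\<And>q h v w. set q \<subseteq> I \<Longrightarrow> \<bar>h\<bar> < \<delta> \<Longrightarrow> yh h \<in> Q \<Longrightarrow> v \<in> S \<Longrightarrow> w \<in> S \<Longrightarrow>
         \<bar>a (yh h) q v w - a y q v w - h * a y (k # q) v w\<bar> \<le> C q * (nn v * nn w) * h\<^sup>2"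
    by metis
  \<comment> \<open>Bound for the consistency error \<open>e2\<close> below: the change of the form
    acting on \<open>U y (k # r)\<close>, and the Taylor remainder divided by \<open>h\<close>
    acting on \<open>U y r\<close>.\<close>
  define R where "R h q r = (C q * h\<^sup>2 + \<bar>h\<bar> * B (k # q)) * nn (U y (k # r)) + C q * nn (U y r) * \<bar>h\<bar>" for h q r
  define E where "E h = leibniz (\<lambda>q r. (if q = [] then 0 else B q * nn (D h r)) + R h q r) p" for h
  have "(E \<longlongrightarrow> leibniz (\<lambda>q r. 0) p) (at 0)"
    unfolding E_def
  proof (rule leibniz_tendsto)
    fix q r assume qr: "length q + length r = length p" "set q \<subseteq> set p" "set r \<subseteq> set p"
    have "((\<lambda>h. R h q r) \<longlongrightarrow> (C q * 0\<^sup>2 + \<bar>0\<bar> * B (k # q)) * nn (U y (k # r)) + C q * nn (U y r) * \<bar>0\<bar>) (at 0)"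
      unfolding R_def by (intro tendsto_intros)
    moreover have "((\<lambda>h. if q = [] then 0 else B q * nn (D h r)) \<longlongrightarrow> 0) (at 0)"
    proof (cases "q = []")
      case False
      have "((\<lambda>h. nn (D h r)) \<longlongrightarrow> 0) (at 0)"
        unfolding D_def yh_def by (rule less.hyps) (use qr False less.prems in \<open>cases q; auto\<close>)+
      then have "((\<lambda>h. B q * nn (D h r)) \<longlongrightarrow> 0) (at 0)" by (rule tendsto_mult_right_zero)
      then show ?thesis using False by simp
    qed simp
    ultimately have "((\<lambda>h. (if q = [] then 0 else B q * nn (D h r)) + R h q r) \<longlongrightarrow>
        0 + ((C q * 0\<^sup>2 + \<bar>0\<bar> * B (k # q)) * nn (U y (k # r)) + C q * nn (U y r) * \<bar>0\<bar>)) (at 0)"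
      by (intro tendsto_add)
    then show "((\<lambda>h. (if q = [] then 0 else B q * nn (D h r)) + R h q r) \<longlongrightarrow> 0) (at 0)" by simp
  qed
  then have "((\<lambda>h. \<bar>E h\<bar> / \<theta>) \<longlongrightarrow> \<bar>0\<bar> / \<theta>) (at 0)"
    using constants by (intro tendsto_intros) auto
  then have E0: "((\<lambda>h. \<bar>E h\<bar> / \<theta>) \<longlongrightarrow> 0) (at 0)" by simp
  have bound: "nn (D h p) \<le> \<bar>E h\<bar> / \<theta>" if h: "h \<noteq> 0" "\<bar>h\<bar> < \<delta>" "yh h \<in> Q" for h
  proof (rule coercive_imp_bound[OF h(3) DS[OF h(3) less.prems]])
    let ?v = "D h p"
    have v: "?v \<in> S" by (rule DS[OF h(3) less.prems])
    define e2 where "e2 q r = (a (yh h) q (U y (k # r)) ?v - a y q (U y (k # r)) ?v)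
       + ((a (yh h) q (U y r) ?v - a y q (U y r) ?v) / h - a y (k # q) (U y r) ?v)" for q r
    have e2: "\<bar>e2 q r\<bar> \<le> R h q r * nn ?v" if "set q \<subseteq> set p" "set r \<subseteq> set p" for q r
    proof -
      have I: "set q \<subseteq> I" "set r \<subseteq> I" "set (k # q) \<subseteq> I" "set (k # r) \<subseteq> I" using that less.prems k by auto
      have 1: "\<bar>a (yh h) q (U y (k # r)) ?v - a y q (U y (k # r)) ?v - h * a y (k # q) (U y (k # r)) ?v\<bar>
         \<le> C q * (nn (U y (k # r)) * nn ?v) * h\<^sup>2"
        by (rule C) (use I h v U_in[OF y] in auto)
      have "\<bar>a y (k # q) (U y (k # r)) ?v\<bar> \<le> B (k # q) * (nn (U y (k # r)) * nn ?v)"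
        unfolding B_def by (rule a_bound) (use y v I U_in[OF y] in auto)
      from mult_left_mono[OF this, of "\<bar>h\<bar>"]
      have "\<bar>h * a y (k # q) (U y (k # r)) ?v\<bar> \<le> \<bar>h\<bar> * (B (k # q) * (nn (U y (k # r)) * nn ?v))"
        by (simp add: abs_mult)
      with 1
      have 2: "\<bar>a (yh h) q (U y (k # r)) ?v - a y q (U y (k # r)) ?v\<bar>
        \<le> C q * (nn (U y (k # r)) * nn ?v) * h\<^sup>2 + \<bar>h\<bar> * (B (k # q) * (nn (U y (k # r)) * nn ?v))"
        by linarith
      have 3: "\<bar>a (yh h) q (U y r) ?v - a y q (U y r) ?v - h * a y (k # q) (U y r) ?v\<bar>
         \<le> C q * (nn (U y r) * nn ?v) * h\<^sup>2"
        by (rule C) (use I h v U_in[OF y] in auto)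
      have "\<bar>(a (yh h) q (U y r) ?v - a y q (U y r) ?v) / h - a y (k # q) (U y r) ?v\<bar>
        = \<bar>a (yh h) q (U y r) ?v - a y q (U y r) ?v - h * a y (k # q) (U y r) ?v\<bar> / \<bar>h\<bar>"
        unfolding abs_divide[symmetric] using h(1) by (simp add: diff_divide_distrib)
      also have "\<dots> \<le> C q * (nn (U y r) * nn ?v) * h\<^sup>2 / \<bar>h\<bar>"
        using 3 by (rule divide_right_mono) simp
      also have "\<dots> = C q * (nn (U y r) * nn ?v) * \<bar>h\<bar>"
        using h(1) by (simp add: power2_eq_square field_simps)
      finally show ?thesis using 2 unfolding e2_def R_def by (simp add: algebra_simps)
    qed
    let ?m = "\<lambda>q r. a (yh h) q (D h r) ?v + e2 q r"
    have "leibniz ?m p = leibniz (\<lambda>q r. (1 / h) * a (yh h) q (U (yh h) r) ?v + ((- 1 / h) * a y q (U y r) ?v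
        + (-1) * (a (y) (k # q) (U y r) ?v + a y q (U y (k # r)) ?v))) p"
    proof (rule leibniz_cong)
      fix q r assume "set q \<subseteq> set p" "set r \<subseteq> set p"
      then have I: "set q \<subseteq> I" "set r \<subseteq> I" "set (k # r) \<subseteq> I" using less.prems k by auto
      have "a (yh h) q (D h r) ?v = 1 / h * a (yh h) q (U (yh h) r) ?v - 1 / h * a (yh h) q (U y r) ?v - a (yh h) q (U y (k # r)) ?v"
        unfolding D_eq[of h r] using I h(3) y v by (simp add: a_left U_in lincomb_S)
      then show "?m q r = (1 / h) * a (yh h) q (U (yh h) r) ?v + ((- 1 / h) * a y q (U y r) ?v
        + (-1) * (a (y) (k # q) (U y r) ?v + a y q (U y (k # r)) ?v))"
        by (simp add: e2_def diff_divide_distrib)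
    qed
    also have "\<dots> = 1 / h * leibniz (\<lambda>q r. a (yh h) q (U (yh h) r) ?v) p - 1 / h * leibniz (\<lambda>q r. a y q (U y r) ?v) p
        - leibniz (\<lambda>q r. a y q (U y r) ?v) (k # p)"
      unfolding leibniz_add leibniz_cmult by simp
    \<comment> \<open>The loads at the two parameters cancel, also for empty \<open>p\<close>, and
      the equation for the nonempty list \<open>k # p\<close> has right-hand side zero.\<close>
    also have "\<dots> = 0"
      using U_leibniz[OF h(3) less.prems v] U_leibniz[OF y less.prems v] U_leibniz[OF y _ v, of "k # p"] k less.prems by simp
    finally have "leibniz ?m p = 0" .
    moreover have "leibniz ?m p = a (yh h) [] ?v ?v + leibniz (\<lambda>q r. (if q = [] then 0 else a (yh h) q (D h r) ?v) + e2 q r) p"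
      unfolding leibniz_add by (subst leibniz_split_head) simp
    ultimately have "\<bar>a (yh h) [] ?v ?v\<bar> = \<bar>leibniz (\<lambda>q r. (if q = [] then 0 else a (yh h) q (D h r) ?v) + e2 q r) p\<bar>"
      by simp
    also have "\<dots> \<le> leibniz (\<lambda>q r. \<bar>(if q = [] then 0 else a (yh h) q (D h r) ?v) + e2 q r\<bar>) p"
      by (rule leibniz_abs)
    also have "\<dots> \<le> leibniz (\<lambda>q r. nn ?v * ((if q = [] then 0 else B q * nn (D h r)) + R h q r)) p"
    proof (rule leibniz_mono)
      fix q r assume qr: "set q \<subseteq> set p" "set r \<subseteq> set p"
      have "\<bar>if q = [] then 0 else a (yh h) q (D h r) ?v\<bar> \<le> nn ?v * (if q = [] then 0 else B q * nn (D h r))"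
        using a_bound[OF h(3), of q "D h r" ?v] qr less.prems DS[OF h(3)] v by (auto simp: B_def mult_ac)
      with e2[OF qr] show "\<bar>(if q = [] then 0 else a (yh h) q (D h r) ?v) + e2 q r\<bar>
         \<le> nn ?v * ((if q = [] then 0 else B q * nn (D h r)) + R h q r)"
        unfolding distrib_left
        by (intro order_trans[OF abs_triangle_ineq] add_mono) (simp_all only: mult.commute)
    qed
    also have "\<dots> = E h * nn ?v" unfolding leibniz_cmult E_def by simp
    also have "\<dots> \<le> \<bar>E h\<bar> * nn ?v" by (rule mult_right_mono) (use nn_nonneg[OF v] in auto)
    finally show "\<bar>a (yh h) [] ?v ?v\<bar> \<le> \<bar>E h\<bar> * nn ?v" .
  qed simp
  have ev: "\<forall>\<^sub>F h in at 0. h \<noteq> 0 \<and> \<bar>h\<bar> < \<delta> \<and> yh h \<in> Q"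
  proof -
    have "\<forall>\<^sub>F h in at 0. h \<noteq> 0 \<and> \<bar>h\<bar> < \<delta>"
      using \<delta> unfolding eventually_at by (intro exI[of _ \<delta>]) auto
    moreover have "\<forall>\<^sub>F h in at 0. yh h \<in> Q"
      using Q_open[OF y k] unfolding eventually_nhds_conv_at yh_def by simp
    ultimately show ?thesis by eventually_elim auto
  qed
  show ?case
    unfolding yh_def[symmetric] D_def[symmetric]
  proof (rule Lim_null_comparison[OF _ E0])
    show "\<forall>\<^sub>F h in at 0. norm (nn (D h p)) \<le> \<bar>E h\<bar> / \<theta>"
      using ev by eventually_elim (use bound nn_nonneg[OF DS] less.prems in auto)
  qed
qed

text \<open>The inner derivatives exist on a whole neighbourhood because \<open>Q\<close> is open
  along coordinate lines. Convergence in \<open>nn\<close> passes to any norm that it dominates,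
  later the full norm of the Sobolev space.\<close>

lemma U_iter_partial:
  assumes nrm: "\<And>v. v \<in> S \<Longrightarrow> 0 \<le> nrm v" "\<And>v. v \<in> S \<Longrightarrow> nrm v \<le> c * nn v"
    and y: "y \<in> Q" and p: "set p \<subseteq> I"
  shows "has_iter_partial S nrm p u y (U y p)"
  using y p
proof (induction p arbitrary: y)
  case Nil
  then show ?case using U u_solves by (simp add: derivative_family_def)
next
  case (Cons k p)
  let ?D = "\<lambda>h x. (U (y(k := y k + h)) p x - U y p x) / h - U y (k # p) x"
  have IH: "\<forall>\<^sub>F h in nhds 0. has_iter_partial S nrm p u (y(k := y k + h)) (U (y(k := y k + h)) p)"
    using Q_open[OF Cons.prems(1), of k] Cons.prems by (auto elim!: eventually_mono intro: Cons.IH)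
  have lim: "((\<lambda>h. nrm (?D h)) \<longlongrightarrow> 0) (at 0)"
  proof (rule Lim_null_comparison)
    have "((\<lambda>h. nn (?D h)) \<longlongrightarrow> 0) (at 0)" using Cons.prems by (intro U_derivative) auto
    then show "((\<lambda>h. c * nn (?D h)) \<longlongrightarrow> 0) (at 0)" by (rule tendsto_mult_right_zero)
    have "\<forall>\<^sub>F h in at 0. y(k := y k + h) \<in> Q"
      using Q_open[OF Cons.prems(1), of k] Cons.prems unfolding eventually_nhds_conv_at by simp
    then show "\<forall>\<^sub>F h in at 0. norm (nrm (?D h)) \<le> c * nn (?D h)"
    proof eventually_elim
      case (elim h)
      have "?D h = lincomb 1 (lincomb (1 / h) (U (y(k := y k + h)) p) (- 1 / h) (U y p)) (-1) (U y (k # p))"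
        by (auto simp: lincomb_def fun_eq_iff diff_divide_distrib)
      also have "\<dots> \<in> S" using elim Cons.prems by (intro lincomb_S U_in) auto
      finally show ?case using nrm[of "?D h"] by auto
    qed
  qed
  show ?case
    unfolding has_iter_partial.simps
    by (intro conjI exI[of _ "\<lambda>h. U (y(k := y k + h)) p"]) (use IH lim U_in Cons.prems in auto)
qed

end

end

section \<open>The space \<open>L\<^sup>2\<close>\<close>

lemma L2_measurable: "f \<in> L2 N \<Longrightarrow> f \<in> borel_measurable N"
  by (simp add: L2_def)

lemma L2_integrable: "f \<in> L2 N \<Longrightarrow> integrable N (\<lambda>x. (norm (f x))\<^sup>2)"
  by (simp add: L2_def)

lemma L2_norm_nonneg [simp]: "0 \<le> L2_norm N f"
  by (simp add: L2_norm_def)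

lemma L2_norm_square: "(L2_norm N f)\<^sup>2 = (\<integral>x. (norm (f x))\<^sup>2 \<partial>N)"
  by (simp add: L2_norm_def)


lemma L2_integrable_mult:
  assumes "f \<in> L2 N" "g \<in> L2 N"
  shows "integrable N (\<lambda>x. norm (f x) * norm (g x))"
proof (rule Bochner_Integration.integrable_bound)
  show "integrable N (\<lambda>x. (norm (f x))\<^sup>2 + (norm (g x))\<^sup>2)"
    using assms by (intro Bochner_Integration.integrable_add L2_integrable)
  show "(\<lambda>x. norm (f x) * norm (g x)) \<in> borel_measurable N"
    using assms[THEN L2_measurable] by measurable
  have le: "norm (f x) * norm (g x) \<le> (norm (f x))\<^sup>2 + (norm (g x))\<^sup>2" for x
    using sum_squares_bound[of "norm (f x)" "norm (g x)"] mult_nonneg_nonneg[OF norm_ge_zero[of "f x"] norm_ge_zero[of "g x"]]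
    unfolding mult.assoc by linarith
  show "AE x in N. norm (norm (f x) * norm (g x)) \<le> norm ((norm (f x))\<^sup>2 + (norm (g x))\<^sup>2)"
  proof (rule AE_I2)
    fix x
    have "norm (norm (f x) * norm (g x)) = norm (f x) * norm (g x)" by (simp add: norm_mult)
    also note le[of x]
    also have "(norm (f x))\<^sup>2 + (norm (g x))\<^sup>2 = norm ((norm (f x))\<^sup>2 + (norm (g x))\<^sup>2)" by simp
    finally show "norm (norm (f x) * norm (g x)) \<le> norm ((norm (f x))\<^sup>2 + (norm (g x))\<^sup>2)" .
  qed
qed


lemma L2_Cauchy_Schwarz:
  assumes "f \<in> L2 N" "g \<in> L2 N"
  shows "(\<integral>x. norm (f x) * norm (g x) \<partial>N) \<le> L2_norm N f * L2_norm N g"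
proof -
  have "(\<integral>x. norm (f x) * norm (g x) \<partial>N)\<^sup>2 \<le> (\<integral>x. (norm (f x))\<^sup>2 \<partial>N) * (\<integral>x. (norm (g x))\<^sup>2 \<partial>N)"
  proof (rule nonneg_quadratic_discriminant)
    fix t :: real
    have "0 \<le> (\<integral>x. (t * norm (f x) + norm (g x))\<^sup>2 \<partial>N)" by simp
    also have "\<dots> = (\<integral>x. t\<^sup>2 * (norm (f x))\<^sup>2 + 2 * t * (norm (f x) * norm (g x)) + (norm (g x))\<^sup>2 \<partial>N)"
      by (rule Bochner_Integration.integral_cong) (auto simp: power2_eq_square algebra_simps)
    also have "\<dots> = t\<^sup>2 * (\<integral>x. (norm (f x))\<^sup>2 \<partial>N) + 2 * t * (\<integral>x. norm (f x) * norm (g x) \<partial>N) + (\<integral>x. (norm (g x))\<^sup>2 \<partial>N)"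
      using assms[THEN L2_integrable] L2_integrable_mult[OF assms] by simp
    finally show "0 \<le> (\<integral>x. (norm (f x))\<^sup>2 \<partial>N) * t\<^sup>2 + 2 * (\<integral>x. norm (f x) * norm (g x) \<partial>N) * t + (\<integral>x. (norm (g x))\<^sup>2 \<partial>N)"
      by (simp add: algebra_simps)
  qed
  then show ?thesis
    unfolding L2_norm_def real_sqrt_mult[symmetric] by (rule real_le_rsqrt)
qed

lemma norm_lincomb_square_le:
  fixes u v :: "'a::real_normed_vector"
  shows "(norm (b *\<^sub>R u + c *\<^sub>R v))\<^sup>2
    \<le> b\<^sup>2 * (norm u)\<^sup>2 + 2 * (\<bar>b\<bar> * \<bar>c\<bar>) * (norm u * norm v) + c\<^sup>2 * (norm v)\<^sup>2"
proof -
  have "(norm (b *\<^sub>R u + c *\<^sub>R v))\<^sup>2 \<le> (\<bar>b\<bar> * norm u + \<bar>c\<bar> * norm v)\<^sup>2"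
    by (intro power_mono norm_triangle_le) auto
  then show ?thesis by (simp add: power2_sum power_mult_distrib mult_ac add_ac)
qed

lemma L2_lincomb:
  assumes "f \<in> L2 N" "g \<in> L2 N"
  shows "(\<lambda>x. b *\<^sub>R f x + c *\<^sub>R g x) \<in> L2 N"
proof -
  let ?h = "\<lambda>x. b\<^sup>2 * (norm (f x))\<^sup>2 + 2 * (\<bar>b\<bar> * \<bar>c\<bar>) * (norm (f x) * norm (g x)) + c\<^sup>2 * (norm (g x))\<^sup>2"
  have "integrable N (\<lambda>x. (norm (b *\<^sub>R f x + c *\<^sub>R g x))\<^sup>2)"
  proof (rule Bochner_Integration.integrable_bound)
    show "integrable N ?h"
      using assms by (intro Bochner_Integration.integrable_add integrable_mult_right L2_integrable L2_integrable_mult)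
    show "(\<lambda>x. (norm (b *\<^sub>R f x + c *\<^sub>R g x))\<^sup>2) \<in> borel_measurable N"
      using assms[THEN L2_measurable] by measurable
    show "AE x in N. norm ((norm (b *\<^sub>R f x + c *\<^sub>R g x))\<^sup>2) \<le> norm (?h x)"
      by (simp add: norm_lincomb_square_le)
  qed
  moreover have "(\<lambda>x. b *\<^sub>R f x + c *\<^sub>R g x) \<in> borel_measurable N"
    using assms[THEN L2_measurable] by measurable
  ultimately show ?thesis by (simp add: L2_def)
qed

lemma L2_norm_triangle:
  assumes "f \<in> L2 N" "g \<in> L2 N"
  shows "L2_norm N (\<lambda>x. b *\<^sub>R f x + c *\<^sub>R g x) \<le> \<bar>b\<bar> * L2_norm N f + \<bar>c\<bar> * L2_norm N g"
proof -
  let ?h = "\<lambda>x. b\<^sup>2 * (norm (f x))\<^sup>2 + 2 * (\<bar>b\<bar> * \<bar>c\<bar>) * (norm (f x) * norm (g x)) + c\<^sup>2 * (norm (g x))\<^sup>2"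
  have "(L2_norm N (\<lambda>x. b *\<^sub>R f x + c *\<^sub>R g x))\<^sup>2 \<le> (\<integral>x. ?h x \<partial>N)"
    unfolding L2_norm_square
  proof (rule integral_mono)
    show "integrable N (\<lambda>x. (norm (b *\<^sub>R f x + c *\<^sub>R g x))\<^sup>2)"
      using assms by (intro L2_integrable L2_lincomb)
    show "integrable N ?h"
      using assms by (intro Bochner_Integration.integrable_add integrable_mult_right L2_integrable L2_integrable_mult)
  qed (rule norm_lincomb_square_le)
  also have "\<dots> = b\<^sup>2 * (L2_norm N f)\<^sup>2 + 2 * (\<bar>b\<bar> * \<bar>c\<bar>) * (\<integral>x. norm (f x) * norm (g x) \<partial>N) + c\<^sup>2 * (L2_norm N g)\<^sup>2"
    using assms[THEN L2_integrable] L2_integrable_mult[OF assms] by (simp add: L2_norm_square)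
  also have "\<dots> \<le> b\<^sup>2 * (L2_norm N f)\<^sup>2 + 2 * (\<bar>b\<bar> * \<bar>c\<bar>) * (L2_norm N f * L2_norm N g) + c\<^sup>2 * (L2_norm N g)\<^sup>2"
    by (intro add_mono mult_left_mono L2_Cauchy_Schwarz assms) auto
  also have "\<dots> = (\<bar>b\<bar> * L2_norm N f + \<bar>c\<bar> * L2_norm N g)\<^sup>2"
    by (simp add: power2_sum power_mult_distrib mult_ac)
  finally show ?thesis by (rule power2_le_imp_le) auto
qed

lemma L2_norm_cong_AE:
  assumes "f \<in> borel_measurable N" "g \<in> borel_measurable N" "AE x in N. f x = g x"
  shows "L2_norm N f = L2_norm N g"
proof -
  have "(\<integral>x. (norm (f x))\<^sup>2 \<partial>N) = (\<integral>x. (norm (g x))\<^sup>2 \<partial>N)"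
    by (rule integral_cong_AE) (use assms in auto)
  then show ?thesis by (simp add: L2_norm_def)
qed

lemma L2_nn_integral: "f \<in> L2 N \<Longrightarrow> (\<integral>\<^sup>+x. ennreal ((norm (f x))\<^sup>2) \<partial>N) = ennreal ((L2_norm N f)\<^sup>2)"
  unfolding L2_norm_square by (rule nn_integral_eq_integral) (auto dest: L2_integrable)

text \<open>Fatou's lemma for the squared norms: balls are closed under convergence almost
  everywhere.\<close>

lemma L2_Fatou:
  assumes f: "\<And>n. f n \<in> L2 N" "\<And>n. L2_norm N (f n) \<le> e" and g: "g \<in> borel_measurable N"
    and lim: "AE x in N. (\<lambda>n. f n x) \<longlonglongrightarrow> g x"
  shows "g \<in> L2 N \<and> L2_norm N g \<le> e"
proof -
  have e: "0 \<le> e" using f(2)[of 0] L2_norm_nonneg[of N "f 0"] by linarith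
  have [measurable]: "f n \<in> borel_measurable N" for n using f(1) by (rule L2_measurable)
  have "(\<integral>\<^sup>+x. ennreal ((norm (g x))\<^sup>2) \<partial>N) = (\<integral>\<^sup>+x. liminf (\<lambda>n. ennreal ((norm (f n x))\<^sup>2)) \<partial>N)"
  proof (rule nn_integral_cong_AE)
    show "AE x in N. ennreal ((norm (g x))\<^sup>2) = liminf (\<lambda>n. ennreal ((norm (f n x))\<^sup>2))"
      using lim
    proof eventually_elim
      case (elim x)
      then have "(\<lambda>n. ennreal ((norm (f n x))\<^sup>2)) \<longlonglongrightarrow> ennreal ((norm (g x))\<^sup>2)"
        by (intro tendsto_ennrealI tendsto_intros)
      then show ?case by (rule lim_imp_Liminf[OF sequentially_bot, symmetric])
    qed
  qed
  also have "\<dots> \<le> liminf (\<lambda>n. \<integral>\<^sup>+x. ennreal ((norm (f n x))\<^sup>2) \<partial>N)"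
    by (rule nn_integral_liminf) measurable
  also have "\<dots> \<le> liminf (\<lambda>n. ennreal (e\<^sup>2))"
    using f by (intro Liminf_mono always_eventually allI) (auto simp: L2_nn_integral intro!: ennreal_leI power_mono)
  also have "\<dots> = ennreal (e\<^sup>2)" by (simp add: Liminf_const)
  finally have le: "(\<integral>\<^sup>+x. ennreal ((norm (g x))\<^sup>2) \<partial>N) \<le> ennreal (e\<^sup>2)" .
  have "integrable N (\<lambda>x. (norm (g x))\<^sup>2)"
    by (rule integrableI_bounded) (use g le_less_trans[OF le ennreal_less_top] in auto)
  with g have L: "g \<in> L2 N" by (simp add: L2_def)
  with le have "(L2_norm N g)\<^sup>2 \<le> e\<^sup>2" by (simp add: L2_nn_integral)
  from power2_le_imp_le[OF this e] L show ?thesis by (rule conjI[rotated])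
qed


lemma L2_diff: "f \<in> L2 N \<Longrightarrow> g \<in> L2 N \<Longrightarrow> (\<lambda>x. f x - g x) \<in> L2 N"
  using L2_lincomb[of f N g 1 "-1"] by simp

section \<open>Completeness over a finite measure\<close>

lemma (in finite_measure) L2_const: "(\<lambda>_. c) \<in> L2 M"
  by (simp add: L2_def)

lemma (in finite_measure) L2_integrable_norm:
  assumes "f \<in> L2 M"
  shows "integrable M f" and "(\<integral>x. norm (f x) \<partial>M) \<le> sqrt (measure M (space M)) * L2_norm M f"
proof -
  have "integrable M (\<lambda>x. norm (1::real) * norm (f x))"
    by (rule L2_integrable_mult[OF L2_const assms])
  then show "integrable M f"
    using L2_measurable[OF assms] by (simp add: integrable_norm_iff)
  show "(\<integral>x. norm (f x) \<partial>M) \<le> sqrt (measure M (space M)) * L2_norm M f"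
    using L2_Cauchy_Schwarz[OF L2_const[of "1::real"] assms] by (simp add: L2_norm_def)
qed

text \<open>Riesz-Fischer: along a subsequence the increments are at most powers of 1/2. Finiteness
  of the measure bounds their integrals by their \<open>L2_norm\<close>, so the series of increments
  converges absolutely almost everywhere.\<close>

lemma (in finite_measure) L2_complete:
  assumes X: "\<And>n. X n \<in> L2 M"
    and Cauchy: "\<And>e. e > 0 \<Longrightarrow> \<exists>k. \<forall>m\<ge>k. \<forall>n\<ge>k. L2_norm M (\<lambda>x. X m x - X n x) < e"
  shows "\<exists>l\<in>L2 M. (\<lambda>n. L2_norm M (\<lambda>x. X n x - l x)) \<longlonglongrightarrow> 0"
proof -
  have "\<exists>k. \<forall>m\<ge>k. \<forall>n\<ge>k. L2_norm M (\<lambda>x. X m x - X n x) < (1/2) ^ i" for i :: nat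
    by (rule Cauchy) simp
  then obtain K where K: "\<And>i m n. m \<ge> K i \<Longrightarrow> n \<ge> K i \<Longrightarrow> L2_norm M (\<lambda>x. X m x - X n x) < (1/2) ^ i"
    by metis
  \<comment> \<open>Partial sums make the selected indices monotone while keeping them at least
    \<open>K k\<close>.\<close>
  define s where "s k = (\<Sum>i\<le>k. K i)" for k
  have sK: "s k \<ge> K k" for k unfolding s_def by (cases k) auto
  have s_mono: "s j \<le> s k" if "j \<le> k" for j k unfolding s_def by (rule sum_mono2) (use that in auto)
  have [measurable]: "X n \<in> borel_measurable M" for n using X by (rule L2_measurable)
  define d where "d k x = X (s (Suc k)) x - X (s k) x" for k x
  have d: "d k \<in> L2 M" for k unfolding d_def by (intro L2_diff X)
  have d_small: "L2_norm M (d k) \<le> (1/2) ^ k" for k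
    unfolding d_def using K[of k "s (Suc k)" "s k"] sK[of k] s_mono[of k "Suc k"] by simp
  define C where "C = sqrt (measure M (space M))"
  have C: "C \<ge> 0" by (simp add: C_def)
  have "(\<integral>\<^sup>+x. (\<Sum>k. ennreal (norm (d k x))) \<partial>M) = (\<Sum>k. \<integral>\<^sup>+x. ennreal (norm (d k x)) \<partial>M)"
    by (rule nn_integral_suminf) (use L2_measurable[OF d] in measurable)
  also have "\<dots> \<le> (\<Sum>k. ennreal (C * (1/2) ^ k))"
  proof (rule suminf_le)
    fix k
    have "(\<integral>\<^sup>+x. ennreal (norm (d k x)) \<partial>M) = ennreal (\<integral>x. norm (d k x) \<partial>M)"
      by (rule nn_integral_eq_integral) (use L2_integrable_norm(1)[OF d] in auto)
    also have "(\<integral>x. norm (d k x) \<partial>M) \<le> C * L2_norm M (d k)"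
      unfolding C_def by (rule L2_integrable_norm[OF d])
    also have "\<dots> \<le> C * (1/2) ^ k" by (rule mult_left_mono[OF d_small C])
    finally show "(\<integral>\<^sup>+x. ennreal (norm (d k x)) \<partial>M) \<le> ennreal (C * (1/2) ^ k)" by (simp add: ennreal_leI)
  qed auto
  also have "\<dots> < top"
    by (subst less_top[symmetric], rule ennreal_suminf_neq_top) (use C in \<open>auto intro!: summable_mult summable_geometric\<close>)
  finally have "AE x in M. (\<Sum>k. ennreal (norm (d k x))) \<noteq> \<infinity>"
    by (intro nn_integral_PInf_AE) (use L2_measurable[OF d] in auto)
  then have conv: "AE x in M. convergent (\<lambda>n. X (s n) x)"
  proof eventually_elim
    case (elim x)
    then have "summable (\<lambda>k. norm (d k x))"
      by (intro summable_suminf_not_top) (auto simp: infinity_ennreal_def)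
    then have "summable (\<lambda>k. d k x)" by (rule summable_norm_cancel)
    then have "(\<lambda>n. \<Sum>k<n. d k x) \<longlonglongrightarrow> (\<Sum>k. d k x)" by (rule summable_LIMSEQ)
    moreover have "(\<Sum>k<n. d k x) = X (s n) x - X (s 0) x" for n
      unfolding d_def by (rule sum_lessThan_telescope)
    ultimately have "(\<lambda>n. (X (s n) x - X (s 0) x) + X (s 0) x) \<longlonglongrightarrow> (\<Sum>k. d k x) + X (s 0) x"
      by (intro tendsto_add tendsto_const) simp
    then show ?case by (auto simp: convergent_def)
  qed
  define l where "l x = lim (\<lambda>n. X (s n) x)" for x
  have l[measurable]: "l \<in> borel_measurable M" unfolding l_def by measurable
  \<comment> \<open>The index \<open>j\<close> ranges over the full sequence and only the other one
    follows the subsequence, so the full sequence converges; \<open>j = s 0\<close> also gives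
    membership of \<open>l\<close>.\<close>
  have key: "(\<lambda>x. X j x - l x) \<in> L2 M \<and> L2_norm M (\<lambda>x. X j x - l x) \<le> (1/2) ^ k" if "j \<ge> s k" for j k
  proof (rule L2_Fatou[where f = "\<lambda>n x. X j x - X (s (n + k)) x"])
    show "L2_norm M (\<lambda>x. X j x - X (s (n + k)) x) \<le> (1/2) ^ k" for n
      using K[of k j "s (n + k)"] that sK[of k] s_mono[of k "n + k"] by simp
    show "AE x in M. (\<lambda>n. X j x - X (s (n + k)) x) \<longlonglongrightarrow> X j x - l x"
      using conv
    proof eventually_elim
      case (elim x)
      then have "(\<lambda>n. X (s n) x) \<longlonglongrightarrow> l x" unfolding l_def by (simp add: convergent_LIMSEQ_iff)
      then show ?case by (intro tendsto_diff tendsto_const LIMSEQ_ignore_initial_segment)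
    qed
  qed (auto intro: L2_diff X)
  have "(\<lambda>x. X (s 0) x - l x) \<in> L2 M" using key[of 0 "s 0"] by simp
  from L2_diff[OF X[of "s 0"] this] have "l \<in> L2 M" by simp
  moreover have "(\<lambda>n. L2_norm M (\<lambda>x. X n x - l x)) \<longlonglongrightarrow> 0"
  proof (rule LIMSEQ_I)
    fix e :: real assume "e > 0"
    then obtain k where "(1/2) ^ k < e" using real_arch_pow_inv[of e "1/2"] by auto
    then show "\<exists>no. \<forall>n\<ge>no. norm (L2_norm M (\<lambda>x. X n x - l x) - 0) < e"
      using key[of k] by (intro exI[of _ "s k"]) (auto intro: le_less_trans)
  qed
  ultimately show ?thesis by blast
qed

section \<open>Uniqueness of weak gradients\<close>

text \<open>Squaring makes the positive part continuously differentiable, exactly the smoothness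
  asked of test functions.\<close>

lemma DERIV_square_positive_part:
  "((\<lambda>t::real. (max 0 t)\<^sup>2) has_real_derivative 2 * max 0 t) (at t)"
proof -
  consider "t > 0" | "t < 0" | "t = 0" by linarith
  then show ?thesis
  proof cases
    case 1
    have "((\<lambda>t::real. t\<^sup>2) has_real_derivative 2 * max 0 t) (at t)"
      using 1 by (auto intro!: derivative_eq_intros)
    then show ?thesis
      by (rule has_field_derivative_transform_within_open[of _ _ _ "{0<..}"]) (use 1 in auto)
  next
    case 2
    have "((\<lambda>t::real. 0) has_real_derivative 2 * max 0 t) (at t)"
      using 2 by (auto intro!: derivative_eq_intros)
    then show ?thesis
      by (rule has_field_derivative_transform_within_open[of _ _ _ "{..<0}"]) (use 2 in auto)
  next
    case 3
    have "((\<lambda>h::real. (max 0 h)\<^sup>2 / h) \<longlongrightarrow> 0) (at 0)"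
    proof (rule Lim_null_comparison)
      show "((\<lambda>h::real. \<bar>h\<bar>) \<longlongrightarrow> 0) (at 0)" by (rule tendsto_rabs_zero) (rule tendsto_ident_at)
      show "\<forall>\<^sub>F h::real in at 0. norm ((max 0 h)\<^sup>2 / h) \<le> \<bar>h\<bar>"
        by (auto simp: max_def power2_eq_square intro!: always_eventually)
    qed
    then show ?thesis using 3 by (simp add: DERIV_def)
  qed
qed

text \<open>Products of such functions are again such functions, and \<open>1 - \<zeta>\<close> is a test function.\<close>

definition cutoff :: "(real^'d) set \<Rightarrow> (real^'d \<Rightarrow> real) \<Rightarrow> bool" where
  "cutoff D \<zeta> \<longleftrightarrow> (\<exists>d\<zeta>. (\<forall>x. GDERIV \<zeta> x :> d\<zeta> x) \<and> continuous_on UNIV d\<zeta>) \<and>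
     (\<exists>K. compact K \<and> K \<subseteq> D \<and> (\<forall>x. x \<notin> K \<longrightarrow> \<zeta> x = 1))"

lemma cutoff_one: "cutoff D (\<lambda>_. 1)"
  unfolding cutoff_def by (auto intro!: exI[of _ "\<lambda>_. 0"] exI[of _ "{}"] GDERIV_const)

lemma GDERIV_continuous_on: "(\<And>x. GDERIV f x :> df x) \<Longrightarrow> continuous_on S f"
  unfolding gderiv_def
  by (meson continuous_at_imp_continuous_on has_derivative_continuous)

lemma cutoff_mult:
  assumes "cutoff D \<zeta>" "cutoff D \<zeta>'"
  shows "cutoff D (\<lambda>x. \<zeta> x * \<zeta>' x)"
proof -
  from assms obtain d K d' K' where
    1: "\<And>x. GDERIV \<zeta> x :> d x" "continuous_on UNIV d" "compact K" "K \<subseteq> D" "\<And>x. x \<notin> K \<Longrightarrow> \<zeta> x = 1" and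
    2: "\<And>x. GDERIV \<zeta>' x :> d' x" "continuous_on UNIV d'" "compact K'" "K' \<subseteq> D" "\<And>x. x \<notin> K' \<Longrightarrow> \<zeta>' x = 1"
    unfolding cutoff_def by blast
  have "continuous_on UNIV \<zeta>" "continuous_on UNIV \<zeta>'"
    using 1(1) 2(1) by (auto intro: GDERIV_continuous_on)
  then have "continuous_on UNIV (\<lambda>x. \<zeta> x *\<^sub>R d' x + \<zeta>' x *\<^sub>R d x)"
    by (intro continuous_intros 1 2)
  then show ?thesis
    unfolding cutoff_def using 1 2
    by (intro conjI exI[of _ "\<lambda>x. \<zeta> x *\<^sub>R d' x + \<zeta>' x *\<^sub>R d x"] exI[of _ "K \<union> K'"]) (auto intro: GDERIV_mult)
qed

lemma cutoff_power: "cutoff D \<zeta> \<Longrightarrow> cutoff D (\<lambda>x. \<zeta> x ^ n)"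
  by (induction n) (auto intro: cutoff_one cutoff_mult)

lemma cutoff_prod: "(\<And>j. j < (n::nat) \<Longrightarrow> cutoff D (\<zeta> j)) \<Longrightarrow> cutoff D (\<lambda>x. \<Prod>j<n. \<zeta> j x)"
  by (induction n) (auto intro: cutoff_one cutoff_mult simp: lessThan_Suc)

lemma cutoff_test_function:
  assumes "cutoff D \<zeta>"
  shows "\<exists>d\<phi>. test_function D (\<lambda>x. 1 - \<zeta> x) d\<phi>"
proof -
  from assms obtain d K where
    1: "\<And>x. GDERIV \<zeta> x :> d x" "continuous_on UNIV d" "compact K" "K \<subseteq> D" "\<And>x. x \<notin> K \<Longrightarrow> \<zeta> x = 1"
    unfolding cutoff_def by blast
  have "{x. 1 - \<zeta> x \<noteq> 0} \<subseteq> K" using 1(5) by auto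
  then have K: "closure {x. 1 - \<zeta> x \<noteq> 0} \<subseteq> K"
    using 1(3) by (simp add: closure_minimal compact_imp_closed)
  then have "compact (closure {x. 1 - \<zeta> x \<noteq> 0})"
    using 1(3) by (metis closed_closure compact_Int_closed inf.absorb_iff2)
  moreover have "GDERIV (\<lambda>x. 1 - \<zeta> x) x :> 0 - d x" for x
    by (intro GDERIV_diff GDERIV_const 1)
  moreover have "continuous_on UNIV (\<lambda>x. 0 - d x)" by (intro continuous_intros 1)
  ultimately show ?thesis unfolding test_function_def using K 1(4)
    by (intro exI[of _ "\<lambda>x. 0 - d x"]) auto
qed

text \<open>The function \<open>q\<close> is positive precisely on the open ball and at most the
  square of \<open>r\<close>, so the factor \<open>1 / r ^ 4\<close> keeps the values of the cutoff
  in the unit interval.\<close>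

lemma cutoff_ball_exists:
  fixes c :: "real^'d"
  assumes "r > 0" "cball c r \<subseteq> D"
  shows "\<exists>\<zeta>. cutoff D \<zeta> \<and> (\<forall>x. 0 \<le> \<zeta> x \<and> \<zeta> x \<le> 1) \<and> (\<forall>x\<in>ball c r. \<zeta> x < 1) \<and> (\<forall>x. x \<notin> ball c r \<longrightarrow> \<zeta> x = 1)"
proof -
  define q where "q x = r\<^sup>2 - (x - c) \<bullet> (x - c)" for x
  define \<zeta> where "\<zeta> x = 1 - (1 / r ^ 4) * (max 0 (q x))\<^sup>2" for x
  let ?d = "\<lambda>x. 0 - ((1 / r ^ 4) *\<^sub>R ((2 * max 0 (q x)) *\<^sub>R (- (2 *\<^sub>R (x - c)))) + ((max 0 (q x))\<^sup>2) *\<^sub>R 0)"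
  have q: "GDERIV q x :> - (2 *\<^sub>R (x - c))" for x
    unfolding q_def gderiv_def
    by (rule has_derivative_eq_rhs) (auto intro!: derivative_eq_intros simp: fun_eq_iff inner_simps inner_commute)
  have max_q: "GDERIV (\<lambda>x. (max 0 (q x))\<^sup>2) x :> (2 * max 0 (q x)) *\<^sub>R (- (2 *\<^sub>R (x - c)))" for x
    by (rule GDERIV_DERIV_compose[OF q DERIV_square_positive_part])
  have chi: "GDERIV \<zeta> x :> ?d x" for x
    unfolding \<zeta>_def by (intro GDERIV_diff GDERIV_mult GDERIV_const max_q)
  have "continuous_on UNIV q" unfolding q_def by (intro continuous_intros)
  then have cont: "continuous_on UNIV ?d"
    by (intro continuous_intros)
  have q_ball: "q x > 0 \<longleftrightarrow> x \<in> ball c r" for x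
  proof -
    have "q x > 0 \<longleftrightarrow> (dist c x)\<^sup>2 < r\<^sup>2"
      by (simp add: q_def dist_norm power2_norm_eq_inner[symmetric] norm_minus_commute)
    also have "\<dots> \<longleftrightarrow> dist c x < r"
      using assms(1) by (meson less_imp_le power2_less_imp_less power_strict_mono zero_le_dist zero_less_numeral)
    finally show ?thesis by simp
  qed
  have q_le: "(max 0 (q x))\<^sup>2 \<le> r ^ 4" for x
  proof -
    have "max 0 (q x) \<le> r\<^sup>2" by (simp add: q_def)
    then have "(max 0 (q x))\<^sup>2 \<le> (r\<^sup>2)\<^sup>2" by (intro power_mono) auto
    then show ?thesis by (simp flip: power_mult)
  qed
  have "\<zeta> x = 1" if "x \<notin> ball c r" for x
    using that q_ball[of x] by (simp add: \<zeta>_def max_def)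
  moreover have "\<zeta> x < 1" if "x \<in> ball c r" for x
    using that q_ball[of x] assms by (simp add: \<zeta>_def)
  moreover have "0 \<le> \<zeta> x" "\<zeta> x \<le> 1" for x
    using q_le[of x] assms by (auto simp: \<zeta>_def field_simps)
  moreover have "cutoff D \<zeta>"
    unfolding cutoff_def using chi cont assms calculation(1)
    by (intro conjI exI[of _ ?d] exI[of _ "cball c r"]) auto
  ultimately show ?thesis by blast
qed

text \<open>By Lindelof's theorem countably many balls fill \<open>U\<close>. The product of the
  first \<open>n\<close> cutoffs, each raised to the power \<open>n\<close>, equals 1 off
  \<open>U\<close> and tends to 0 in \<open>U\<close>, since some cutoff is below 1 at each point
  and all others are at most 1.\<close>

lemma open_indicator_limit_test_functions:
  fixes U :: "(real^'d) set"
  assumes "open U" "U \<subseteq> D"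
  shows "\<exists>\<Phi>. (\<forall>n. \<exists>d\<phi>. test_function D (\<Phi> n) d\<phi>) \<and> (\<forall>n x. 0 \<le> \<Phi> n x \<and> \<Phi> n x \<le> 1) \<and>
     (\<forall>x. (\<lambda>n. \<Phi> n x) \<longlonglongrightarrow> indicator U x)"
proof -
  define B0 where "B0 = {ball c r | c r. r > 0 \<and> cball c r \<subseteq> U}"
  have op: "\<And>S. S \<in> B0 \<Longrightarrow> open S" by (auto simp: B0_def)
  obtain B where B: "B \<subseteq> B0" "countable B" "\<Union>B = \<Union>B0"
    by (rule Lindelof[OF op])
  have "x \<in> \<Union>B0" if "x \<in> U" for x
  proof -
    from that obtain e where e: "e > 0" "cball x e \<subseteq> U"
      using bspec[OF open_contains_cball[THEN iffD1, OF assms(1)], of x] by auto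
    then have "ball x e \<in> B0" unfolding B0_def by (intro CollectI exI[of _ x] exI[of _ e] conjI refl)
    moreover have "x \<in> ball x e" using e(1) by simp
    ultimately show ?thesis by (rule UnionI)
  qed
  moreover have "x \<in> U" if x: "x \<in> \<Union>B0" for x
  proof -
    from x obtain c r where "x \<in> ball c r" "cball c r \<subseteq> U" unfolding B0_def by auto
    then show ?thesis using ball_subset_cball[of c r] by (meson subsetD)
  qed
  ultimately have UB: "\<Union>B = U" unfolding B(3) by (intro equalityI subsetI)
  have "\<exists>\<zeta>. cutoff D \<zeta> \<and> (\<forall>x. 0 \<le> \<zeta> x \<and> \<zeta> x \<le> 1) \<and> (\<forall>x\<in>b. \<zeta> x < 1) \<and> (\<forall>x. x \<notin> b \<longrightarrow> \<zeta> x = 1)" if "b \<in> B" for b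
  proof -
    have "b \<in> B0" using B(1) that by (rule subsetD)
    then obtain c r where b: "b = ball c r" "r > 0" "cball c r \<subseteq> U" unfolding B0_def by auto
    show ?thesis unfolding b(1) using b assms(2) by (intro cutoff_ball_exists) simp_all
  qed
  then have "\<exists>\<zeta>. \<forall>b\<in>B. cutoff D (\<zeta> b) \<and> (\<forall>x. 0 \<le> \<zeta> b x \<and> \<zeta> b x \<le> 1) \<and> (\<forall>x\<in>b. \<zeta> b x < 1) \<and> (\<forall>x. x \<notin> b \<longrightarrow> \<zeta> b x = 1)"
    by (intro bchoice ballI)
  then obtain \<zeta> where \<zeta>: "\<And>b. b \<in> B \<Longrightarrow> cutoff D (\<zeta> b)" "\<And>b x. b \<in> B \<Longrightarrow> 0 \<le> \<zeta> b x" "\<And>b x. b \<in> B \<Longrightarrow> \<zeta> b x \<le> 1"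
    "\<And>b x. b \<in> B \<Longrightarrow> x \<in> b \<Longrightarrow> \<zeta> b x < 1" "\<And>b x. b \<in> B \<Longrightarrow> x \<notin> b \<Longrightarrow> \<zeta> b x = 1"
    by blast
  \<comment> \<open>If \<open>B\<close> is empty, so is \<open>U\<close>, and the constant 1 makes
    the approximations vanish identically.\<close>
  define \<xi> where "\<xi> j = (if B = {} then (\<lambda>_. 1) else \<zeta> (from_nat_into B j))" for j :: nat
  have in_B: "B \<noteq> {} \<Longrightarrow> from_nat_into B j \<in> B" for j by (rule from_nat_into)
  have \<xi>: "cutoff D (\<xi> j)" "0 \<le> \<xi> j x" "\<xi> j x \<le> 1" "x \<notin> U \<Longrightarrow> \<xi> j x = 1" for j x
  proof -
    show "cutoff D (\<xi> j)" "0 \<le> \<xi> j x" "\<xi> j x \<le> 1"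
      using \<zeta>(1-3)[OF in_B] by (simp_all add: \<xi>_def cutoff_one)
    show "\<xi> j x = 1" if "x \<notin> U"
      using that UB in_B[of j] \<zeta>(5)[of "from_nat_into B j" x] by (cases "B = {}") (auto simp: \<xi>_def)
  qed
  have \<xi>_less: "\<exists>j. \<xi> j x < 1" if x: "x \<in> U" for x
  proof -
    have "x \<in> \<Union>B" unfolding UB by (rule x)
    then obtain b where b: "b \<in> B" "x \<in> b" by (rule UnionE)
    then obtain j where "from_nat_into B j = b" using from_nat_into_surj[OF B(2)] by metis
    then show ?thesis using b \<zeta>(4) by (auto simp: \<xi>_def)
  qed
  define \<Phi> where "\<Phi> n x = 1 - (\<Prod>j<n. \<xi> j x ^ n)" for n x
  have P01: "0 \<le> (\<Prod>j<n. \<xi> j x ^ n)" "(\<Prod>j<n. \<xi> j x ^ n) \<le> 1" for n x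
    using \<xi> by (auto intro!: prod_nonneg prod_le_1 power_le_one)
  have "(\<lambda>n. \<Phi> n x) \<longlonglongrightarrow> indicator U x" for x
  proof (cases "x \<in> U")
    case True
    then obtain j where j: "\<xi> j x < 1" using \<xi>_less by blast
    have "(\<lambda>n. \<Prod>i<n. \<xi> i x ^ n) \<longlonglongrightarrow> 0"
    proof (rule Lim_null_comparison)
      show "(\<lambda>n. \<xi> j x ^ n) \<longlonglongrightarrow> 0" using j \<xi>(2)[of j x] by (intro LIMSEQ_power_zero) auto
      show "\<forall>\<^sub>F n in sequentially. norm (\<Prod>i<n. \<xi> i x ^ n) \<le> \<xi> j x ^ n"
        using eventually_gt_at_top[of j]
      proof eventually_elim
        case (elim n)
        have "(\<Prod>i<n. \<xi> i x ^ n) = \<xi> j x ^ n * (\<Prod>i\<in>{..<n} - {j}. \<xi> i x ^ n)"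
          using elim by (intro prod.remove) auto
        also have "\<dots> \<le> \<xi> j x ^ n * 1"
          using \<xi> by (intro mult_left_mono prod_le_1) (auto intro: power_le_one)
        finally show ?case using P01(1)[where n = n and x = x] by simp
      qed
    qed
    then have "(\<lambda>n. 1 - (\<Prod>i<n. \<xi> i x ^ n)) \<longlonglongrightarrow> 1 - 0" by (intro tendsto_intros)
    then show ?thesis using True by (simp add: \<Phi>_def)
  next
    case False
    then show ?thesis using \<xi>(4) by (simp add: \<Phi>_def)
  qed
  moreover have "\<exists>d\<phi>. test_function D (\<Phi> n) d\<phi>" for n
    unfolding \<Phi>_def by (intro cutoff_test_function cutoff_prod cutoff_power \<xi>)
  moreover have "0 \<le> \<Phi> n x" "\<Phi> n x \<le> 1" for n x using P01[of x n] by (auto simp: \<Phi>_def)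
  ultimately show ?thesis by blast
qed

text \<open>Fundamental lemma of the calculus of variations. Dominated convergence extends the
  vanishing of the integral from test functions to indicators of open sets, then of measurable sets;
  the sets where a component is positive finish the proof.\<close>

lemma AE_zero_of_test_functions:
  fixes G :: "real^'d \<Rightarrow> real^'d"
  assumes D: "open D" and G: "integrable (lebesgue_on D) G"
    and zero: "\<And>\<phi> d\<phi>. test_function D \<phi> d\<phi> \<Longrightarrow> (\<integral>x. \<phi> x *\<^sub>R G x \<partial>lebesgue_on D) = 0"
  shows "AE x in lebesgue_on D. G x = 0"
proof -
  let ?N = "lebesgue_on D"
  have D_sets [measurable]: "D \<in> sets lebesgue" using D by auto
  have [measurable]: "G \<in> borel_measurable ?N" using G by auto
  have space_N: "space ?N = D" by (simp add: space_restrict_space)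
  have ind: "(indicator S :: real^'d \<Rightarrow> real) \<in> borel_measurable ?N" if "S \<in> sets lebesgue" for S
    using that by (intro measurable_restrict_space1 borel_measurable_indicator)
  have open_zero: "(\<integral>x. indicator U x *\<^sub>R G x \<partial>?N) = 0" if U: "open U" "U \<subseteq> D" for U
  proof -
    obtain \<Phi> where \<Phi>: "\<And>n. \<exists>d\<phi>. test_function D (\<Phi> n) d\<phi>" "\<And>n x. 0 \<le> \<Phi> n x" "\<And>n x. \<Phi> n x \<le> 1"
      "\<And>x. (\<lambda>n. \<Phi> n x) \<longlonglongrightarrow> indicator U x"
      using open_indicator_limit_test_functions[OF U] by blast
    have \<Phi>_meas: "\<Phi> n \<in> borel_measurable ?N" for n
    proof -
      have "continuous_on UNIV (\<Phi> n)"
        using \<Phi>(1)[of n] by (auto simp: test_function_def intro: GDERIV_continuous_on)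
      then have "\<Phi> n \<in> borel_measurable borel" by (rule borel_measurable_continuous_onI)
      then show ?thesis by (intro measurable_restrict_space1 measurable_completion) simp
    qed
    have "(\<lambda>n. \<integral>x. \<Phi> n x *\<^sub>R G x \<partial>?N) \<longlonglongrightarrow> (\<integral>x. indicator U x *\<^sub>R G x \<partial>?N)"
    proof (rule integral_dominated_convergence[where w = "\<lambda>x. norm (G x)"])
      show "(\<lambda>x. indicator U x *\<^sub>R G x) \<in> borel_measurable ?N"
        using ind[of U] U by (intro borel_measurable_scaleR) auto
      show "(\<lambda>x. \<Phi> n x *\<^sub>R G x) \<in> borel_measurable ?N" for n
        using \<Phi>_meas by (intro borel_measurable_scaleR) auto
      show "AE x in ?N. (\<lambda>n. \<Phi> n x *\<^sub>R G x) \<longlonglongrightarrow> indicator U x *\<^sub>R G x"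
        using \<Phi>(4) by (intro AE_I2 tendsto_intros) auto
      show "AE x in ?N. norm (\<Phi> n x *\<^sub>R G x) \<le> norm (G x)" for n
        using \<Phi>(2,3) by (intro AE_I2) (auto intro: mult_left_le_one_le)
    qed (use G in auto)
    moreover have "(\<integral>x. \<Phi> n x *\<^sub>R G x \<partial>?N) = 0" for n using \<Phi>(1)[of n] zero by blast
    ultimately show ?thesis by (simp add: LIMSEQ_const_iff)
  qed
  have set_zero: "(\<integral>x. indicator E x *\<^sub>R G x \<partial>?N) = 0" if E: "E \<in> sets lebesgue" for E
  proof -
    obtain C T where C: "gdelta C" "T \<in> null_sets lebesgue" "E \<union> T = C" "disjnt E T"
      using lebesgue_set_almost_gdelta[OF E] .
    from C(1) obtain F :: "nat \<Rightarrow> (real^'d) set" where F: "\<And>n. open (F n)" "C = \<Inter>(F ` UNIV)"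
      by (auto elim: gdelta.cases)
    \<comment> \<open>Decreasing open subsets of \<open>D\<close> whose intersection is
      \<open>C\<close> within \<open>D\<close>, hence \<open>E\<close> up to a null set.\<close>
    define U where "U n = D \<inter> (\<Inter>j\<le>n. F j)" for n
    have U: "open (U n)" "U n \<subseteq> D" for n
      unfolding U_def using D F by (auto intro!: open_Int open_INT)
    have "(\<lambda>n. \<integral>x. indicator (U n) x *\<^sub>R G x \<partial>?N) \<longlonglongrightarrow> (\<integral>x. indicator E x *\<^sub>R G x \<partial>?N)"
    proof (rule integral_dominated_convergence[where w = "\<lambda>x. norm (G x)"])
      have "AE x in lebesgue. x \<notin> T" using C(2) by (rule AE_not_in)
      then have "AE x in ?N. x \<notin> T"
        by (subst AE_restrict_space_iff) (auto elim: eventually_mono)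
      moreover have "AE x in ?N. x \<in> D" using space_N by (intro AE_I2) auto
      ultimately show "AE x in ?N. (\<lambda>n. indicator (U n) x *\<^sub>R G x) \<longlonglongrightarrow> indicator E x *\<^sub>R G x"
      proof eventually_elim
        case (elim x)
        have "(\<lambda>n. indicator (U n) x :: real) \<longlonglongrightarrow> indicator E x"
        proof (cases "x \<in> E")
          case True
          then have "x \<in> U n" for n using elim C(3) F(2) by (auto simp: U_def)
          then show ?thesis using True by simp
        next
          case False
          then have "x \<notin> C" using C(3) elim by auto
          then obtain j where "x \<notin> F j" using F(2) by auto
          then have "x \<notin> U n" if "n \<ge> j" for n using that by (auto simp: U_def)
          then have "\<forall>\<^sub>F n in sequentially. (indicator (U n) x :: real) = 0"
            unfolding eventually_sequentially by (auto simp: indicator_def)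
          then show ?thesis using False by (simp add: tendsto_eventually)
        qed
        then show ?case by (intro tendsto_intros)
      qed
      show "(\<lambda>x. indicator E x *\<^sub>R G x) \<in> borel_measurable ?N"
        using ind[OF E] by (intro borel_measurable_scaleR) auto
      show "(\<lambda>x. indicator (U n) x *\<^sub>R G x) \<in> borel_measurable ?N" for n
        using ind[of "U n"] U(1) by (intro borel_measurable_scaleR) auto
      show "AE x in ?N. norm (indicator (U n) x *\<^sub>R G x) \<le> norm (G x)" for n
        by (intro AE_I2) (auto simp: indicator_def)
    qed (use G in auto)
    then show ?thesis using open_zero[OF U] by (simp add: LIMSEQ_const_iff)
  qed
  have half: "AE x in ?N. G x \<bullet> b \<le> 0" for b
  proof -
    define E where "E = {x \<in> D. G x \<bullet> b > 0}"
    have "E = {x \<in> space ?N. G x \<bullet> b > 0}" by (simp add: E_def space_N)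
    also have "\<dots> \<in> sets ?N" by measurable
    finally have E: "E \<in> sets lebesgue" using D_sets by (simp add: sets_restrict_space_iff)
    have int: "integrable ?N (\<lambda>x. indicator E x *\<^sub>R G x)"
    proof (rule Bochner_Integration.integrable_bound[OF G])
      show "(\<lambda>x. indicator E x *\<^sub>R G x) \<in> borel_measurable ?N"
        using ind[OF E] by (intro borel_measurable_scaleR) auto
      show "AE x in ?N. norm (indicator E x *\<^sub>R G x) \<le> norm (G x)"
        by (intro AE_I2) (auto simp: indicator_def)
    qed
    have "(\<integral>x. (indicator E x *\<^sub>R G x) \<bullet> b \<partial>?N) = (\<integral>x. indicator E x *\<^sub>R G x \<partial>?N) \<bullet> b"
      by (rule integral_inner_left) (rule int)
    then have "(\<integral>x. (indicator E x *\<^sub>R G x) \<bullet> b \<partial>?N) = 0" using set_zero[OF E] by simp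
    moreover have "integrable ?N (\<lambda>x. (indicator E x *\<^sub>R G x) \<bullet> b)" using int by (intro integrable_inner_left)
    moreover have "AE x in ?N. 0 \<le> (indicator E x *\<^sub>R G x) \<bullet> b" by (intro AE_I2) (auto simp: E_def indicator_def)
    ultimately have "AE x in ?N. (indicator E x *\<^sub>R G x) \<bullet> b = 0" by (simp only: integral_nonneg_eq_0_iff_AE)
    moreover have "AE x in ?N. x \<in> D" using space_N by (intro AE_I2) auto
    ultimately show ?thesis by eventually_elim (auto simp: E_def indicator_def split: if_splits)
  qed
  have "AE x in ?N. \<forall>b\<in>Basis. G x \<bullet> b = 0"
  proof (rule AE_finite_allI[OF finite_Basis])
    fix b :: "real^'d"
    show "AE x in ?N. G x \<bullet> b = 0"
      using half[of b] half[of "- b"] by eventually_elim auto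
  qed
  then show ?thesis by eventually_elim (auto intro: euclidean_eqI)
qed

section \<open>Sobolev spaces\<close>

locale bounded_open =
  fixes D :: "(real^'d) set"
  assumes open_D: "open D" and bounded_D: "bounded D"
begin

abbreviation "N \<equiv> lebesgue_on D"

lemma space_N: "space N = D"
  by (simp add: space_restrict_space)

lemma finite_measure_N: "finite_measure N"
proof
  have "D \<in> lmeasurable" using open_D bounded_D by (rule lmeasurable_open[rotated])
  then show "emeasure N (space N) \<noteq> \<infinity>"
    using open_D by (simp add: space_N emeasure_restrict_space fmeasurable_def)
qed

sublocale finite_measure N by (rule finite_measure_N)

lemma integrable_mult_bounded:
  fixes f :: "real^'d \<Rightarrow> 'b::euclidean_space" and h :: "real^'d \<Rightarrow> 'c::euclidean_space"
    and m :: "'b \<Rightarrow> 'c \<Rightarrow> 'e::euclidean_space"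
  assumes f: "integrable N f" and m: "\<And>x y. norm (m x y) \<le> norm x * norm y"
    and meas: "(\<lambda>x. m (f x) (h x)) \<in> borel_measurable N" and B: "\<And>x. x \<in> D \<Longrightarrow> norm (h x) \<le> B"
  shows "integrable N (\<lambda>x. m (f x) (h x))" "norm (\<integral>x. m (f x) (h x) \<partial>N) \<le> B * (\<integral>x. norm (f x) \<partial>N)"
proof -
  have le: "norm (m (f x) (h x)) \<le> B * norm (f x)" if "x \<in> D" for x
  proof -
    have "norm (m (f x) (h x)) \<le> norm (f x) * norm (h x)" by (rule m)
    also have "\<dots> \<le> norm (f x) * B" by (rule mult_left_mono[OF B[OF that]]) simp
    finally show ?thesis by (simp add: mult.commute)
  qed
  have int: "integrable N (\<lambda>x. B * norm (f x))" using f by simp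
  show 1: "integrable N (\<lambda>x. m (f x) (h x))"
  proof (rule Bochner_Integration.integrable_bound[OF int meas], rule AE_I2)
    fix x assume "x \<in> space N"
    then have "norm (m (f x) (h x)) \<le> B * norm (f x)" using le by (simp add: space_N)
    also have "\<dots> \<le> norm (B * norm (f x))" by simp
    finally show "norm (m (f x) (h x)) \<le> norm (B * norm (f x))" .
  qed
  have "norm (\<integral>x. m (f x) (h x) \<partial>N) \<le> (\<integral>x. norm (m (f x) (h x)) \<partial>N)" by (rule integral_norm_bound)
  also have "\<dots> \<le> (\<integral>x. B * norm (f x) \<partial>N)"
    by (rule integral_mono) (use 1 int le space_N in auto)
  finally show "norm (\<integral>x. m (f x) (h x) \<partial>N) \<le> B * (\<integral>x. norm (f x) \<partial>N)" by simp
qed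

lemma continuous_bounded_on_D:
  fixes f :: "real^'d \<Rightarrow> 'b::euclidean_space"
  assumes "continuous_on UNIV f"
  shows "\<exists>B. \<forall>x\<in>D. norm (f x) \<le> B"
proof -
  have "compact (closure D)" using bounded_D by (simp add: compact_closure)
  then have "compact (f ` closure D)"
    by (rule compact_continuous_image[rotated]) (rule continuous_on_subset[OF assms], simp)
  then obtain B where "\<forall>y\<in>f ` closure D. norm y \<le> B" by (meson bounded_iff compact_imp_bounded)
  then have "\<forall>x\<in>D. norm (f x) \<le> B" using closure_subset[of D] by (meson imageI subsetD)
  then show ?thesis by (rule exI)
qed

lemma continuous_measurable:
  fixes f :: "real^'d \<Rightarrow> 'b::euclidean_space"
  assumes "continuous_on UNIV f"
  shows "f \<in> borel_measurable N"
proof -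
  have "f \<in> borel_measurable borel" using assms by (rule borel_measurable_continuous_onI)
  then show ?thesis by (intro measurable_restrict_space1 measurable_completion) simp
qed

lemma test_function_continuous:
  "test_function D \<phi> d\<phi> \<Longrightarrow> continuous_on UNIV \<phi>" "test_function D \<phi> d\<phi> \<Longrightarrow> continuous_on UNIV d\<phi>"
  by (auto simp: test_function_def intro: GDERIV_continuous_on)

lemma scaleR_continuous_bound:
  fixes v :: "real^'d \<Rightarrow> real"
  assumes "v \<in> L2 N" "continuous_on UNIV d\<phi>" "\<And>x. x \<in> D \<Longrightarrow> norm (d\<phi> x) \<le> B"
  shows "integrable N (\<lambda>x. v x *\<^sub>R (d\<phi> x :: real^'d))" "norm (\<integral>x. v x *\<^sub>R d\<phi> x \<partial>N) \<le> B * (\<integral>x. norm (v x) \<partial>N)"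
proof -
  have "(\<lambda>x. v x *\<^sub>R d\<phi> x) \<in> borel_measurable N"
    by (intro borel_measurable_scaleR L2_measurable assms continuous_measurable)
  from integrable_mult_bounded[where m = scaleR, OF L2_integrable_norm(1)[OF assms(1)] _ this assms(3)]
  show "integrable N (\<lambda>x. v x *\<^sub>R d\<phi> x)" "norm (\<integral>x. v x *\<^sub>R d\<phi> x \<partial>N) \<le> B * (\<integral>x. norm (v x) \<partial>N)"
    by auto
qed

lemma continuous_scaleR_bound:
  fixes G :: "real^'d \<Rightarrow> real^'d"
  assumes "G \<in> L2 N" "continuous_on UNIV \<phi>" "\<And>x. x \<in> D \<Longrightarrow> norm (\<phi> x :: real) \<le> B"
  shows "integrable N (\<lambda>x. \<phi> x *\<^sub>R G x)" "norm (\<integral>x. \<phi> x *\<^sub>R G x \<partial>N) \<le> B * (\<integral>x. norm (G x) \<partial>N)"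
proof -
  have "(\<lambda>x. \<phi> x *\<^sub>R G x) \<in> borel_measurable N"
    by (intro borel_measurable_scaleR L2_measurable assms continuous_measurable)
  from integrable_mult_bounded[where m = "\<lambda>x y. y *\<^sub>R x", OF L2_integrable_norm(1)[OF assms(1)] _ this assms(3)]
  show "integrable N (\<lambda>x. \<phi> x *\<^sub>R G x)" "norm (\<integral>x. \<phi> x *\<^sub>R G x \<partial>N) \<le> B * (\<integral>x. norm (G x) \<partial>N)"
    by auto
qed

lemma test_integrable:
  assumes "test_function D \<phi> d\<phi>"
  shows "v \<in> L2 N \<Longrightarrow> integrable N (\<lambda>x. v x *\<^sub>R d\<phi> x)" "G \<in> L2 N \<Longrightarrow> integrable N (\<lambda>x. \<phi> x *\<^sub>R (G x :: real^'d))"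
proof -
  obtain B where B: "\<And>x. x \<in> D \<Longrightarrow> norm (\<phi> x) \<le> B"
    using continuous_bounded_on_D[OF test_function_continuous(1)[OF assms]] by blast
  obtain B' where B': "\<And>x. x \<in> D \<Longrightarrow> norm (d\<phi> x) \<le> B'"
    using continuous_bounded_on_D[OF test_function_continuous(2)[OF assms]] by blast
  show "v \<in> L2 N \<Longrightarrow> integrable N (\<lambda>x. v x *\<^sub>R d\<phi> x)"
    using scaleR_continuous_bound(1)[OF _ test_function_continuous(2)[OF assms] B'] by blast
  show "G \<in> L2 N \<Longrightarrow> integrable N (\<lambda>x. \<phi> x *\<^sub>R G x)"
    using continuous_scaleR_bound(1)[OF _ test_function_continuous(1)[OF assms] B] by blast
qed

lemma has_weak_gradient_lincomb:
  assumes L2: "u \<in> L2 N" "v \<in> L2 N" "G \<in> L2 N" "H \<in> L2 N"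
    and G: "has_weak_gradient D u G" "has_weak_gradient D v H"
  shows "has_weak_gradient D (lincomb b u c v) (\<lambda>x. b *\<^sub>R G x + c *\<^sub>R H x)"
  unfolding has_weak_gradient_def
proof (intro allI impI)
  fix \<phi> d\<phi> assume \<phi>: "test_function D \<phi> d\<phi>"
  have "(\<integral>x. lincomb b u c v x *\<^sub>R d\<phi> x \<partial>N) = (\<integral>x. b *\<^sub>R (u x *\<^sub>R d\<phi> x) + c *\<^sub>R (v x *\<^sub>R d\<phi> x) \<partial>N)"
    by (simp only: lincomb_def scaleR_add_left scaleR_scaleR)
  also have "\<dots> = b *\<^sub>R (\<integral>x. u x *\<^sub>R d\<phi> x \<partial>N) + c *\<^sub>R (\<integral>x. v x *\<^sub>R d\<phi> x \<partial>N)"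
    using test_integrable(1)[OF \<phi>] L2 by (simp del: scaleR_scaleR)
  also have "\<dots> = b *\<^sub>R (- (\<integral>x. \<phi> x *\<^sub>R G x \<partial>N)) + c *\<^sub>R (- (\<integral>x. \<phi> x *\<^sub>R H x \<partial>N))"
    using G \<phi> by (simp add: has_weak_gradient_def)
  also have "\<dots> = - (\<integral>x. b *\<^sub>R (\<phi> x *\<^sub>R G x) + c *\<^sub>R (\<phi> x *\<^sub>R H x) \<partial>N)"
    using test_integrable(2)[OF \<phi>] L2 by (simp del: scaleR_scaleR)
  also have "\<dots> = - (\<integral>x. \<phi> x *\<^sub>R (b *\<^sub>R G x + c *\<^sub>R H x) \<partial>N)"
    by (simp add: scaleR_add_right mult.commute)
  finally show "(\<integral>x. lincomb b u c v x *\<^sub>R d\<phi> x \<partial>N) = - (\<integral>x. \<phi> x *\<^sub>R (b *\<^sub>R G x + c *\<^sub>R H x) \<partial>N)" .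
qed

text \<open>\<open>weak_grad\<close> is an arbitrary choice. Uniqueness up to null sets makes it
  linear almost everywhere and the norms built on it independent of the choice.\<close>

lemma has_weak_gradient_unique:
  assumes "G \<in> L2 N" "H \<in> L2 N" "has_weak_gradient D v G" "has_weak_gradient D v H"
  shows "AE x in N. G x = H x"
proof -
  have "AE x in N. G x - H x = 0"
  proof (rule AE_zero_of_test_functions[OF open_D])
    show "integrable N (\<lambda>x. G x - H x)" using assms by (intro Bochner_Integration.integrable_diff L2_integrable_norm)
    fix \<phi> d\<phi> assume \<phi>: "test_function D \<phi> d\<phi>"
    have "(\<integral>x. \<phi> x *\<^sub>R G x \<partial>N) = (\<integral>x. \<phi> x *\<^sub>R H x \<partial>N)"
      using assms(3,4)[unfolded has_weak_gradient_def, rule_format, OF \<phi>] by simp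
    then show "(\<integral>x. \<phi> x *\<^sub>R (G x - H x) \<partial>N) = 0"
      using test_integrable(2)[OF \<phi>] assms by (simp add: scaleR_diff_right)
  qed
  then show ?thesis by simp
qed

lemma H1_L2: "v \<in> H1 D \<Longrightarrow> v \<in> L2 N"
  by (simp add: H1_def)

lemma weak_grad: "v \<in> H1 D \<Longrightarrow> weak_grad D v \<in> L2 N" "v \<in> H1 D \<Longrightarrow> has_weak_gradient D v (weak_grad D v)"
proof -
  assume "v \<in> H1 D"
  then have "\<exists>G. G \<in> L2 N \<and> has_weak_gradient D v G" by (auto simp: H1_def)
  then have "weak_grad D v \<in> L2 N \<and> has_weak_gradient D v (weak_grad D v)"
    unfolding weak_grad_def by (rule someI_ex)
  then show "weak_grad D v \<in> L2 N" "has_weak_gradient D v (weak_grad D v)" by auto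
qed

lemma H1I: "v \<in> L2 N \<Longrightarrow> G \<in> L2 N \<Longrightarrow> has_weak_gradient D v G \<Longrightarrow> v \<in> H1 D"
  by (auto simp: H1_def)

lemma L2_lincomb_real: "u \<in> L2 N \<Longrightarrow> v \<in> L2 N \<Longrightarrow> lincomb b u c v \<in> L2 N"
  using L2_lincomb[of u N v b c] by (simp add: lincomb_def)

lemma H1_lincomb: "u \<in> H1 D \<Longrightarrow> v \<in> H1 D \<Longrightarrow> lincomb b u c v \<in> H1 D"
  by (rule H1I[OF L2_lincomb_real[OF H1_L2 H1_L2] L2_lincomb[OF weak_grad(1) weak_grad(1)]
      has_weak_gradient_lincomb[OF H1_L2 H1_L2 weak_grad(1) weak_grad(1) weak_grad(2) weak_grad(2)]])

lemma weak_grad_lincomb: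
  assumes "u \<in> H1 D" "v \<in> H1 D"
  shows "AE x in N. weak_grad D (lincomb b u c v) x = b *\<^sub>R weak_grad D u x + c *\<^sub>R weak_grad D v x"
  using assms
  by (intro has_weak_gradient_unique[OF weak_grad(1)[OF H1_lincomb] L2_lincomb[OF weak_grad(1) weak_grad(1)] weak_grad(2)[OF H1_lincomb]
      has_weak_gradient_lincomb[OF H1_L2 H1_L2 weak_grad(1) weak_grad(1) weak_grad(2) weak_grad(2)]])

lemma grad_norm_lincomb:
  assumes "u \<in> H1 D" "v \<in> H1 D"
  shows "L2_norm N (weak_grad D (lincomb b u c v)) = L2_norm N (\<lambda>x. b *\<^sub>R weak_grad D u x + c *\<^sub>R weak_grad D v x)"
  by (rule L2_norm_cong_AE[OF L2_measurable L2_measurable weak_grad_lincomb])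
    (auto intro: assms weak_grad L2_lincomb H1_lincomb)

lemma H1_norm_nonneg [simp]: "0 \<le> H1_norm D v"
  by (simp add: H1_norm_def)

lemma L2_le_H1_norm: "L2_norm N v \<le> H1_norm D v" "L2_norm N (weak_grad D v) \<le> H1_norm D v"
  by (auto simp: H1_norm_def intro: real_le_rsqrt)

lemma H1_norm_le: "H1_norm D v \<le> L2_norm N v + L2_norm N (weak_grad D v)"
  unfolding H1_norm_def by (rule sqrt_sum_squares_le_sum) auto

text \<open>The factor \<open>2\<close> avoids Minkowski's inequality for the product norm.\<close>

lemma H1_norm_lincomb_le:
  assumes "u \<in> H1 D" "v \<in> H1 D"
  shows "H1_norm D (lincomb b u c v) \<le> 2 * (\<bar>b\<bar> * H1_norm D u + \<bar>c\<bar> * H1_norm D v)"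
proof -
  have "L2_norm N (lincomb b u c v) \<le> \<bar>b\<bar> * L2_norm N u + \<bar>c\<bar> * L2_norm N v"
    using L2_norm_triangle[OF H1_L2 H1_L2, OF assms, of b c] by (simp add: lincomb_def)
  also have "\<dots> \<le> \<bar>b\<bar> * H1_norm D u + \<bar>c\<bar> * H1_norm D v"
    by (intro add_mono mult_left_mono L2_le_H1_norm) auto
  finally have 1: "L2_norm N (lincomb b u c v) \<le> \<bar>b\<bar> * H1_norm D u + \<bar>c\<bar> * H1_norm D v" .
  have "L2_norm N (weak_grad D (lincomb b u c v)) \<le> \<bar>b\<bar> * L2_norm N (weak_grad D u) + \<bar>c\<bar> * L2_norm N (weak_grad D v)"
    unfolding grad_norm_lincomb[OF assms] by (intro L2_norm_triangle weak_grad assms)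
  also have "\<dots> \<le> \<bar>b\<bar> * H1_norm D u + \<bar>c\<bar> * H1_norm D v"
    by (intro add_mono mult_left_mono L2_le_H1_norm) auto
  finally show ?thesis using order_trans[OF H1_norm_le add_mono[OF 1]] by (simp only: mult_2)
qed

lemma L2_norm_scaleR: "L2_norm M' (\<lambda>x. b *\<^sub>R f x) = \<bar>b\<bar> * L2_norm M' f"
  by (simp add: L2_norm_def power_mult_distrib real_sqrt_mult)

lemma H1_norm_cmult:
  assumes "v \<in> H1 D"
  shows "H1_norm D (\<lambda>x. b * v x) = \<bar>b\<bar> * H1_norm D v"
proof -
  have eq: "(\<lambda>x. b * v x) = lincomb b v 0 v" by (simp add: lincomb_def)
  have "L2_norm N (\<lambda>x. b * v x) = \<bar>b\<bar> * L2_norm N v"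
    using L2_norm_scaleR[of N b v] by simp
  moreover have "L2_norm N (weak_grad D (\<lambda>x. b * v x)) = \<bar>b\<bar> * L2_norm N (weak_grad D v)"
    unfolding eq grad_norm_lincomb[OF assms assms] by (simp add: L2_norm_scaleR)
  ultimately have "H1_norm D (\<lambda>x. b * v x) = sqrt (\<bar>b\<bar>\<^sup>2 * ((L2_norm N v)\<^sup>2 + (L2_norm N (weak_grad D v))\<^sup>2))"
    unfolding H1_norm_def by (simp only: power_mult_distrib distrib_left)
  then show ?thesis by (simp only: real_sqrt_mult H1_norm_def real_sqrt_abs abs_idempotent)
qed

lemma zero_H1: "(\<lambda>_. 0) \<in> H1 D" and H1_norm_zero: "H1_norm D (\<lambda>_. 0) = 0"
proof -
  show z: "(\<lambda>_. 0) \<in> H1 D"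
    by (rule H1I[of _ "\<lambda>_. 0"]) (auto intro: L2_const simp: has_weak_gradient_def)
  show "H1_norm D (\<lambda>_. 0) = 0" using H1_norm_cmult[OF z, of 0] by simp
qed

text \<open>The weak gradient is a closed operator: for a fixed test function both sides of the
  integration by parts are continuous in the \<open>L2_norm\<close>, because \<open>\<phi>\<close>
  and its gradient are bounded on the bounded set \<open>D\<close>.\<close>

lemma H1_complete:
  assumes X: "\<And>n. X n \<in> H1 D"
    and Cauchy: "\<And>e. e > 0 \<Longrightarrow> \<exists>k. \<forall>m\<ge>k. \<forall>n\<ge>k. H1_norm D (lincomb 1 (X m) (-1) (X n)) < e"
  shows "\<exists>l\<in>H1 D. (\<lambda>n. H1_norm D (lincomb 1 (X n) (-1) l)) \<longlonglongrightarrow> 0"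
proof -
  let ?G = "\<lambda>n. weak_grad D (X n)"
  have G_diff: "L2_norm N (weak_grad D (lincomb 1 (X m) (-1) v)) = L2_norm N (\<lambda>x. ?G m x - weak_grad D v x)" if "v \<in> H1 D" for m v
    using grad_norm_lincomb[OF X that, of 1 m "-1"] by simp
  have v_diff: "L2_norm N (lincomb 1 (X m) (-1) v) = L2_norm N (\<lambda>x. X m x - v x)" for m v
    by (simp add: lincomb_def)
  have "\<exists>v\<in>L2 N. (\<lambda>n. L2_norm N (\<lambda>x. X n x - v x)) \<longlonglongrightarrow> 0"
  proof (rule L2_complete)
    fix e :: real assume "e > 0"
    from Cauchy[OF this] show "\<exists>k. \<forall>m\<ge>k. \<forall>n\<ge>k. L2_norm N (\<lambda>x. X m x - X n x) < e"
      unfolding v_diff[symmetric] by (meson L2_le_H1_norm(1) le_less_trans)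
  qed (rule H1_L2[OF X])
  then obtain v where v: "v \<in> L2 N" "(\<lambda>n. L2_norm N (\<lambda>x. X n x - v x)) \<longlonglongrightarrow> 0" by blast
  have "\<exists>G\<in>L2 N. (\<lambda>n. L2_norm N (\<lambda>x. ?G n x - G x)) \<longlonglongrightarrow> 0"
  proof (rule L2_complete)
    fix e :: real assume "e > 0"
    from Cauchy[OF this] show "\<exists>k. \<forall>m\<ge>k. \<forall>n\<ge>k. L2_norm N (\<lambda>x. ?G m x - ?G n x) < e"
      unfolding G_diff[OF X, symmetric] by (meson L2_le_H1_norm(2) le_less_trans)
  qed (rule weak_grad(1)[OF X])
  then obtain G where G: "G \<in> L2 N" "(\<lambda>n. L2_norm N (\<lambda>x. ?G n x - G x)) \<longlonglongrightarrow> 0" by blast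
  define C where "C = sqrt (measure N (space N))"
  have "has_weak_gradient D v G"
    unfolding has_weak_gradient_def
  proof (intro allI impI)
    fix \<phi> d\<phi> assume \<phi>: "test_function D \<phi> d\<phi>"
    let ?a = "\<lambda>n. (\<integral>x. X n x *\<^sub>R d\<phi> x \<partial>N) - (\<integral>x. v x *\<^sub>R d\<phi> x \<partial>N)"
    let ?b = "\<lambda>n. (\<integral>x. \<phi> x *\<^sub>R ?G n x \<partial>N) - (\<integral>x. \<phi> x *\<^sub>R G x \<partial>N)"
    let ?c = "\<lambda>n. C * L2_norm N (\<lambda>x. X n x - v x)" and ?d = "\<lambda>n. C * L2_norm N (\<lambda>x. ?G n x - G x)"
    obtain B where B: "\<And>x. x \<in> D \<Longrightarrow> norm (\<phi> x) \<le> B"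
      using continuous_bounded_on_D[OF test_function_continuous(1)[OF \<phi>]] by blast
    obtain B' where B': "\<And>x. x \<in> D \<Longrightarrow> norm (d\<phi> x) \<le> B'"
      using continuous_bounded_on_D[OF test_function_continuous(2)[OF \<phi>]] by blast
    have lim1: "?a \<longlonglongrightarrow> 0"
    proof (rule Lim_null_comparison)
      show "(\<lambda>n. \<bar>B'\<bar> * ?c n) \<longlonglongrightarrow> 0"
        by (intro tendsto_mult_right_zero v)
      show "\<forall>\<^sub>F n in sequentially. norm (?a n) \<le> \<bar>B'\<bar> * ?c n"
      proof (rule always_eventually, rule allI)
        fix n
        have L: "(\<lambda>x. X n x - v x) \<in> L2 N" by (intro L2_diff H1_L2 X v)
        have "?a n = (\<integral>x. (X n x - v x) *\<^sub>R d\<phi> x \<partial>N)"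
          using test_integrable(1)[OF \<phi>] H1_L2[OF X] v by (simp add: scaleR_diff_left)
        also have "norm \<dots> \<le> \<bar>B'\<bar> * (\<integral>x. norm (X n x - v x) \<partial>N)"
          by (rule scaleR_continuous_bound(2)[OF L test_function_continuous(2)[OF \<phi>]]) (use B' in \<open>auto intro: order_trans[OF _ abs_ge_self]\<close>)
        also have "\<dots> \<le> \<bar>B'\<bar> * ?c n"
          unfolding C_def by (intro mult_left_mono L2_integrable_norm(2) L) simp
        finally show "norm (?a n) \<le> \<bar>B'\<bar> * ?c n" .
      qed
    qed
    have lim2: "?b \<longlonglongrightarrow> 0"
    proof (rule Lim_null_comparison)
      show "(\<lambda>n. \<bar>B\<bar> * ?d n) \<longlonglongrightarrow> 0"
        by (intro tendsto_mult_right_zero G)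
      show "\<forall>\<^sub>F n in sequentially. norm (?b n) \<le> \<bar>B\<bar> * ?d n"
      proof (rule always_eventually, rule allI)
        fix n
        have L: "(\<lambda>x. ?G n x - G x) \<in> L2 N" by (intro L2_diff weak_grad X G)
        have "?b n = (\<integral>x. \<phi> x *\<^sub>R (?G n x - G x) \<partial>N)"
          using test_integrable(2)[OF \<phi>] weak_grad(1)[OF X] G by (simp add: scaleR_diff_right)
        also have "norm \<dots> \<le> \<bar>B\<bar> * (\<integral>x. norm (?G n x - G x) \<partial>N)"
          by (rule continuous_scaleR_bound(2)[OF L test_function_continuous(1)[OF \<phi>]]) (use B in \<open>auto intro: order_trans[OF _ abs_ge_self]\<close>)
        also have "\<dots> \<le> \<bar>B\<bar> * ?d n"
          unfolding C_def by (intro mult_left_mono L2_integrable_norm(2) L) simp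
        finally show "norm (?b n) \<le> \<bar>B\<bar> * ?d n" .
      qed
    qed
    have eq: "(\<integral>x. X n x *\<^sub>R d\<phi> x \<partial>N) = - (\<integral>x. \<phi> x *\<^sub>R ?G n x \<partial>N)" for n
      using weak_grad(2)[OF X] \<phi> by (simp add: has_weak_gradient_def)
    have "(\<lambda>n. ?a n + ?b n) \<longlonglongrightarrow> 0 + 0"
      by (rule tendsto_add[OF lim1 lim2])
    then have "(\<lambda>n::nat. - (\<integral>x. v x *\<^sub>R d\<phi> x \<partial>N) - (\<integral>x. \<phi> x *\<^sub>R G x \<partial>N)) \<longlonglongrightarrow> 0"
      unfolding eq by simp
    then have "- (\<integral>x. v x *\<^sub>R d\<phi> x \<partial>N) - (\<integral>x. \<phi> x *\<^sub>R G x \<partial>N) = 0"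
      by (simp only: LIMSEQ_const_iff)
    then show "(\<integral>x. v x *\<^sub>R d\<phi> x \<partial>N) = - (\<integral>x. \<phi> x *\<^sub>R G x \<partial>N)"
      by (metis add.inverse_inverse eq_iff_diff_eq_0)
  qed
  with v(1) G(1) have vH: "v \<in> H1 D" by (intro H1I)
  \<comment> \<open>The limit of the gradients is a weak gradient of \<open>v\<close> but not
    necessarily the chosen one.\<close>
  have AE: "AE x in N. weak_grad D v x = G x"
    by (rule has_weak_gradient_unique[OF weak_grad(1)[OF vH] G(1) weak_grad(2)[OF vH] \<open>has_weak_gradient D v G\<close>])
  have G_eq: "L2_norm N (weak_grad D (lincomb 1 (X n) (-1) v)) = L2_norm N (\<lambda>x. ?G n x - G x)" for n
    unfolding G_diff[OF vH]
    by (rule L2_norm_cong_AE) (use AE in \<open>auto intro!: L2_measurable[OF L2_diff] weak_grad X vH G\<close>)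
  have "(\<lambda>n. H1_norm D (lincomb 1 (X n) (-1) v)) \<longlonglongrightarrow> 0"
  proof (rule Lim_null_comparison)
    show "(\<lambda>n. L2_norm N (\<lambda>x. X n x - v x) + L2_norm N (\<lambda>x. ?G n x - G x)) \<longlonglongrightarrow> 0"
      using tendsto_add[OF v(2) G(2)] by simp
    show "\<forall>\<^sub>F n in sequentially. norm (H1_norm D (lincomb 1 (X n) (-1) v)) \<le> L2_norm N (\<lambda>x. X n x - v x) + L2_norm N (\<lambda>x. ?G n x - G x)"
      using H1_norm_le[of "lincomb 1 (X _) (-1) v"] unfolding v_diff G_eq by (intro always_eventually allI) simp
  qed
  with vH show ?thesis by blast
qed

section \<open>The solution space is a closed subspace\<close>

lemma C1_function_lincomb:
  assumes "C1_function f" "C1_function (g :: real^'d \<Rightarrow> real)"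
  shows "C1_function (lincomb b f c g)"
proof -
  from assms obtain df dg where d: "\<And>x. GDERIV f x :> df x" "continuous_on UNIV df" "\<And>x. GDERIV g x :> dg x" "continuous_on UNIV dg"
    unfolding C1_function_def by blast
  have "GDERIV (lincomb b f c g) x :> (b *\<^sub>R df x + f x *\<^sub>R 0) + (c *\<^sub>R dg x + g x *\<^sub>R 0)" for x
    unfolding lincomb_def by (intro GDERIV_add GDERIV_mult GDERIV_const d)
  then have "GDERIV (lincomb b f c g) x :> b *\<^sub>R df x + c *\<^sub>R dg x" for x by simp
  moreover have "continuous_on UNIV (\<lambda>x. b *\<^sub>R df x + c *\<^sub>R dg x)" by (intro continuous_intros d)
  ultimately show ?thesis unfolding C1_function_def
    by (intro exI[of _ "\<lambda>x. b *\<^sub>R df x + c *\<^sub>R dg x"] conjI allI)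
qed

text \<open>Approximation within every \<open>e\<close> replaces approximating sequences, so linear
  combinations and limits of such functions require no diagonal sequences.\<close>

lemma vanishes_on_iff:
  "vanishes_on D \<Gamma> v \<longleftrightarrow> (\<forall>e>0. \<exists>\<phi>. C1_function \<phi> \<and> \<phi> \<in> H1 D \<and> \<phi> \<in> L2 (restrict_space surface_measure \<Gamma>) \<and>
     H1_norm D (lincomb 1 \<phi> (-1) v) < e \<and> L2_norm (restrict_space surface_measure \<Gamma>) \<phi> < e)"
  (is "_ \<longleftrightarrow> (\<forall>e>0. \<exists>\<phi>. ?P e \<phi>)")
proof
  let ?R = "restrict_space surface_measure \<Gamma>"
  assume "vanishes_on D \<Gamma> v"
  then obtain \<phi> :: "nat \<Rightarrow> real^'d \<Rightarrow> real" where \<phi>: "\<And>n. C1_function (\<phi> n) \<and> \<phi> n \<in> H1 D \<and> \<phi> n \<in> L2 ?R"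
    "(\<lambda>n. H1_norm D (lincomb 1 (\<phi> n) (-1) v)) \<longlonglongrightarrow> 0" "(\<lambda>n. L2_norm ?R (\<phi> n)) \<longlonglongrightarrow> 0"
    unfolding vanishes_on_def bd_trace_def lincomb_def by auto
  show "\<forall>e>0. \<exists>\<phi>. ?P e \<phi>"
  proof (intro allI impI)
    fix e :: real assume "e > 0"
    have "\<forall>\<^sub>F n in sequentially. H1_norm D (lincomb 1 (\<phi> n) (-1) v) < e \<and> L2_norm ?R (\<phi> n) < e"
      by (intro eventually_conj order_tendstoD(2)[OF \<phi>(2)] order_tendstoD(2)[OF \<phi>(3)] \<open>e > 0\<close>)
    from eventually_happens'[OF sequentially_bot this]
    show "\<exists>\<phi>. ?P e \<phi>" using \<phi>(1) by blast
  qed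
next
  let ?R = "restrict_space surface_measure \<Gamma>"
  assume "\<forall>e>0. \<exists>\<phi>. ?P e \<phi>"
  then have "\<exists>\<phi>. ?P (inverse (Suc n)) \<phi>" for n :: nat by (rule allE[of _ "inverse (Suc n)"]) simp
  then obtain \<phi> where \<phi>: "\<And>n. ?P (inverse (Suc n)) (\<phi> n)" by metis
  have 1: "(\<lambda>n. H1_norm D (lincomb 1 (\<phi> n) (-1) v)) \<longlonglongrightarrow> 0"
    by (rule Lim_null_comparison[OF _ LIMSEQ_inverse_real_of_nat]) (use \<phi> less_imp_le in \<open>auto intro!: always_eventually\<close>)
  have 2: "(\<lambda>n. L2_norm ?R (\<phi> n)) \<longlonglongrightarrow> 0"
    by (rule Lim_null_comparison[OF _ LIMSEQ_inverse_real_of_nat]) (use \<phi> less_imp_le in \<open>auto intro!: always_eventually\<close>)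
  show "vanishes_on D \<Gamma> v"
    unfolding vanishes_on_def bd_trace_def using \<phi> 1 2
    by (auto simp: L2_def lincomb_def intro!: exI[of _ \<phi>])
qed

lemma vanishes_on_lincomb:
  assumes "u \<in> H1 D" "v \<in> H1 D" "vanishes_on D \<Gamma> u" "vanishes_on D \<Gamma> v"
  shows "vanishes_on D \<Gamma> (lincomb b u c v)"
  unfolding vanishes_on_iff
proof (intro allI impI)
  fix e :: real assume e: "e > 0"
  \<comment> \<open>The 2 compensates the factor in \<open>H1_norm_lincomb_le\<close>; the added 1
    excludes a zero denominator and makes the final inequality strict.\<close>
  define d where "d = e / (2 * (\<bar>b\<bar> + \<bar>c\<bar> + 1))"
  have s: "\<bar>b\<bar> + \<bar>c\<bar> + 1 > 0" by linarith
  then have d: "d > 0" using e by (simp add: d_def)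
  have de: "2 * ((\<bar>b\<bar> + \<bar>c\<bar>) * d) < e" "(\<bar>b\<bar> + \<bar>c\<bar>) * d < e"
  proof -
    have "2 * (s * (e / (2 * s))) = e" if "s > 0" for s :: real using that by simp
    from this[OF s] have "2 * ((\<bar>b\<bar> + \<bar>c\<bar> + 1) * d) = e" by (simp only: d_def)
    then show "2 * ((\<bar>b\<bar> + \<bar>c\<bar>) * d) < e" using d by (simp add: algebra_simps)
    then show "(\<bar>b\<bar> + \<bar>c\<bar>) * d < e" using e by linarith
  qed
  let ?R = "restrict_space surface_measure \<Gamma>"
  obtain \<phi> where \<phi>: "C1_function \<phi>" "\<phi> \<in> H1 D" "\<phi> \<in> L2 ?R" "H1_norm D (lincomb 1 \<phi> (-1) u) < d" "L2_norm ?R \<phi> < d"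
    using assms(3) d unfolding vanishes_on_iff by blast
  obtain \<psi> where \<psi>: "C1_function \<psi>" "\<psi> \<in> H1 D" "\<psi> \<in> L2 ?R" "H1_norm D (lincomb 1 \<psi> (-1) v) < d" "L2_norm ?R \<psi> < d"
    using assms(4) d unfolding vanishes_on_iff by blast
  have "H1_norm D (lincomb 1 (lincomb b \<phi> c \<psi>) (-1) (lincomb b u c v)) = H1_norm D (lincomb b (lincomb 1 \<phi> (-1) u) c (lincomb 1 \<psi> (-1) v))"
    by (rule arg_cong[of _ _ "H1_norm D"]) (simp add: lincomb_def fun_eq_iff algebra_simps)
  also have "\<dots> \<le> 2 * (\<bar>b\<bar> * H1_norm D (lincomb 1 \<phi> (-1) u) + \<bar>c\<bar> * H1_norm D (lincomb 1 \<psi> (-1) v))"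
    by (intro H1_norm_lincomb_le H1_lincomb assms \<phi> \<psi>)
  also have "\<dots> \<le> 2 * (\<bar>b\<bar> * d + \<bar>c\<bar> * d)"
    using \<phi>(4) \<psi>(4) by (intro mult_left_mono add_mono) auto
  also have "\<dots> < e" using de(1) by (simp add: distrib_right)
  finally have 1: "H1_norm D (lincomb 1 (lincomb b \<phi> c \<psi>) (-1) (lincomb b u c v)) < e" .
  have "L2_norm ?R (lincomb b \<phi> c \<psi>) \<le> \<bar>b\<bar> * L2_norm ?R \<phi> + \<bar>c\<bar> * L2_norm ?R \<psi>"
    using L2_norm_triangle[OF \<phi>(3) \<psi>(3), of b c] by (simp add: lincomb_def)
  also have "\<dots> \<le> \<bar>b\<bar> * d + \<bar>c\<bar> * d"
    using \<phi>(5) \<psi>(5) by (intro mult_left_mono add_mono) auto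
  also have "\<dots> < e" using de(2) by (simp add: distrib_right)
  finally have 2: "L2_norm ?R (lincomb b \<phi> c \<psi>) < e" .
  have 3: "lincomb b \<phi> c \<psi> \<in> L2 ?R"
    using L2_lincomb[OF \<phi>(3) \<psi>(3), of b c] by (simp add: lincomb_def)
  show "\<exists>\<phi>. C1_function \<phi> \<and> \<phi> \<in> H1 D \<and> \<phi> \<in> L2 ?R \<and>
     H1_norm D (lincomb 1 \<phi> (-1) (lincomb b u c v)) < e \<and> L2_norm ?R \<phi> < e"
    using 1 2 3 C1_function_lincomb[OF \<phi>(1) \<psi>(1)] H1_lincomb[OF \<phi>(2) \<psi>(2)] by blast
qed

lemma vanishes_on_limit:
  assumes X: "\<And>n. X n \<in> H1 D" "\<And>n. vanishes_on D \<Gamma> (X n)" and v: "v \<in> H1 D"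
    and lim: "(\<lambda>n. H1_norm D (lincomb 1 (X n) (-1) v)) \<longlonglongrightarrow> 0"
  shows "vanishes_on D \<Gamma> v"
  unfolding vanishes_on_iff
proof (intro allI impI)
  fix e :: real assume e: "e > 0"
  let ?R = "restrict_space surface_measure \<Gamma>"
  have "\<forall>\<^sub>F n in sequentially. H1_norm D (lincomb 1 (X n) (-1) v) < e / 4"
    using e by (intro order_tendstoD(2)[OF lim]) auto
  from eventually_happens'[OF sequentially_bot this]
  obtain n where n: "H1_norm D (lincomb 1 (X n) (-1) v) < e / 4" by blast
  obtain \<phi> where \<phi>: "C1_function \<phi>" "\<phi> \<in> H1 D" "\<phi> \<in> L2 ?R" "H1_norm D (lincomb 1 \<phi> (-1) (X n)) < e / 4" "L2_norm ?R \<phi> < e / 4"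
    using X(2)[of n] e unfolding vanishes_on_iff by (meson zero_less_divide_iff zero_less_numeral)
  have "H1_norm D (lincomb 1 \<phi> (-1) v) = H1_norm D (lincomb 1 (lincomb 1 \<phi> (-1) (X n)) 1 (lincomb 1 (X n) (-1) v))"
    by (rule arg_cong[of _ _ "H1_norm D"]) (simp add: lincomb_def fun_eq_iff algebra_simps)
  also have "\<dots> \<le> 2 * (\<bar>1\<bar> * H1_norm D (lincomb 1 \<phi> (-1) (X n)) + \<bar>1\<bar> * H1_norm D (lincomb 1 (X n) (-1) v))"
    by (intro H1_norm_lincomb_le H1_lincomb X v \<phi>)
  also have "\<dots> < e" using n \<phi>(4) by simp
  finally show "\<exists>\<phi>. C1_function \<phi> \<and> \<phi> \<in> H1 D \<and> \<phi> \<in> L2 ?R \<and>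
     H1_norm D (lincomb 1 \<phi> (-1) v) < e \<and> L2_norm ?R \<phi> < e"
    using \<phi> e by (intro exI[of _ \<phi>]) auto
qed

lemma bvp_space_H1: "v \<in> bvp_space D \<Gamma>D \<Longrightarrow> v \<in> H1 D"
  by (simp add: bvp_space_def split: if_splits)

lemma bvp_space_lincomb:
  assumes "u \<in> bvp_space D \<Gamma>D" "v \<in> bvp_space D \<Gamma>D"
  shows "lincomb b u c v \<in> bvp_space D \<Gamma>D"
proof (cases "emeasure surface_measure \<Gamma>D = 0")
  case True
  with assms have *: "u \<in> H1 D" "v \<in> H1 D" "(\<integral>x. u x \<partial>N) = 0" "(\<integral>x. v x \<partial>N) = 0" by (auto simp: bvp_space_def)
  have "(\<integral>x. lincomb b u c v x \<partial>N) = 0"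
    unfolding lincomb_def using * L2_integrable_norm(1)[OF H1_L2] by simp
  then show ?thesis using True * H1_lincomb by (simp add: bvp_space_def)
next
  case False
  then show ?thesis using assms H1_lincomb vanishes_on_lincomb by (simp add: bvp_space_def)
qed

lemma zero_bvp_space: "(\<lambda>_. 0) \<in> bvp_space D \<Gamma>D"
proof -
  have "vanishes_on D \<Gamma>D (\<lambda>_. 0)"
    unfolding vanishes_on_iff
  proof (intro allI impI exI conjI)
    show "C1_function (\<lambda>_. 0::real)"
      unfolding C1_function_def by (intro exI[of _ "\<lambda>_. 0"]) (auto intro: GDERIV_const)
  qed (auto simp: zero_H1 L2_def lincomb_def H1_norm_zero L2_norm_def)
  then show ?thesis by (simp add: bvp_space_def zero_H1)
qed

text \<open>Both kinds of constraint, zero trace and zero mean, are continuous in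
  \<open>H1_norm\<close>. Closedness keeps the minimiser of the energy inside the solution
  space.\<close>

lemma bvp_space_limit:
  assumes X: "\<And>n. X n \<in> bvp_space D \<Gamma>D" and v: "v \<in> H1 D"
    and lim: "(\<lambda>n. H1_norm D (lincomb 1 (X n) (-1) v)) \<longlonglongrightarrow> 0"
  shows "v \<in> bvp_space D \<Gamma>D"
proof (cases "emeasure surface_measure \<Gamma>D = 0")
  case True
  with X have XH: "X n \<in> H1 D" "(\<integral>x. X n x \<partial>N) = 0" for n by (auto simp: bvp_space_def)
  have "(\<lambda>n. (\<integral>x. v x \<partial>N)) \<longlonglongrightarrow> 0"
  proof (rule Lim_null_comparison)
    show "(\<lambda>n. sqrt (measure N (space N)) * H1_norm D (lincomb 1 (X n) (-1) v)) \<longlonglongrightarrow> 0"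
      by (intro tendsto_mult_right_zero lim)
    show "\<forall>\<^sub>F n in sequentially. norm (\<integral>x. v x \<partial>N) \<le> sqrt (measure N (space N)) * H1_norm D (lincomb 1 (X n) (-1) v)"
    proof (rule always_eventually, rule allI)
      fix n
      have L: "lincomb 1 (X n) (-1) v \<in> L2 N" by (intro L2_lincomb_real H1_L2 XH v)
      have "(\<integral>x. lincomb 1 (X n) (-1) v x \<partial>N) = - (\<integral>x. v x \<partial>N)"
        unfolding lincomb_def using XH L2_integrable_norm(1)[OF H1_L2] v by simp
      then have "norm (\<integral>x. v x \<partial>N) = norm (\<integral>x. lincomb 1 (X n) (-1) v x \<partial>N)" by simp
      also have "\<dots> \<le> (\<integral>x. norm (lincomb 1 (X n) (-1) v x) \<partial>N)" by (rule integral_norm_bound)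
      also have "\<dots> \<le> sqrt (measure N (space N)) * L2_norm N (lincomb 1 (X n) (-1) v)"
        by (rule L2_integrable_norm(2)[OF L])
      also have "\<dots> \<le> sqrt (measure N (space N)) * H1_norm D (lincomb 1 (X n) (-1) v)"
        by (intro mult_left_mono L2_le_H1_norm) simp
      finally show "norm (\<integral>x. v x \<partial>N) \<le> sqrt (measure N (space N)) * H1_norm D (lincomb 1 (X n) (-1) v)" .
    qed
  qed
  then have "(\<integral>x. v x \<partial>N) = 0" by (simp only: LIMSEQ_const_iff)
  then show ?thesis using True v by (simp add: bvp_space_def)
next
  case False
  with X have "X n \<in> H1 D" "vanishes_on D \<Gamma>D (X n)" for n by (auto simp: bvp_space_def)
  from vanishes_on_limit[OF this v lim] show ?thesis using False v by (simp add: bvp_space_def)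
qed

end

section \<open>The weak problem\<close>

lemma Aexp_deriv_bound_range:
  fixes v :: "'a::real_inner"
  assumes v: "0 < c" "c \<le> norm v" "norm v \<le> d" and a: "0 \<le> a" "a \<le> d"
    and w: "\<And>k. k \<in> set p \<Longrightarrow> norm (w k) \<le> \<gamma> k"
  shows "\<bar>ev w \<xi> \<eta> (dexps p (Aexp a)) v\<bar>
    \<le> 6 * d * (fact (length p) * (5 / c) ^ length p * weight \<gamma> p) * (norm \<xi> * norm \<eta>)"
proof -
  have \<gamma>0: "0 \<le> \<gamma> k" if "k \<in> set p" for k using w[OF that] norm_ge_zero[of "w k"] by linarith
  have W0: "0 \<le> weight \<gamma> p" by (rule weight_nonneg[OF \<gamma>0])
  have v0: "v \<noteq> 0" "0 < norm v" using v by auto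
  have "5 / norm v \<le> 5 / c" using v v0 by (simp add: frac_le)
  then have "(5 / norm v) ^ length p \<le> (5 / c) ^ length p" using v0 by (intro power_mono) auto
  then have 1: "fact (length p) * (5 / norm v) ^ length p * weight \<gamma> p \<le> fact (length p) * (5 / c) ^ length p * weight \<gamma> p"
    using W0 by (intro mult_right_mono mult_left_mono) auto
  have 2: "3 * (a + norm v) \<le> 6 * d" using add_mono[OF a(2) v(3)] by simp
  have "0 \<le> fact (length p) * (5 / norm v) ^ length p * weight \<gamma> p" using W0 by simp
  then have "3 * (a + norm v) * (fact (length p) * (5 / norm v) ^ length p * weight \<gamma> p) * (norm \<xi> * norm \<eta>)
     \<le> 6 * d * (fact (length p) * (5 / c) ^ length p * weight \<gamma> p) * (norm \<xi> * norm \<eta>)"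
    using a v by (intro mult_right_mono mult_mono[OF 2 1]) auto
  with Aexp_deriv_bound[where p = p and \<gamma> = \<gamma> and \<xi> = \<xi> and \<eta> = \<eta>, OF v0(1) a(1) w] show ?thesis by linarith
qed

lemma ev_measurable:
  fixes V \<xi> \<eta> :: "'b \<Rightarrow> 'a::euclidean_space"
  assumes [measurable]: "V \<in> borel_measurable N" "\<xi> \<in> borel_measurable N" "\<eta> \<in> borel_measurable N"
    "\<And>k. (\<lambda>x. w k x) \<in> borel_measurable N"
  shows "(\<lambda>x. ev (\<lambda>k. w k x) (\<xi> x) (\<eta> x) e (V x)) \<in> borel_measurable N"
  by (induction e) simp_all

text \<open>At \<open>v = 0\<close> division by zero gives zero on both sides and only the multiple
  of the identity remains. The formula therefore holds at every point, and
  \<open>weak_solution\<close> can be rewritten without null sets.\<close>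

lemma Aexp_diffusion_matrix:
  fixes v :: "real^'d"
  shows "(diffusion_matrix a v *v \<xi>) \<bullet> \<eta> = ev w \<xi> \<eta> (Aexp a) v"
proof (cases "v = 0")
  case True
  have "outer_prod (0 :: real^'d) 0 = (0 :: real^'d^'d)" by (simp add: outer_prod_def vec_eq_iff)
  then show ?thesis
    using True by (simp add: diffusion_matrix_def Aexp_def scaleR_matrix_vector_assoc[symmetric])
qed (rule Aexp_diffusion_matrix_nonzero)

lemma L2_product_bound:
  assumes "\<xi> \<in> L2 N" "\<eta> \<in> L2 N" "f \<in> borel_measurable N" "0 \<le> C"
    and le: "AE x in N. \<bar>f x\<bar> \<le> C * (norm (\<xi> x) * norm (\<eta> x))"
  shows "integrable N f" "\<bar>\<integral>x. f x \<partial>N\<bar> \<le> C * (L2_norm N \<xi> * L2_norm N \<eta>)"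
proof -
  have int: "integrable N (\<lambda>x. C * (norm (\<xi> x) * norm (\<eta> x)))"
    by (intro integrable_mult_right L2_integrable_mult assms)
  show f: "integrable N f"
  proof (rule Bochner_Integration.integrable_bound[OF int assms(3)])
    show "AE x in N. norm (f x) \<le> norm (C * (norm (\<xi> x) * norm (\<eta> x)))"
      using le by eventually_elim simp
  qed
  have "\<bar>\<integral>x. f x \<partial>N\<bar> \<le> (\<integral>x. \<bar>f x\<bar> \<partial>N)" using integral_norm_bound[of N f] by simp
  also have "\<dots> \<le> (\<integral>x. C * (norm (\<xi> x) * norm (\<eta> x)) \<partial>N)"
    by (rule integral_mono_AE) (use f int le in auto)
  also have "\<dots> = C * (\<integral>x. norm (\<xi> x) * norm (\<eta> x) \<partial>N)" by simp
  also have "\<dots> \<le> C * (L2_norm N \<xi> * L2_norm N \<eta>)"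
    by (intro mult_left_mono L2_Cauchy_Schwarz assms)
  finally show "\<bar>\<integral>x. f x \<partial>N\<bar> \<le> C * (L2_norm N \<xi> * L2_norm N \<eta>)" .
qed

text \<open>Of the expansion of the field only its affine dependence on each parameter is kept, as
  \<open>V_shift\<close>. The bounds hold for every parameter in \<open>Q\<close>, with an
  exceptional null set in \<open>D\<close> that may depend on it.\<close>

locale diffusion_problem = bounded_open D for D :: "(real^'d) set" +
  fixes \<Gamma>D :: "(real^'d) set" and V :: "real^'d \<Rightarrow> (nat \<Rightarrow> real) \<Rightarrow> real^'d" and w :: "nat \<Rightarrow> real^'d \<Rightarrow> real^'d"
    and I :: "nat set" and Q :: "(nat \<Rightarrow> real) set" and \<gamma> :: "nat \<Rightarrow> real" and a am aM cV :: real
  assumes V_measurable: "\<And>y. y \<in> Q \<Longrightarrow> (\<lambda>x. V x y) \<in> borel_measurable N"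
    and w_measurable: "\<And>k. w k \<in> borel_measurable N"
    and V_range: "\<And>y. y \<in> Q \<Longrightarrow> AE x in N. am \<le> norm (V x y) \<and> norm (V x y) \<le> aM"
    and w_bound: "\<And>k. k \<in> I \<Longrightarrow> AE x in N. norm (w k x) \<le> \<gamma> k"
    and V_shift: "\<And>k x y h. k \<in> I \<Longrightarrow> V x (y(k := y k + h)) = V x y + h *\<^sub>R w k x"
    and finite_I: "finite I"
    and param_open: "\<And>y k. y \<in> Q \<Longrightarrow> k \<in> I \<Longrightarrow> \<forall>\<^sub>F h in nhds 0. y(k := y k + h) \<in> Q"
    and a_range: "0 < am" "am \<le> a" "a \<le> aM"
    and \<gamma>_nonneg: "\<And>k. k \<in> I \<Longrightarrow> 0 \<le> \<gamma> k"
    and cV: "0 < cV" "\<And>v. v \<in> bvp_space D \<Gamma>D \<Longrightarrow> cV * H1_norm D v \<le> L2_norm N (weak_grad D v)"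
begin

abbreviation "S \<equiv> bvp_space D \<Gamma>D"

definition nn :: "(real^'d \<Rightarrow> real) \<Rightarrow> real" where
  "nn v = L2_norm N (weak_grad D v)"

definition kernel where
  "kernel y q u v x = ev (\<lambda>k. w k x) (weak_grad D u x) (weak_grad D v x) (dexps q (Aexp a)) (V x y)"

definition form where
  "form y q u v = (\<integral>x. kernel y q u v x \<partial>N)"

text \<open>Supplies the constants of \<open>parametric_forms\<close>: \<open>K\<close> is
  \<open>6 * aM\<close> and \<open>\<kappa>\<close> is \<open>5 / am\<close>.\<close>

definition bound where
  "bound q = 6 * aM * (fact (length q) * (5 / am) ^ length q * weight \<gamma> q)"

lemma a_pos: "0 < a" "0 < aM"
  using a_range by auto

lemma bound_nonneg: "set q \<subseteq> I \<Longrightarrow> 0 \<le> bound q"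
  using a_range a_pos \<gamma>_nonneg unfolding bound_def
  by (intro mult_nonneg_nonneg weight_nonneg) auto

lemma S_H1: "v \<in> S \<Longrightarrow> v \<in> H1 D"
  by (rule bvp_space_H1)

lemma nn_nonneg: "0 \<le> nn v"
  by (simp add: nn_def)

lemma nn_le_H1: "nn v \<le> H1_norm D v"
  unfolding nn_def by (rule L2_le_H1_norm)

lemma H1_le_nn: "v \<in> S \<Longrightarrow> H1_norm D v \<le> nn v / cV"
  using cV by (simp add: nn_def field_simps)

lemma AE_w_bound: "AE x in N. \<forall>k\<in>I. norm (w k x) \<le> \<gamma> k"
  by (rule AE_finite_allI[OF finite_I w_bound])

lemma kernel_measurable:
  assumes "y \<in> Q" "u \<in> H1 D" "v \<in> H1 D"
  shows "kernel y q u v \<in> borel_measurable N"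
  unfolding kernel_def
  by (intro ev_measurable V_measurable assms w_measurable L2_measurable[OF weak_grad(1)])

lemma AE_kernel_bound:
  assumes "y \<in> Q" "set q \<subseteq> I"
  shows "AE x in N. \<bar>kernel y q u v x\<bar> \<le> bound q * (norm (weak_grad D u x) * norm (weak_grad D v x))"
  using AE_w_bound V_range[OF assms(1)]
proof eventually_elim
  case (elim x)
  then show ?case
    unfolding kernel_def bound_def using a_range a_pos assms(2)
    by (intro Aexp_deriv_bound_range) auto
qed

lemma kernel_integrable:
  assumes "y \<in> Q" "set q \<subseteq> I" "u \<in> H1 D" "v \<in> H1 D"
  shows "integrable N (kernel y q u v)"
  by (rule L2_product_bound(1)[OF weak_grad(1) weak_grad(1) kernel_measurable bound_nonneg AE_kernel_bound])
    (rule assms)+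

lemma form_bound:
  assumes "y \<in> Q" "set q \<subseteq> I" "u \<in> H1 D" "v \<in> H1 D"
  shows "\<bar>form y q u v\<bar> \<le> bound q * (nn u * nn v)"
  unfolding form_def nn_def
  by (rule L2_product_bound(2)[OF weak_grad(1) weak_grad(1) kernel_measurable bound_nonneg AE_kernel_bound])
    (rule assms)+

lemma AE_V_nonzero: "y \<in> Q \<Longrightarrow> AE x in N. V x y \<noteq> 0"
  using V_range by (rule eventually_mono) (use a_range in auto)

lemma form_lincomb_left:
  assumes y: "y \<in> Q" "set q \<subseteq> I" and H: "u \<in> H1 D" "v \<in> H1 D" "z \<in> H1 D"
  shows "form y q (lincomb b u c v) z = b * form y q u z + c * form y q v z"
proof -
  have "form y q (lincomb b u c v) z = (\<integral>x. b * kernel y q u z x + c * kernel y q v z x \<partial>N)"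
    unfolding form_def
  proof (rule integral_cong_AE)
    show "AE x in N. kernel y q (lincomb b u c v) z x = b * kernel y q u z x + c * kernel y q v z x"
      using weak_grad_lincomb[OF H(1,2), of b c] AE_V_nonzero[OF y(1)]
      by eventually_elim (simp add: kernel_def Aexp_linear_left)
  qed (use kernel_measurable[OF y(1)] H H1_lincomb in auto)
  also have "\<dots> = b * form y q u z + c * form y q v z"
    unfolding form_def using kernel_integrable[OF y] H by simp
  finally show ?thesis .
qed

lemma form_lincomb_right:
  assumes y: "y \<in> Q" "set q \<subseteq> I" and H: "u \<in> H1 D" "v \<in> H1 D" "z \<in> H1 D"
  shows "form y q z (lincomb b u c v) = b * form y q z u + c * form y q z v"
proof -
  have "form y q z (lincomb b u c v) = (\<integral>x. b * kernel y q z u x + c * kernel y q z v x \<partial>N)"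
    unfolding form_def
  proof (rule integral_cong_AE)
    show "AE x in N. kernel y q z (lincomb b u c v) x = b * kernel y q z u x + c * kernel y q z v x"
      using weak_grad_lincomb[OF H(1,2), of b c] AE_V_nonzero[OF y(1)]
      by eventually_elim (simp add: kernel_def Aexp_linear_right)
  qed (use kernel_measurable[OF y(1)] H H1_lincomb in auto)
  also have "\<dots> = b * form y q z u + c * form y q z v"
    unfolding form_def using kernel_integrable[OF y] H by simp
  finally show ?thesis .
qed

lemma form_commute: "form y [] u v = form y [] v u"
  unfolding form_def kernel_def by (simp add: Aexp_sym[of _ "weak_grad D u _"])

lemma form_coercive:
  assumes y: "y \<in> Q" and v: "v \<in> H1 D"
  shows "am * (nn v)\<^sup>2 \<le> form y [] v v"
proof -
  have "am * (nn v)\<^sup>2 = (\<integral>x. am * (norm (weak_grad D v x))\<^sup>2 \<partial>N)"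
    by (simp add: nn_def L2_norm_square)
  also have "\<dots> \<le> form y [] v v"
    unfolding form_def
  proof (rule integral_mono_AE)
    show "integrable N (\<lambda>x. am * (norm (weak_grad D v x))\<^sup>2)"
      by (intro integrable_mult_right L2_integrable weak_grad v)
    show "integrable N (kernel y [] v v)" by (rule kernel_integrable) (use y v in auto)
    show "AE x in N. am * (norm (weak_grad D v x))\<^sup>2 \<le> kernel y [] v v x"
      using V_range[OF y] AE_V_nonzero[OF y]
      by eventually_elim (use a_range in \<open>auto simp: kernel_def intro: Aexp_coercive\<close>)
  qed
  finally show ?thesis .
qed

lemma form_remainder:
  assumes y: "y \<in> Q" and k: "k \<in> I"
  shows "\<exists>\<delta>>0. \<forall>q. set q \<subseteq> I \<longrightarrow>
       (\<exists>C. \<forall>h v z. \<bar>h\<bar> < \<delta> \<longrightarrow> y(k := y k + h) \<in> Q \<longrightarrow> v \<in> S \<longrightarrow> z \<in> S \<longrightarrow>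
         \<bar>form (y(k := y k + h)) q v z - form y q v z - h * form y (k # q) v z\<bar> \<le> C * (nn v * nn z) * h\<^sup>2)"
proof (intro exI conjI allI impI)
  \<comment> \<open>Makes \<bar>h\<bar> times \<open>\<gamma> k\<close> at most
    \<open>am / 2\<close>, as \<open>Aexp_remainder\<close> demands; the added 1 covers
    \<open>\<gamma> k = 0\<close>.\<close>
  let ?\<delta> = "am / (2 * (\<gamma> k + 1))"
  have g: "\<gamma> k \<ge> 0" using \<gamma>_nonneg k by simp
  show "0 < ?\<delta>" using a_range g by simp
  fix q h v z
  let ?yh = "y(k := y k + h)"
  let ?C = "9 * aM * (fact (length q + 2) * (10 / am) ^ (length q + 2) * (\<gamma> k * (\<gamma> k * weight \<gamma> q)))"
  assume q: "set q \<subseteq> I" and h: "\<bar>h\<bar> < ?\<delta>" and yh: "?yh \<in> Q" and "v \<in> S" "z \<in> S"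
  then have H: "v \<in> H1 D" "z \<in> H1 D" by (auto intro: S_H1)
  have kq: "set (k # q) \<subseteq> I" using k q by simp
  have hg: "\<bar>h\<bar> * \<gamma> k \<le> am / 2"
  proof -
    have "\<bar>h\<bar> * \<gamma> k \<le> ?\<delta> * (\<gamma> k + 1)" using h g by (intro mult_mono) auto
    also have "\<dots> = am / 2" using g by (simp add: field_simps)
    finally show ?thesis .
  qed
  have W: "weight \<gamma> q \<ge> 0" using \<gamma>_nonneg q by (intro weight_nonneg) auto
  let ?f = "\<lambda>x. kernel ?yh q v z x - kernel y q v z x - h * kernel y (k # q) v z x"
  have eq: "form ?yh q v z - form y q v z - h * form y (k # q) v z = (\<integral>x. ?f x \<partial>N)"
    unfolding form_def using kernel_integrable[OF yh q H] kernel_integrable[OF y q H] kernel_integrable[OF y kq H] by simp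
  have le: "\<bar>\<integral>x. ?f x \<partial>N\<bar> \<le> (?C * h\<^sup>2) * (L2_norm N (weak_grad D v) * L2_norm N (weak_grad D z))"
  proof (rule L2_product_bound(2)[OF weak_grad(1)[OF H(1)] weak_grad(1)[OF H(2)]])
    show "?f \<in> borel_measurable N"
      using kernel_measurable[OF yh H] kernel_measurable[OF y H] by simp
    show "0 \<le> ?C * h\<^sup>2" using a_pos a_range g W by (intro mult_nonneg_nonneg) auto
    show "AE x in N. \<bar>?f x\<bar> \<le> ?C * h\<^sup>2 * (norm (weak_grad D v x) * norm (weak_grad D z x))"
      using AE_w_bound V_range[OF y]
    proof eventually_elim
      case (elim x)
      have "\<bar>?f x\<bar> \<le> ?C * (norm (weak_grad D v x) * norm (weak_grad D z x)) * h\<^sup>2"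
        unfolding kernel_def V_shift[OF k]
        by (rule Aexp_remainder[of am "V x y" aM a k q "\<lambda>k. w k x" \<gamma> h "weak_grad D v x" "weak_grad D z x"])
          (use elim a_range a_pos hg kq in auto)
      then show ?case by (simp only: mult_ac)
    qed
  qed
  have "c * h\<^sup>2 * l = c * l * h\<^sup>2" for c l :: real
    by (metis mult.assoc mult.commute)
  from le[unfolded this[of ?C]] show "\<bar>form ?yh q v z - form y q v z - h * form y (k # q) v z\<bar> \<le> ?C * (nn v * nn z) * h\<^sup>2"
    unfolding eq nn_def .
qed

lemma semi_inner_form: "y \<in> Q \<Longrightarrow> semi_inner S (form y [])"
proof
  assume y: "y \<in> Q"
  show "S \<noteq> {}" using zero_bvp_space by blast
  show "lincomb b u c v \<in> S" if "u \<in> S" "v \<in> S" for u v b c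
    using that by (rule bvp_space_lincomb)
  show "form y [] (lincomb b u c v) z = b * form y [] u z + c * form y [] v z" if "u \<in> S" "v \<in> S" "z \<in> S" for u v z b c
    using y that by (intro form_lincomb_left S_H1) auto
  show "form y [] u v = form y [] v u" for u v by (rule form_commute)
  show "0 \<le> form y [] v v" if "v \<in> S" for v
  proof -
    have "0 \<le> am * (nn v)\<^sup>2" using a_range by simp
    with form_coercive[OF y S_H1[OF that]] show ?thesis by linarith
  qed
qed

text \<open>Completeness in the energy: coercivity and \<open>cV\<close> make energy-Cauchy
  sequences Cauchy in \<open>H1_norm\<close>, the limit stays in the closed space \<open>S\<close>,
  and boundedness of the form leads back to the energy.\<close>

lemma form_solvable:
  assumes y: "y \<in> Q" and G: "\<And>v z b c. v \<in> S \<Longrightarrow> z \<in> S \<Longrightarrow> G (lincomb b v c z) = b * G v + c * G z"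
    and G_bound: "\<And>v. v \<in> S \<Longrightarrow> \<bar>G v\<bar> \<le> C * nn v"
  shows "\<exists>u\<in>S. \<forall>v\<in>S. form y [] u v = G v"
proof -
  interpret semi_inner S "form y []" by (rule semi_inner_form[OF y])
  have nn_le: "nn v \<le> sqrt (form y [] v v / am)" if "v \<in> S" for v
  proof (rule real_le_rsqrt)
    show "(nn v)\<^sup>2 \<le> form y [] v v / am"
      using form_coercive[OF y S_H1[OF that]] a_range by (simp add: field_simps)
  qed
  show ?thesis
  proof (rule Riesz_representation[where C = "\<bar>C\<bar> / sqrt am"])
    fix v assume v: "v \<in> S"
    have "\<bar>G v\<bar> \<le> C * nn v" by (rule G_bound[OF v])
    also have "\<dots> \<le> \<bar>C\<bar> * nn v" by (intro mult_right_mono nn_nonneg) simp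
    also have "\<dots> \<le> \<bar>C\<bar> * sqrt (form y [] v v / am)" by (intro mult_left_mono nn_le v) simp
    finally show "\<bar>G v\<bar> \<le> \<bar>C\<bar> / sqrt am * sqrt (form y [] v v)" by (simp add: real_sqrt_divide)
  next
    fix X :: "nat \<Rightarrow> real^'d \<Rightarrow> real"
    assume X: "\<And>n. X n \<in> S"
      and Cauchy: "\<And>e. e > 0 \<Longrightarrow> \<exists>k. \<forall>m\<ge>k. \<forall>n\<ge>k. form y [] (lincomb 1 (X m) (-1) (X n)) (lincomb 1 (X m) (-1) (X n)) < e"
    have "\<exists>l\<in>H1 D. (\<lambda>n. H1_norm D (lincomb 1 (X n) (-1) l)) \<longlonglongrightarrow> 0"
    proof (rule H1_complete)
      fix e :: real assume e: "e > 0"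
      have "am * (cV * e)\<^sup>2 > 0" using a_range cV e by simp
      from Cauchy[OF this] obtain k where k: "\<And>m n. m \<ge> k \<Longrightarrow> n \<ge> k \<Longrightarrow>
         form y [] (lincomb 1 (X m) (-1) (X n)) (lincomb 1 (X m) (-1) (X n)) < am * (cV * e)\<^sup>2" by blast
      have "H1_norm D (lincomb 1 (X m) (-1) (X n)) < e" if "m \<ge> k" "n \<ge> k" for m n
      proof -
        let ?z = "lincomb 1 (X m) (-1) (X n)"
        have z: "?z \<in> S" by (intro lincomb_in X)
        have "am * (nn ?z)\<^sup>2 < am * (cV * e)\<^sup>2"
          using form_coercive[OF y S_H1[OF z]] k[OF that] by linarith
        then have "(nn ?z)\<^sup>2 < (cV * e)\<^sup>2" using a_range by simp
        then have "nn ?z < cV * e" by (rule power_less_imp_less_base) (use cV e in simp)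
        then have "nn ?z / cV < e" using cV by (simp add: field_simps)
        with H1_le_nn[OF z] show ?thesis by linarith
      qed
      then show "\<exists>k. \<forall>m\<ge>k. \<forall>n\<ge>k. H1_norm D (lincomb 1 (X m) (-1) (X n)) < e" by blast
    qed (rule S_H1[OF X])
    then obtain l where l: "l \<in> H1 D" "(\<lambda>n. H1_norm D (lincomb 1 (X n) (-1) l)) \<longlonglongrightarrow> 0" by blast
    have lS: "l \<in> S" by (rule bvp_space_limit[OF X l])
    have "(\<lambda>n. form y [] (lincomb 1 (X n) (-1) l) (lincomb 1 (X n) (-1) l)) \<longlonglongrightarrow> 0"
    proof (rule Lim_null_comparison)
      show "(\<lambda>n. bound [] * (H1_norm D (lincomb 1 (X n) (-1) l) * H1_norm D (lincomb 1 (X n) (-1) l))) \<longlonglongrightarrow> 0"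
        by (intro tendsto_mult_right_zero tendsto_mult_zero l)
      show "\<forall>\<^sub>F n in sequentially. norm (form y [] (lincomb 1 (X n) (-1) l) (lincomb 1 (X n) (-1) l))
         \<le> bound [] * (H1_norm D (lincomb 1 (X n) (-1) l) * H1_norm D (lincomb 1 (X n) (-1) l))"
      proof (rule always_eventually, rule allI)
        fix n
        let ?z = "lincomb 1 (X n) (-1) l"
        have z: "?z \<in> H1 D" by (intro S_H1 lincomb_in X lS)
        have "norm (form y [] ?z ?z) \<le> bound [] * (nn ?z * nn ?z)"
          using form_bound[OF y, of "[]", OF _ z z] by simp
        also have "\<dots> \<le> bound [] * (H1_norm D ?z * H1_norm D ?z)"
          by (intro mult_left_mono mult_mono nn_le_H1 bound_nonneg) (simp_all add: nn_nonneg)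
        finally show "norm (form y [] ?z ?z) \<le> bound [] * (H1_norm D ?z * H1_norm D ?z)" .
      qed
    qed
    with lS show "\<exists>l\<in>S. (\<lambda>n. form y [] (lincomb 1 (X n) (-1) l) (lincomb 1 (X n) (-1) l)) \<longlonglongrightarrow> 0" by blast
  qed (rule G)
qed

lemma weak_solution_iff_form:
  "weak_solution D \<Gamma>D \<Gamma>N (\<lambda>x. diffusion_matrix a (V x y)) f g u \<longleftrightarrow>
     u \<in> S \<and> (\<forall>v\<in>S. form y [] u v = f v + g (bd_trace D \<Gamma>N v))"
  unfolding weak_solution_def form_def kernel_def dexps_simps(1) Aexp_diffusion_matrix[symmetric] ..

text \<open>One factor \<open>1 / cV\<close> arises when the load is bounded by the gradient norm
  \<open>nn\<close>, the other when the result is turned back into a bound on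
  \<open>H1_norm\<close>; hence the square of \<open>cV\<close>.\<close>

theorem parametric_regularity:
  assumes F: "\<And>v z b c. v \<in> S \<Longrightarrow> z \<in> S \<Longrightarrow> F (lincomb b v c z) = b * F v + c * F z"
    and F_bound: "\<And>v. v \<in> S \<Longrightarrow> \<bar>F v\<bar> \<le> F0 * H1_norm D v" and F0: "0 \<le> F0"
    and u: "\<And>y. y \<in> Q \<Longrightarrow> \<exists>z\<in>S. \<forall>v\<in>S. form y [] z v = F v \<Longrightarrow> u y \<in> S \<and> (\<forall>v\<in>S. form y [] (u y) v = F v)"
    and y: "y \<in> Q" and p: "set p \<subseteq> I"
  shows "\<exists>z. has_iter_partial S (H1_norm D) p u y z \<and>
    H1_norm D z \<le> weight \<gamma> p * (fact (length p) * ((5 / am) ^ length p * (F0 / (am * cV\<^sup>2) * (1 + 6 * aM / am) ^ length p)))"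
proof -
  have F_bound': "\<bar>F v\<bar> \<le> F0 / cV * nn v" if "v \<in> S" for v
  proof -
    have "\<bar>F v\<bar> \<le> F0 * H1_norm D v" by (rule F_bound[OF that])
    also have "\<dots> \<le> F0 * (nn v / cV)" by (intro mult_left_mono H1_le_nn that F0)
    finally show ?thesis by simp
  qed
  \<comment> \<open>The assumption on \<open>u\<close> is conditional on solvability, which
    \<open>form_solvable\<close> provides.\<close>
  have sol: "u y \<in> S \<and> (\<forall>v\<in>S. form y [] (u y) v = F v)" if "y \<in> Q" for y
    by (rule u[OF that form_solvable[OF that F F_bound']])
  interpret parametric_forms S nn form Q I "6 * aM" "5 / am" am "F0 / cV" \<gamma> F u
    by (rule parametric_forms.intro[OF bvp_space_lincomb nn_nonneg form_lincomb_left[OF _ _ S_H1 S_H1 S_H1]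
          form_lincomb_right[OF _ _ S_H1 S_H1 S_H1] form_bound[OF _ _ S_H1 S_H1, unfolded bound_def]
          form_coercive[OF _ S_H1] form_remainder param_open form_solvable _ _ _ _ \<gamma>_nonneg F_bound'])
      (use a_range a_pos F0 cV(1) sol in auto)
  obtain U where U: "derivative_family U" using derivative_family_exists by blast
  have H: "H1_norm D v \<le> 1 / cV * nn v" if "v \<in> S" for v using H1_le_nn[OF that] by simp
  have "has_iter_partial S (H1_norm D) p u y (U y p)"
    by (rule U_iter_partial[OF U _ H y p]) simp
  moreover have "H1_norm D (U y p) \<le> weight \<gamma> p * (fact (length p) * ((5 / am) ^ length p * (F0 / (am * cV\<^sup>2) * (1 + 6 * aM / am) ^ length p)))"
  proof -
    have "H1_norm D (U y p) \<le> 1 / cV * nn (U y p)" by (rule H[OF U_in[OF U y p]])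
    also have "\<dots> \<le> 1 / cV * (weight \<gamma> p * (fact (length p) * ((5 / am) ^ length p * (F0 / cV / am * (1 + 6 * aM / am) ^ length p))))"
      by (rule mult_left_mono[OF U_bound[OF U y p]]) (use cV in simp)
    also have "\<dots> = weight \<gamma> p * (fact (length p) * ((5 / am) ^ length p * (1 / cV * (F0 / cV / am) * (1 + 6 * aM / am) ^ length p)))"
      by (simp only: mult_ac)
    also have "1 / cV * (F0 / cV / am) = F0 / (am * cV\<^sup>2)"
      by (simp add: power2_eq_square mult_ac)
    finally show ?thesis .
  qed
  ultimately show ?thesis by blast
qed

end

section \<open>Regularity in the parameters\<close>

text \<open>Two norms are kept apart for the trace space: \<open>nrm\<close> is the infimum norm of
  the trace and \<open>n\<close> the Sobolev norm of a function having it. The scaled function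
  competes in the infimum, which yields the scaling inequality. The constant \<open>C\<close> makes
  the supremum finite.\<close>

lemma dual_norm_bound:
  assumes hom: "\<And>b v. v \<in> X \<Longrightarrow> F (r b v) = b * F v" and rX: "\<And>b v. v \<in> X \<Longrightarrow> r b v \<in> X"
    and nrm: "\<And>b v. v \<in> X \<Longrightarrow> 0 \<le> b \<Longrightarrow> nrm (r b v) \<le> b * n v" "\<And>v. v \<in> X \<Longrightarrow> nrm v \<le> n v" "\<And>v. v \<in> X \<Longrightarrow> 0 \<le> nrm v" "\<And>v. v \<in> X \<Longrightarrow> 0 \<le> n v"
    and C: "\<And>v. v \<in> X \<Longrightarrow> \<bar>F v\<bar> \<le> C * nrm v" and v: "v \<in> X"
  shows "\<bar>F v\<bar> \<le> dual_norm X nrm F * n v" "0 \<le> dual_norm X nrm F"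
proof -
  have bdd: "bdd_above {\<bar>F v\<bar> | v. v \<in> X \<and> nrm v \<le> 1}"
  proof (rule bdd_aboveI)
    fix z assume "z \<in> {\<bar>F v\<bar> | v. v \<in> X \<and> nrm v \<le> 1}"
    then obtain v where v: "z = \<bar>F v\<bar>" "v \<in> X" "nrm v \<le> 1" by blast
    have "z \<le> C * nrm v" using C v by simp
    also have "\<dots> \<le> \<bar>C\<bar> * nrm v" using nrm(3)[OF v(2)] by (intro mult_right_mono) auto
    also have "\<dots> \<le> \<bar>C\<bar> * 1" using v(3) by (intro mult_left_mono) auto
    finally show "z \<le> \<bar>C\<bar>" by simp
  qed
  have upper: "\<bar>F v\<bar> \<le> dual_norm X nrm F" if "v \<in> X" "nrm v \<le> 1" for v
    unfolding dual_norm_def by (rule cSup_upper[OF _ bdd]) (use that in blast)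
  have "nrm (r 0 v) \<le> 1" using nrm(1)[OF v, of 0] by simp
  from upper[OF rX[OF v] this] show "0 \<le> dual_norm X nrm F" by linarith
  show "\<bar>F v\<bar> \<le> dual_norm X nrm F * n v"
  proof (cases "n v = 0")
    \<comment> \<open>No normalisation is possible here, but \<open>nrm v\<close> vanishes as well
      and \<open>C\<close> forces \<open>F v = 0\<close>.\<close>
    case True
    then have "nrm v = 0" using nrm(2,3)[OF v] by simp
    then show ?thesis using C[OF v] True by simp
  next
    case False
    then have n: "n v > 0" using nrm(4)[OF v] by simp
    have "nrm (r (1 / n v) v) \<le> 1" using nrm(1)[OF v, of "1 / n v"] n by simp
    from upper[OF rX[OF v] this] have "\<bar>1 / n v * F v\<bar> \<le> dual_norm X nrm F" by (simp only: hom[OF v])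
    then show ?thesis using n by (simp add: abs_mult field_simps)
  qed
qed

context bounded_open
begin

lemma H1_dual_bound:
  assumes f: "f \<in> H1_dual D" and v: "v \<in> H1 D"
  shows "\<bar>f v\<bar> \<le> H1_dual_norm D f * H1_norm D v" "0 \<le> H1_dual_norm D f"
proof -
  from f obtain C where lin: "\<And>v w b c. v \<in> H1 D \<Longrightarrow> w \<in> H1 D \<Longrightarrow> f (\<lambda>x. b * v x + c * w x) = b * f v + c * f w"
    and C: "\<And>v. v \<in> H1 D \<Longrightarrow> \<bar>f v\<bar> \<le> C * H1_norm D v"
    unfolding H1_dual_def by blast
  have hom: "f (\<lambda>x. b * v x) = b * f v" if "v \<in> H1 D" for b v
    using lin[OF that that, of b 0] by simp
  have r: "(\<lambda>x. b * v x) \<in> H1 D" if "v \<in> H1 D" for b v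
    using H1_lincomb[OF that that, of b 0] by (simp add: lincomb_def)
  have n: "H1_norm D (\<lambda>x. b * v x) \<le> b * H1_norm D v" if "v \<in> H1 D" "0 \<le> b" for b v
    using H1_norm_cmult[OF that(1), of b] that(2) by simp
  note * = dual_norm_bound[where X = "H1 D" and F = f and r = "\<lambda>b v x. b * v x" and nrm = "H1_norm D" and n = "H1_norm D",
      OF hom r n _ _ _ C v]
  show "\<bar>f v\<bar> \<le> H1_dual_norm D f * H1_norm D v" "0 \<le> H1_dual_norm D f"
    unfolding H1_dual_norm_def by (rule *; simp)+
qed

lemma Hhalf_norm_trace:
  assumes "v \<in> H1 D"
  shows "Hhalf_norm D \<Gamma> (bd_trace D \<Gamma> v) \<le> H1_norm D v" "0 \<le> Hhalf_norm D \<Gamma> (bd_trace D \<Gamma> v)"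
proof -
  let ?A = "{H1_norm D v' | v'. v' \<in> H1 D \<and> bd_trace D \<Gamma> v' = bd_trace D \<Gamma> v}"
  have A: "H1_norm D v \<in> ?A" using assms by blast
  have "bdd_below ?A" by (rule bdd_belowI[of _ 0]) auto
  then show "Hhalf_norm D \<Gamma> (bd_trace D \<Gamma> v) \<le> H1_norm D v"
    unfolding Hhalf_norm_def by (rule cInf_lower[OF A])
  show "0 \<le> Hhalf_norm D \<Gamma> (bd_trace D \<Gamma> v)"
    unfolding Hhalf_norm_def by (rule cInf_greatest) (use A in auto)
qed

text \<open>Pulls the supremum over traces back to functions, for which scaling is
  available.\<close>

lemma dual_norm_image: "dual_norm (h ` X) nrm g = dual_norm X (\<lambda>v. nrm (h v)) (\<lambda>v. g (h v))"
proof -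
  have "{\<bar>g v\<bar> | v. v \<in> h ` X \<and> nrm v \<le> 1} = {\<bar>g (h v)\<bar> | v. v \<in> X \<and> nrm (h v) \<le> 1}" by blast
  then show ?thesis by (simp add: dual_norm_def)
qed

lemma Hhalf_dual_bound:
  assumes g: "g \<in> Hhalf_dual D \<Gamma>" and v: "v \<in> H1 D"
  shows "\<bar>g (bd_trace D \<Gamma> v)\<bar> \<le> Hhalf_dual_norm D \<Gamma> g * H1_norm D v" "0 \<le> Hhalf_dual_norm D \<Gamma> g"
proof -
  let ?t = "bd_trace D \<Gamma>"
  from g obtain C where lin: "\<And>v w b c. v \<in> H1 D \<Longrightarrow> w \<in> H1 D \<Longrightarrow> g (?t (\<lambda>x. b * v x + c * w x)) = b * g (?t v) + c * g (?t w)"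
    and C: "\<And>w. w \<in> Hhalf D \<Gamma> \<Longrightarrow> \<bar>g w\<bar> \<le> C * Hhalf_norm D \<Gamma> w"
    unfolding Hhalf_dual_def by blast
  have hom: "g (?t (\<lambda>x. b * v x)) = b * g (?t v)" if "v \<in> H1 D" for b v
    using lin[OF that that, of b 0] by simp
  have r: "(\<lambda>x. b * v x) \<in> H1 D" if "v \<in> H1 D" for b v
    using H1_lincomb[OF that that, of b 0] by (simp add: lincomb_def)
  have n: "Hhalf_norm D \<Gamma> (?t (\<lambda>x. b * v x)) \<le> b * H1_norm D v" if "v \<in> H1 D" "0 \<le> b" for b v
    using H1_norm_cmult[OF that(1), of b] that(2) Hhalf_norm_trace(1)[OF r[OF that(1)], of \<Gamma> b] by simp
  have C': "\<bar>g (?t v)\<bar> \<le> C * Hhalf_norm D \<Gamma> (?t v)" if "v \<in> H1 D" for v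
    using that by (intro C) (auto simp: Hhalf_def)
  note * = dual_norm_bound[where X = "H1 D" and F = "\<lambda>v. g (?t v)" and r = "\<lambda>b v x. b * v x"
      and nrm = "\<lambda>v. Hhalf_norm D \<Gamma> (?t v)" and n = "H1_norm D", OF hom r n Hhalf_norm_trace(1) Hhalf_norm_trace(2) _ C' v]
  show "\<bar>g (?t v)\<bar> \<le> Hhalf_dual_norm D \<Gamma> g * H1_norm D v" "0 \<le> Hhalf_dual_norm D \<Gamma> g"
    unfolding Hhalf_dual_norm_def Hhalf_def dual_norm_image by (rule *; simp)+
qed

end

section \<open>Multi-indices as lists and the parameter box\<close>

lemma multi_index_list_Suc:
  "multi_index_list (Suc M) \<alpha> = multi_index_list M \<alpha> @ replicate (\<alpha> (Suc M)) (Suc M)"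
  by (simp add: multi_index_list_def)

lemma multi_index_list_zero: "multi_index_list 0 \<alpha> = []"
  by (simp add: multi_index_list_def)

lemma set_multi_index_list: "set (multi_index_list M \<alpha>) \<subseteq> {1..M}"
  by (auto simp: multi_index_list_def)

lemma length_multi_index_list: "length (multi_index_list M \<alpha>) = mi_abs M \<alpha>"
  by (induction M) (auto simp: multi_index_list_Suc multi_index_list_zero mi_abs_def)

lemma weight_replicate: "weight \<gamma> (replicate n k) = \<gamma> k ^ n"
  by (induction n) auto

lemma weight_multi_index_list: "weight \<gamma> (multi_index_list M \<alpha>) = mi_power M \<gamma> \<alpha>"
  by (induction M) (auto simp: multi_index_list_Suc multi_index_list_zero mi_power_def weight_replicate)

text \<open>Each active coordinate can be moved both ways. On a face of the box a two-sided
  difference quotient would leave the set on which \<open>u\<close> is prescribed.\<close>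

definition interior_box :: "nat \<Rightarrow> (nat \<Rightarrow> real) set" where
  "interior_box M = {y \<in> param_box. \<forall>k\<in>{1..M}. -1 < y k \<and> y k < 1}"

lemma interior_box_open:
  assumes y: "y \<in> interior_box M" and k: "k \<in> {1..M}"
  shows "\<forall>\<^sub>F h in nhds 0. y(k := y k + h) \<in> interior_box M"
proof -
  have "((\<lambda>h. y k + h) \<longlongrightarrow> y k + 0) (nhds 0)" by (intro tendsto_intros) (simp add: filterlim_ident)
  then have "\<forall>\<^sub>F h in nhds 0. -1 < y k + h \<and> y k + h < 1"
    using y k by (intro eventually_conj order_tendstoD) (auto simp: interior_box_def)
  then show ?thesis
  proof eventually_elim
    case (elim h)
    then show ?case
      using y k unfolding interior_box_def param_box_def by (auto simp: PiE_iff extensional_def)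
  qed
qed

lemma prob_space_uniform: "prob_space (uniform_measure lborel {-1..1::real})"
  by (rule prob_space_uniform_measure) auto

lemma AE_interior_box: "AE y in param_measure. y \<in> interior_box M"
proof -
  have "AE y in param_measure. y k \<in> {-1<..<1}" if "k \<in> {1..}" for k :: nat
    unfolding param_measure_def
  proof (rule AE_PiM_component[OF prob_space_uniform that])
    have "AE t in lborel. t \<noteq> 1 \<and> t \<noteq> (-1::real)"
      by (intro AE_conjI AE_lborel_singleton)
    then have "AE t in lborel. t \<in> {-1..1} \<longrightarrow> t \<in> {-1<..<1::real}"
      by (rule eventually_mono) (auto simp: less_le)
    then show "AE t in uniform_measure lborel {-1..1}. t \<in> {-1<..<1::real}"
      by (intro AE_uniform_measureI) auto
  qed
  then have "AE y in param_measure. \<forall>k\<in>{1..}. y k \<in> {-1<..<1}"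
    by (simp add: AE_ball_countable)
  moreover have "AE y in param_measure. y \<in> space param_measure" by (rule AE_space)
  ultimately show ?thesis
  proof eventually_elim
    case (elim y)
    then have "y \<in> extensional {1..}" by (auto simp: param_measure_def space_PiM PiE_def)
    with elim show ?case by (force simp: interior_box_def param_box_def PiE_iff)
  qed
qed

text \<open>The cylinder of width \<open>e\<close> around \<open>y\<close> in the first
  \<open>M\<close> coordinates has positive measure, a product of \<open>M\<close> positive factors,
  so it meets every set of full measure.\<close>

lemma AE_param_near:
  assumes y: "y \<in> interior_box M" and e: "e > 0" and P: "AE z in param_measure. P z"
  shows "\<exists>z. P z \<and> (\<forall>k\<in>{1..M}. \<bar>z k - y k\<bar> < e)"
proof -
  let ?U = "uniform_measure lborel {-1..1::real}"
  let ?J = "\<lambda>k. {y k - e<..<y k + e}"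
  let ?E = "prod_emb {1..} (\<lambda>_. ?U) {1..M} (Pi\<^sub>E {1..M} ?J)"
  have "emeasure param_measure ?E = (\<Prod>k\<in>{1..M}. emeasure ?U (?J k))"
    unfolding param_measure_def by (rule emeasure_PiM_emb) (auto intro: prob_space_uniform)
  moreover have "(\<Prod>k\<in>{1..M}. emeasure ?U (?J k)) \<noteq> 0"
  proof -
    have nz: "emeasure ?U (?J k) \<noteq> 0" if k: "k \<in> {1..M}" for k
    proof -
      let ?l = "max (-1) (y k - e)" and ?r = "min 1 (y k + e)"
      have "-1 < y k" "y k < 1" using y k by (auto simp: interior_box_def)
      then have lt: "?l < ?r" using e by auto
      have "0 < emeasure lborel {?l<..<?r}" using lt by simp
      also have "\<dots> \<le> emeasure lborel ({-1..1} \<inter> ?J k)" by (rule emeasure_mono) auto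
      finally have "emeasure lborel ({-1..1} \<inter> ?J k) \<noteq> 0" by simp
      then show ?thesis by (simp add: ennreal_divide_eq_0_iff)
    qed
    have "(\<And>k. k \<in> A \<Longrightarrow> f k \<noteq> 0) \<Longrightarrow> finite A \<Longrightarrow> prod f A \<noteq> (0::ennreal)" for f and A :: "nat set"
      by (induction A rule: infinite_finite_induct) auto
    from this[where A = "{1..M}" and f = "\<lambda>k. emeasure ?U (?J k)"] nz show ?thesis by blast
  qed
  ultimately have E: "emeasure param_measure ?E \<noteq> 0" by simp
  have "\<exists>z\<in>?E. P z"
  proof (rule ccontr)
    assume "\<not> ?thesis"
    then have "AE z in param_measure. z \<notin> ?E" using P by (auto elim: eventually_mono)
    moreover have "?E \<in> sets param_measure"
      unfolding param_measure_def by (rule sets_PiM_I) auto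
    ultimately have "?E \<in> null_sets param_measure" by (simp add: AE_iff_null_sets)
    with E show False by (auto simp: null_sets_def)
  qed
  then obtain z where z: "z \<in> ?E" "P z" by blast
  have "\<bar>z k - y k\<bar> < e" if k: "k \<in> {1..M}" for k
  proof -
    have "z k \<in> ?J k" using z(1) k by (auto simp: prod_emb_def PiE_iff)
    then show ?thesis by auto
  qed
  with z(2) show ?thesis by blast
qed

text \<open>Almost every parameter is a limit of good parameters, and \<open>V\<close> is continuous in the
  parameter.\<close>

lemma AE_range_interior_box:
  fixes \<psi>0 :: "'a \<Rightarrow> real^'d"
  assumes bounds: "AE z in param_measure. AE x in N. c \<le> norm (param_field M \<psi>0 \<sigma> \<psi> x z) \<and> norm (param_field M \<psi>0 \<sigma> \<psi> x z) \<le> d"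
    and y: "y \<in> interior_box M"
  shows "AE x in N. c \<le> norm (param_field M \<psi>0 \<sigma> \<psi> x y) \<and> norm (param_field M \<psi>0 \<sigma> \<psi> x y) \<le> d"
proof -
  let ?V = "param_field M \<psi>0 \<sigma> \<psi>"
  have "\<exists>z. (AE x in N. c \<le> norm (?V x z) \<and> norm (?V x z) \<le> d) \<and> (\<forall>k\<in>{1..M}. \<bar>z k - y k\<bar> < inverse (Suc n))" for n :: nat
    by (rule AE_param_near[OF y _ bounds]) simp
  then have "\<exists>z. \<forall>n. (AE x in N. c \<le> norm (?V x (z n)) \<and> norm (?V x (z n)) \<le> d) \<and> (\<forall>k\<in>{1..M}. \<bar>z n k - y k\<bar> < inverse (Suc n))"
    by (intro choice allI)
  then obtain z where z: "\<And>n. AE x in N. c \<le> norm (?V x (z n)) \<and> norm (?V x (z n)) \<le> d"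
    "\<And>n k. k \<in> {1..M} \<Longrightarrow> \<bar>z n k - y k\<bar> < inverse (Suc n)" by blast
  have lim: "(\<lambda>n. z n k) \<longlonglongrightarrow> y k" if k: "k \<in> {1..M}" for k
  proof -
    have "(\<lambda>n. z n k - y k) \<longlonglongrightarrow> 0"
    proof (rule Lim_null_comparison[OF always_eventually LIMSEQ_inverse_real_of_nat], rule allI)
      fix n show "norm (z n k - y k) \<le> inverse (real (Suc n))"
        using less_imp_le[OF z(2)[OF k, of n]] by simp
    qed
    then show ?thesis by (rule LIM_zero_cancel)
  qed
  have "AE x in N. \<forall>n. c \<le> norm (?V x (z n)) \<and> norm (?V x (z n)) \<le> d"
    using z(1) by (simp add: AE_all_countable)
  then show ?thesis
  proof eventually_elim
    case (elim x)
    have "(\<lambda>n. norm (?V x (z n))) \<longlonglongrightarrow> norm (?V x y)"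
      unfolding param_field_def by (intro tendsto_intros lim)
    from LIMSEQ_le_const[OF this, of c] LIMSEQ_le_const2[OF this, of d] elim show ?case by simp
  qed
qed

text \<open>Joint measurability, part of \<open>Linf_Bochner\<close>, makes the integral over the
  sample point measurable in the remaining variable; the factors are swapped so that the integrated
  one comes second.\<close>

lemma mean_field_measurable:
  assumes P: "prob_space P" and V: "V \<in> Linf_Bochner P N"
  shows "mean_field P V \<in> borel_measurable N"
proof -
  interpret prob_space P by (rule P)
  have "case_prod V \<in> borel_measurable (P \<Otimes>\<^sub>M N)" using V by (simp add: Linf_Bochner_def)
  from measurable_compose[OF measurable_Pair[OF measurable_snd measurable_fst] this]
  have "(\<lambda>(x, \<omega>). V \<omega> x) \<in> borel_measurable (N \<Otimes>\<^sub>M P)" by (simp add: split_beta')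
  then have "(\<lambda>x. \<integral>\<omega>. V \<omega> x \<partial>P) \<in> borel_measurable N" by (rule borel_measurable_lebesgue_integral)
  then show ?thesis by (simp add: mean_field_def[abs_def])
qed

text \<open>Compares the constants found with those claimed. The ratio \<open>5 / am\<close> is
  below the factor in the claimed weights because 5 * ln 2 \<le> 4. With \<open>B\<close> the base
  of the claimed power, both \<open>F0 / (am * cV\<^sup>2)\<close> and the ratio
  \<open>1 + 6 * aM / am\<close> are at most \<open>B\<close>; the former accounts for the extra
  power in the exponent \<open>n + 1\<close>.\<close>

lemma regularity_constant_bound:
  fixes am aM cV F0 cA W :: real
  assumes c: "0 < am" "am \<le> 1" "1 \<le> aM" "0 < cV" "cV \<le> 1" "0 \<le> F0" "0 \<le> W"
    and cA: "cA = (2 * aM) * (6 * aM\<^sup>2 / am\<^sup>2)"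
  shows "W * (fact n * ((5 / am) ^ n * (F0 / (am * cV\<^sup>2) * (1 + 6 * aM / am) ^ n)))
    \<le> fact n * ((4 * aM\<^sup>2 / (am\<^sup>2 * ln 2)) ^ n * W) * (aM / (am * cV\<^sup>2) * max (2 * cA) F0) ^ (n + 1)"
proof -
  define B where "B = aM / (am * cV\<^sup>2) * max (2 * cA) F0"
  have aM2: "1 \<le> aM\<^sup>2" using c by (simp add: one_le_power)
  have cV2: "0 < cV\<^sup>2" "cV\<^sup>2 \<le> 1" using c by (auto simp: power_le_one)
  have \<kappa>: "5 / am \<le> 4 * aM\<^sup>2 / (am\<^sup>2 * ln 2)"
  proof -
    have ln2: "0 < ln (2::real)" "5 * ln (2::real) \<le> 4" using ln2_le_25_over_36 by auto
    have "5 * (am * ln 2) \<le> 4 * am" using mult_left_mono[OF ln2(2), of am] c by (simp add: algebra_simps)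
    also have "\<dots> \<le> 4 * 1" using c by simp
    also have "\<dots> \<le> 4 * aM\<^sup>2" using aM2 by simp
    finally show ?thesis using c ln2 by (simp add: field_simps power2_eq_square)
  qed
  have q: "0 \<le> aM / (am * cV\<^sup>2)" using c by simp
  have B1: "F0 / (am * cV\<^sup>2) \<le> B"
  proof -
    have "F0 / (am * cV\<^sup>2) \<le> aM * F0 / (am * cV\<^sup>2)"
      using c mult_right_mono[of 1 aM F0] by (intro divide_right_mono) auto
    also have "\<dots> = aM / (am * cV\<^sup>2) * F0" by simp
    also have "\<dots> \<le> B" unfolding B_def by (rule mult_left_mono[OF _ q]) simp
    finally show ?thesis .
  qed
  \<comment> \<open>The 7 arises from 1 + 6 * aM / am \<le> 7 * aM / am; the maximum in the claim
    contains \<open>2 * cA\<close> to dominate this growth.\<close>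
  have cA7: "7 \<le> 2 * cA"
  proof -
    have "1 * 1 \<le> aM * (aM\<^sup>2 / am\<^sup>2)"
      using c aM2 by (intro mult_mono) (auto simp: field_simps intro: order_trans[OF power_le_one])
    then show ?thesis unfolding cA by simp
  qed
  have B2: "1 + 6 * aM / am \<le> B"
  proof -
    have "1 + 6 * aM / am \<le> aM / am * 7" using c by (simp add: field_simps)
    also have "\<dots> \<le> aM / (am * cV\<^sup>2) * (2 * cA)"
    proof (rule mult_mono[OF _ cA7])
      have "am * cV\<^sup>2 \<le> am * 1" using c cV2 by (intro mult_left_mono) auto
      then show "aM / am \<le> aM / (am * cV\<^sup>2)" using c cV2 by (intro divide_left_mono) auto
    qed (use q in auto)
    also have "\<dots> \<le> B" unfolding B_def by (rule mult_left_mono[OF _ q]) simp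
    finally show ?thesis .
  qed
  have pos: "0 \<le> F0 / (am * cV\<^sup>2)" "0 \<le> 1 + 6 * aM / am" "0 \<le> 5 / am" using c by auto
  have B0: "0 \<le> B" using B1 pos(1) by linarith
  have 1: "F0 / (am * cV\<^sup>2) * (1 + 6 * aM / am) ^ n \<le> B * B ^ n"
    by (rule mult_mono[OF B1 power_mono[OF B2 pos(2)] B0]) (use pos in simp)
  have 2: "(5 / am) ^ n \<le> (4 * aM\<^sup>2 / (am\<^sup>2 * ln 2)) ^ n" by (rule power_mono[OF \<kappa> pos(3)])
  have "0 \<le> (4 * aM\<^sup>2 / (am\<^sup>2 * ln 2)) ^ n" by simp
  moreover have "0 \<le> F0 / (am * cV\<^sup>2) * (1 + 6 * aM / am) ^ n"
    by (rule mult_nonneg_nonneg[OF pos(1) zero_le_power[OF pos(2)]])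
  ultimately have "(5 / am) ^ n * (F0 / (am * cV\<^sup>2) * (1 + 6 * aM / am) ^ n) \<le> (4 * aM\<^sup>2 / (am\<^sup>2 * ln 2)) ^ n * (B * B ^ n)"
    by (rule mult_mono[OF 2 1])
  then have "W * (fact n * ((5 / am) ^ n * (F0 / (am * cV\<^sup>2) * (1 + 6 * aM / am) ^ n)))
    \<le> W * (fact n * ((4 * aM\<^sup>2 / (am\<^sup>2 * ln 2)) ^ n * (B * B ^ n)))"
    using c by (intro mult_left_mono) auto
  also have "\<dots> = fact n * ((4 * aM\<^sup>2 / (am\<^sup>2 * ln 2)) ^ n * W) * B ^ (n + 1)" by simp
  finally show ?thesis by (simp only: B_def)
qed

theorem theorem4p7:
  fixes P :: "'o measure"
    and D \<Gamma>D \<Gamma>N :: "(real^'d) set"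
    and V :: "'o \<Rightarrow> real^'d \<Rightarrow> real^'d"
    and M :: nat
    and lam \<sigma> \<gamma> \<mu> :: "nat \<Rightarrow> real"
    and \<psi> :: "nat \<Rightarrow> real^'d \<Rightarrow> real^'d"
    and Y :: "nat \<Rightarrow> 'o \<Rightarrow> real"
    and Vy :: "real^'d \<Rightarrow> (nat \<Rightarrow> real) \<Rightarrow> real^'d"
    and A :: "real^'d \<Rightarrow> (nat \<Rightarrow> real) \<Rightarrow> real^'d^'d"
    and a a_min a_max c_V c_A :: real
    and f :: "(real^'d \<Rightarrow> real) \<Rightarrow> real"
    and g :: "(real^'d \<Rightarrow> real) set \<Rightarrow> real"
    and u :: "(nat \<Rightarrow> real) \<Rightarrow> real^'d \<Rightarrow> real"
  assumes prob: "prob_space P" "complete_measure P" "separable_measure_space P"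
    and dom: "Lipschitz_domain D" "bounded D"
    and field: "V \<in> Linf_Bochner P (lebesgue_on D)"
    and eigenvalues: "\<And>k. k \<in> {1..M} \<Longrightarrow> lam k > 0"
    and eigenfunctions: "\<And>k. k \<in> {1..M} \<Longrightarrow> \<psi> k \<in> L2 (lebesgue_on D)"
      "\<And>k. k \<in> {1..M} \<Longrightarrow>
         AE x in lebesgue_on D. cov_operator P (lebesgue_on D) V (\<psi> k) x = lam k *\<^sub>R \<psi> k x"
    and orthonormal: "\<And>j k. j \<in> {1..M} \<Longrightarrow> k \<in> {1..M} \<Longrightarrow>
         (\<integral>x. \<psi> j x \<bullet> \<psi> k x \<partial>lebesgue_on D) = (if j = k then 1 else 0)"
    and Y_def: "Y = (\<lambda>k. KL_coord P (lebesgue_on D) V (lam k) (\<psi> k))"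
    and Y_indep: "prob_space.indep_vars P (\<lambda>_. borel) Y {1..M}"
    and Y_uniform: "\<And>k. k \<in> {1..M} \<Longrightarrow>
         distr P borel (Y k) = uniform_measure lborel {- sqrt 3..sqrt 3}"
    and \<sigma>_def: "\<sigma> = (\<lambda>k. sqrt (3 * lam k))"
    and \<gamma>_fin: "\<And>k. k \<in> {1..M} \<Longrightarrow>
         Linf_norm (lebesgue_on D) (\<lambda>x. \<sigma> k *\<^sub>R \<psi> k x) < \<infinity>"
    and \<gamma>_def: "\<gamma> = (\<lambda>k. real_of_ereal (Linf_norm (lebesgue_on D) (\<lambda>x. \<sigma> k *\<^sub>R \<psi> k x)))"
    and Vy_def: "Vy = param_field M (mean_field P V) \<sigma> \<psi>"
    and finite_rank: "AE \<omega> in P. AE x in lebesgue_on D. V \<omega> x = Vy x (\<lambda>k. Y k \<omega> / sqrt 3)"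
    and constants: "0 < a_min" "a_min \<le> 1" "1 \<le> a_max" "a_min \<le> a" "a \<le> a_max"
    and Vy_bounds: "AE y in param_measure. AE x in lebesgue_on D.
         a_min \<le> norm (Vy x y) \<and> norm (Vy x y) \<le> a_max"
    and A_def: "A = (\<lambda>x y. diffusion_matrix a (Vy x y))"
    and boundary: "boundary_decomposition D \<Gamma>D \<Gamma>N"
    and f_dual: "f \<in> H1_dual D"
    and g_dual: "g \<in> Hhalf_dual D \<Gamma>N"
    and compat: "emeasure surface_measure \<Gamma>D = 0 \<Longrightarrow> f (\<lambda>_. 1) = - g (bd_trace D \<Gamma>N (\<lambda>_. 1))"
    and c_V: "0 < c_V" "c_V \<le> 1"
      "\<And>v. v \<in> bvp_space D \<Gamma>D \<Longrightarrow>
         c_V * H1_norm D v \<le> L2_norm (lebesgue_on D) (weak_grad D v) \<and>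
         L2_norm (lebesgue_on D) (weak_grad D v) \<le> H1_norm D v"
    and \<mu>_def: "\<mu> = (\<lambda>k. 4 * a_max\<^sup>2 / (a_min\<^sup>2 * ln 2) * \<gamma> k)"
    and c_A_def: "c_A = (2 * a_max) * (6 * a_max\<^sup>2 / a_min\<^sup>2)"
    and solution: "\<And>y. y \<in> param_box \<Longrightarrow>
         (\<exists>w. weak_solution D \<Gamma>D \<Gamma>N (\<lambda>x. A x y) f g w) \<Longrightarrow>
         weak_solution D \<Gamma>D \<Gamma>N (\<lambda>x. A x y) f g (u y)"
  shows "AE y in param_measure. \<forall>\<alpha> :: nat \<Rightarrow> nat.
     \<exists>w. has_mixed_partial (bvp_space D \<Gamma>D) (H1_norm D) M \<alpha> u y w \<and>
         H1_norm D w \<le> fact (mi_abs M \<alpha>) * mi_power M \<mu> \<alpha> *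
           (a_max / (a_min * c_V\<^sup>2) *
              max (2 * c_A) (H1_dual_norm D f + Hhalf_dual_norm D \<Gamma>N g)) ^ (mi_abs M \<alpha> + 1)"
proof -
  let ?N = "lebesgue_on D"
  let ?I = "{1..M}"
  \<comment> \<open>Extended by zero, since measurability of the directions is required for every
    index.\<close>
  define w where "w k x = (if k \<in> ?I then \<sigma> k *\<^sub>R \<psi> k x else 0)" for k x
  define F where "F v = f v + g (bd_trace D \<Gamma>N v)" for v
  define F0 where "F0 = H1_dual_norm D f + Hhalf_dual_norm D \<Gamma>N g"
  have D: "open D" "D \<noteq> {}" using dom(1) by (auto simp: Lipschitz_domain_def)
  interpret bounded_open D by (rule bounded_open.intro[OF D(1) dom(2)])
  have w_bound: "AE x in ?N. norm (w k x) \<le> \<gamma> k" if k: "k \<in> ?I" for k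
  proof -
    have "AE x in ?N. ereal (norm (\<sigma> k *\<^sub>R \<psi> k x)) \<le> Linf_norm ?N (\<lambda>x. \<sigma> k *\<^sub>R \<psi> k x)"
      unfolding Linf_norm_def by (rule esssup_AE)
    then show ?thesis
    proof eventually_elim
      case (elim x)
      then have "Linf_norm ?N (\<lambda>x. \<sigma> k *\<^sub>R \<psi> k x) \<noteq> - \<infinity>" by auto
      with \<gamma>_fin[OF k] obtain r where r: "Linf_norm ?N (\<lambda>x. \<sigma> k *\<^sub>R \<psi> k x) = ereal r"
        by (cases "Linf_norm ?N (\<lambda>x. \<sigma> k *\<^sub>R \<psi> k x)") auto
      with elim k show ?case by (simp add: \<gamma>_def w_def)
    qed
  qed
  \<comment> \<open>An essential supremum of norms could be negative only over a null measure, but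
    \<open>D\<close> is open and nonempty.\<close>
  have \<gamma>_nonneg: "0 \<le> \<gamma> k" if k: "k \<in> ?I" for k
  proof (rule ccontr)
    assume neg: "\<not> 0 \<le> \<gamma> k"
    from w_bound[OF k] have "AE x in ?N. False"
      by (rule eventually_mono) (use neg norm_ge_zero in \<open>auto dest: order_trans[OF norm_ge_zero]\<close>)
    then have "AE x in ?N. x \<notin> D" by (rule eventually_mono) simp
    moreover have "D \<in> sets ?N" using sets.top[of ?N] by (simp add: space_N)
    ultimately have "D \<in> null_sets ?N" by (simp add: AE_iff_null_sets)
    then have "emeasure lebesgue D = 0" using D by (auto simp: null_sets_def emeasure_restrict_space)
    then have "D \<in> null_sets lebesgue" using D by (simp add: null_sets_def)
    then have "negligible D" by (simp add: negligible_iff_null_sets)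
    with D show False using open_not_negligible by blast
  qed
  have V_shift: "Vy x (y(k := y k + h)) = Vy x y + h *\<^sub>R w k x" if k: "k \<in> ?I" for k x y h
  proof -
    have "(\<Sum>j\<in>?I. (\<sigma> j * (y(k := y k + h)) j) *\<^sub>R \<psi> j x)
       = (\<Sum>j\<in>?I. (\<sigma> j * y j) *\<^sub>R \<psi> j x + (if j = k then h *\<^sub>R w k x else 0))"
      using k by (intro sum.cong) (auto simp: w_def algebra_simps scaleR_add_left)
    then show ?thesis using k by (simp add: Vy_def param_field_def sum.distrib)
  qed
  have \<psi>_measurable: "\<psi> k \<in> borel_measurable ?N" if "k \<in> ?I" for k
    by (rule L2_measurable[OF eigenfunctions(1)[OF that]])
  interpret diffusion_problem D \<Gamma>D Vy w ?I "interior_box M" \<gamma> a a_min a_max c_V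
  proof
    show "w k \<in> borel_measurable ?N" for k
    proof (cases "k \<in> ?I")
      case True
      then have "w k = (\<lambda>x. \<sigma> k *\<^sub>R \<psi> k x)" by (simp add: w_def fun_eq_iff)
      then show ?thesis using borel_measurable_scaleR[OF borel_measurable_const \<psi>_measurable[OF True]] by simp
    next
      case False
      then have "w k = (\<lambda>x. 0)" by (auto simp: w_def fun_eq_iff)
      then show ?thesis by simp
    qed
    show "(\<lambda>x. Vy x y) \<in> borel_measurable ?N" for y
      unfolding Vy_def param_field_def
      by (rule borel_measurable_add[OF mean_field_measurable[OF prob(1) field] borel_measurable_sum],
          rule borel_measurable_scaleR[OF borel_measurable_const \<psi>_measurable])
    show "AE x in ?N. a_min \<le> norm (Vy x y) \<and> norm (Vy x y) \<le> a_max" if "y \<in> interior_box M" for y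
      using AE_range_interior_box[OF Vy_bounds[unfolded Vy_def] that] unfolding Vy_def .
    show "AE x in ?N. norm (w k x) \<le> \<gamma> k" if "k \<in> ?I" for k by (rule w_bound[OF that])
    show "Vy x (y(k := y k + h)) = Vy x y + h *\<^sub>R w k x" if "k \<in> ?I" for k x y h by (rule V_shift[OF that])
    show "\<forall>\<^sub>F h in nhds 0. y(k := y k + h) \<in> interior_box M" if "y \<in> interior_box M" "k \<in> ?I" for y k
      using that by (rule interior_box_open)
    show "0 \<le> \<gamma> k" if "k \<in> ?I" for k by (rule \<gamma>_nonneg[OF that])
    show "c_V * H1_norm D v \<le> L2_norm ?N (weak_grad D v)" if "v \<in> bvp_space D \<Gamma>D" for v
      using c_V(3)[OF that] by simp
  qed (use constants c_V(1) in simp_all)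
  have F_lin: "F (lincomb b v c z) = b * F v + c * F z" if "v \<in> S" "z \<in> S" for v z b c
    using f_dual g_dual S_H1[OF that(1)] S_H1[OF that(2)]
    unfolding F_def lincomb_def H1_dual_def Hhalf_dual_def by (simp add: algebra_simps)
  have F_bound: "\<bar>F v\<bar> \<le> F0 * H1_norm D v" if "v \<in> S" for v
    using H1_dual_bound(1)[OF f_dual S_H1[OF that]] Hhalf_dual_bound(1)[OF g_dual S_H1[OF that]]
    unfolding F_def F0_def distrib_right by linarith
  have F0: "0 \<le> F0"
    unfolding F0_def using H1_dual_bound(2)[OF f_dual zero_H1] Hhalf_dual_bound(2)[OF g_dual zero_H1] by simp
  have u: "u y \<in> S \<and> (\<forall>v\<in>S. form y [] (u y) v = F v)"
    if y: "y \<in> interior_box M" and ex: "\<exists>z\<in>S. \<forall>v\<in>S. form y [] z v = F v" for y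
  proof -
    have "y \<in> param_box" using y by (simp add: interior_box_def)
    moreover have "\<exists>z. weak_solution D \<Gamma>D \<Gamma>N (\<lambda>x. A x y) f g z"
      using ex unfolding A_def weak_solution_iff_form F_def by blast
    ultimately have "weak_solution D \<Gamma>D \<Gamma>N (\<lambda>x. A x y) f g (u y)" by (rule solution)
    then show ?thesis unfolding A_def weak_solution_iff_form F_def .
  qed
  have main: "\<exists>z. has_mixed_partial S (H1_norm D) M \<alpha> u y z \<and>
         H1_norm D z \<le> fact (mi_abs M \<alpha>) * mi_power M \<mu> \<alpha> *
           (a_max / (a_min * c_V\<^sup>2) *
              max (2 * c_A) (H1_dual_norm D f + Hhalf_dual_norm D \<Gamma>N g)) ^ (mi_abs M \<alpha> + 1)"
    if y: "y \<in> interior_box M" for y and \<alpha> :: "nat \<Rightarrow> nat"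
  proof -
    let ?p = "multi_index_list M \<alpha>"
    let ?n = "mi_abs M \<alpha>"
    obtain z where z: "has_iter_partial S (H1_norm D) ?p u y z"
      "H1_norm D z \<le> weight \<gamma> ?p * (fact (length ?p) * ((5 / a_min) ^ length ?p * (F0 / (a_min * c_V\<^sup>2) * (1 + 6 * a_max / a_min) ^ length ?p)))"
      using parametric_regularity[OF F_lin F_bound F0 u y set_multi_index_list] by blast
    have W: "0 \<le> weight \<gamma> ?p"
      by (rule weight_nonneg) (use \<gamma>_nonneg set_multi_index_list in blast)
    \<comment> \<open>\<open>\<mu>\<close> is a constant multiple of \<open>\<gamma>\<close>, and
      the constant comes out once per differentiation.\<close>
    have \<mu>: "mi_power M \<mu> \<alpha> = (4 * a_max\<^sup>2 / (a_min\<^sup>2 * ln 2)) ^ ?n * weight \<gamma> ?p"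
      unfolding weight_multi_index_list[symmetric] \<mu>_def weight_cmult length_multi_index_list ..
    have "H1_norm D z \<le> fact ?n * mi_power M \<mu> \<alpha> * (a_max / (a_min * c_V\<^sup>2) * max (2 * c_A) F0) ^ (?n + 1)"
      using order_trans[OF z(2)[unfolded length_multi_index_list]
          regularity_constant_bound[OF constants(1-3) c_V(1,2) F0 W c_A_def]] unfolding \<mu> .
    with z(1) show ?thesis unfolding F0_def has_mixed_partial_def by blast
  qed
  \<comment> \<open>The exceptional set, the complement of the interior box, is the same for all
    multi-indices.\<close>
  from AE_interior_box[of M] show ?thesis
    by (rule eventually_mono) (use main in blast)
qed

end
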